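(* Let $u_0,\rho_0\in H^s(\mathbb{T}^1)$, let $F,B,U,R$ be the homogenized functions and $F_h,B_h,U_h,R_h$ the numerical approximations defined in the context. If $s\ge2$, then the approximations $U_h(\cdot,\tau,\cdot)$ and $R_h(\cdot,\tau,\cdot)$ converge (as $h\to0$) to $U(\cdot,\tau,\cdot)$ and $R(\cdot,\tau,\cdot)$ in $L^1\big([0,T)\times\mathbb{T}^1\big)$ for any $\tau\in\mathbb{T}^1$. Furthermore, if $s\ge3$, the local truncation errors of the numerical scheme defining $F_h$ and $B_h$ are first order accurate, i.e. they are $\mathcal{O}(h+k)$.
   Context: $\mathbb{T}^1=\mathbb{R}/2\pi\mathbb{Z}$, and $\gamma$ is a fixed constant (the adiabatic coefficient). $T>0$ is an existence time, independent of $\epsilon>0$, for the weakly compressible 1D isentropic Euler system on $\mathbb{T}^1\times[0,T)$: $$\partial_tu^\epsilon+\tfrac12\partial_x\big((u^\epsilon)^2\big)+\partial_x\big(q^\epsilon(\rho^\epsilon)\big)+\tfrac1\epsilon\partial_x\rho^\epsilon=0,\quad \partial_t\rho^\epsilon+\partial_x(\rho^\epsilon u^\epsilon)+\tfrac1\epsilon\partial_xu^\epsilon=0,$$ with initial data $u^\epsilon_{|t=0}=u_0$, $\rho^\epsilon_{|t=0}=\rho_0$, where $q^\epsilon(\rho)=\frac{\gamma-2}{2}\rho^2+\epsilon\,q_1^\epsilon(\rho)$ with $q_1^\epsilon$ regular. Put $\overline{u}=\int_{\mathbb{T}^1}u_0\,dx$, $\overline{\rho}=\int_{\mathbb{T}^1}\rho_0\,dx$,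 $\alpha=\frac{\gamma+1}{4}$, $\beta_\pm=\frac{2\overline{u}\pm(\gamma-1)\overline{\rho}}{4\pi}$. Homogenized model: $F,B\in\mathcal{C}(0,T;H^s(\mathbb{T}^1))$ have zero mean over $\mathbb{T}^1$ for all $t\in[0,T)$ and satisfy $$\partial_tF+\partial_x(\alpha F^2+\beta_+F)=0,\quad \partial_tB+\partial_x(\alpha B^2+\beta_-B)=0,$$ $$F_{|t=0}=\tfrac12\Big(u_0+\rho_0-\tfrac{\overline{u}+\overline{\rho}}{2\pi}\Big),\quad B_{|t=0}=\tfrac12\Big(u_0-\rho_0-\tfrac{\overline{u}-\overline{\rho}}{2\pi}\Big),$$ and $U(x,\tau,t)=F(x-\tau,t)+B(x+\tau,t)+\frac{\overline{u}}{2\pi}$, $R(x,\tau,t)=F(x-\tau,t)-B(x+\tau,t)+\frac{\overline{\rho}}{2\pi}$. Numerical scheme: take a uniform mesh of $\mathbb{T}^1\times[0,T]$ with space step $h=\frac{2\pi}{N_x+1}$ and time step $k$, $x_i=ih$, $x_{i\pm1/2}=(i\pm\frac12)h$, $t_n=nk$ (indices $i$ taken modulo $N_x+1$). Set $F_h(x,t)=F_i^n$ and $B_h(x,t)=B_i^n$ for $(x,t)\in[x_{i-1/2},x_{i+1/2}[\times[t_n,t_{n+1}[$, where $F_i^n$ and $B_i^n$ are computed with Roe's finite volume approximation of the homogenized model: for both $(Q,\beta)=(F,\beta_+)$ and $(Q,\beta)=(B,\beta_-)$, $$Q_i^{n+1}=Q_i^n-\frac{k}{2h}\Big(\alpha\big((Q_{i+1}^n)^2-(Q_{i-1}^n)^2\big)+\beta(Q_{i+1}^n-Q_{i-1}^n)-\big|\alpha(Q_{i+1}^n+Q_i^n)+\beta\big|(Q_{i+1}^n-Q_i^n)+\big|\alpha(Q_i^n+Q_{i-1}^n)+\beta\big|(Q_i^n-Q_{i-1}^n)\Big).$$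 The CFL condition at the $n$-th time step, for both $(Q,\beta)$, is $\frac{k}{h}\max_{0\le i\le N_x}\big|\alpha(Q_i^n+Q_{i-1}^n)+\beta\big|=\nu\le1$. Finally $U_h(x,\tau,t)=F_h(x-\tau,t)+B_h(x+\tau,t)+\frac{\overline{u}}{2\pi}$ and $R_h(x,\tau,t)=F_h(x-\tau,t)-B_h(x+\tau,t)+\frac{\overline{\rho}}{2\pi}$. Local truncation error: with $f(q)=\alpha q^2+\beta q$, and $q_i^n=q(x_i,t_n)$ the values of the exact solution $q=F$ (with $\beta=\beta_+$) or $q=B$ (with $\beta=\beta_-$), it is $$e(x_i,t_n)=\frac{q_i^n-q_i^{n+1}}{k}-\frac1{2h}\Big(f(q_{i+1}^n)-f(q_{i-1}^n)-\big|\alpha(q_{i+1}^n+q_i^n)+\beta\big|(q_{i+1}^n-q_i^n)+\big|\alpha(q_i^n+q_{i-1}^n)+\beta\big|(q_i^n-q_{i-1}^n)\Big).$$ *)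

theory Defs
  imports "HOL-Analysis.Analysis"
begin

text \<open>
  Functions on the torus are \<open>2\<pi>\<close>-periodic functions on the real line. Functions of space and
  time take the space variable first.
\<close>

definition fourier_coeff :: "(real \<Rightarrow> real) \<Rightarrow> int \<Rightarrow> complex" where
  "fourier_coeff f n =
     (LINT x:{0..<2 * pi}|lborel. complex_of_real (f x) * exp (- \<i> * of_int n * of_real x))
       / (2 * pi)"

definition sobolev :: "real \<Rightarrow> (real \<Rightarrow> real) set" where
  "sobolev s = {f. f \<in> borel_measurable borel \<and> (\<forall>x. f (x + 2 * pi) = f x) \<and>
     set_integrable lborel {0..<2 * pi} (\<lambda>x. (f x)\<^sup>2) \<and>
     (\<lambda>n::int. (1 + (of_int n)\<^sup>2) powr s * (cmod (fourier_coeff f n))\<^sup>2) summable_on UNIV}"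

definition sobolev_norm :: "real \<Rightarrow> (real \<Rightarrow> real) \<Rightarrow> real" where
  "sobolev_norm s f =
     sqrt (\<Sum>\<^sub>\<infinity>n::int. (1 + (of_int n)\<^sup>2) powr s * (cmod (fourier_coeff f n))\<^sup>2)"

definition continuous_in_sobolev :: "real \<Rightarrow> real \<Rightarrow> (real \<Rightarrow> real \<Rightarrow> real) \<Rightarrow> bool" where
  "continuous_in_sobolev T s Q \<longleftrightarrow>
     (\<forall>t\<in>{0..<T}. (\<lambda>x. Q x t) \<in> sobolev s) \<and>
     (\<forall>t\<in>{0..<T}. ((\<lambda>r. sobolev_norm s (\<lambda>x. Q x r - Q x t)) \<longlongrightarrow> 0) (at t within {0..<T}))"

definition torus_integral :: "(real \<Rightarrow> real) \<Rightarrow> real" where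
  "torus_integral f = (LINT x:{0..<2 * pi}|lborel. f x)"


definition alpha :: "real \<Rightarrow> real" where
  "alpha \<gamma> = (\<gamma> + 1) / 4"

definition beta_plus :: "real \<Rightarrow> (real \<Rightarrow> real) \<Rightarrow> (real \<Rightarrow> real) \<Rightarrow> real" where
  "beta_plus \<gamma> u\<^sub>0 \<rho>\<^sub>0 = (2 * torus_integral u\<^sub>0 + (\<gamma> - 1) * torus_integral \<rho>\<^sub>0) / (4 * pi)"

definition beta_minus :: "real \<Rightarrow> (real \<Rightarrow> real) \<Rightarrow> (real \<Rightarrow> real) \<Rightarrow> real" where
  "beta_minus \<gamma> u\<^sub>0 \<rho>\<^sub>0 = (2 * torus_integral u\<^sub>0 - (\<gamma> - 1) * torus_integral \<rho>\<^sub>0) / (4 * pi)"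

definition flux :: "real \<Rightarrow> real \<Rightarrow> real \<Rightarrow> real" where
  "flux \<alpha> \<beta> q = \<alpha> * q\<^sup>2 + \<beta> * q"

definition F_init :: "(real \<Rightarrow> real) \<Rightarrow> (real \<Rightarrow> real) \<Rightarrow> real \<Rightarrow> real" where
  "F_init u\<^sub>0 \<rho>\<^sub>0 x =
     (u\<^sub>0 x + \<rho>\<^sub>0 x - (torus_integral u\<^sub>0 + torus_integral \<rho>\<^sub>0) / (2 * pi)) / 2"

definition B_init :: "(real \<Rightarrow> real) \<Rightarrow> (real \<Rightarrow> real) \<Rightarrow> real \<Rightarrow> real" where
  "B_init u\<^sub>0 \<rho>\<^sub>0 x =
     (u\<^sub>0 x - \<rho>\<^sub>0 x - (torus_integral u\<^sub>0 - torus_integral \<rho>\<^sub>0) / (2 * pi)) / 2"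

text \<open>
  For \<open>s \<ge> 2\<close> every element of the Sobolev space has a continuously differentiable
  representative; differentiability in space selects it. The initial datum is an equivalence class,
  hence the equality almost everywhere. At time 0 the time derivative is one-sided.
\<close>

definition conservation_law_solution ::
    "real \<Rightarrow> real \<Rightarrow> real \<Rightarrow> real \<Rightarrow> (real \<Rightarrow> real) \<Rightarrow> (real \<Rightarrow> real \<Rightarrow> real) \<Rightarrow> bool" where
  "conservation_law_solution \<alpha> \<beta> T s Q\<^sub>0 Q \<longleftrightarrow>
     continuous_in_sobolev T s Q \<and>
     (\<forall>t\<in>{0..<T}. torus_integral (\<lambda>x. Q x t) = 0) \<and>
     (\<forall>t\<in>{0..<T}. \<forall>x. (\<lambda>y. Q y t) differentiable (at x) \<and>
        ((\<lambda>r. Q x r) has_real_derivative - deriv (\<lambda>y. flux \<alpha> \<beta> (Q y t)) x)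
          (at t within {0..<T})) \<and>
     (AE x in lborel. Q x 0 = Q\<^sub>0 x)"

text \<open>
  The profiles \<open>U\<close> and \<open>R\<close>, used for the exact as well as for the numerical pair \<open>(F, B)\<close>.
\<close>

definition U_of :: "(real \<Rightarrow> real) \<Rightarrow> (real \<Rightarrow> real \<Rightarrow> real) \<Rightarrow> (real \<Rightarrow> real \<Rightarrow> real) \<Rightarrow>
    real \<Rightarrow> real \<Rightarrow> real \<Rightarrow> real" where
  "U_of u\<^sub>0 F B x \<tau> t = F (x - \<tau>) t + B (x + \<tau>) t + torus_integral u\<^sub>0 / (2 * pi)"

definition R_of :: "(real \<Rightarrow> real) \<Rightarrow> (real \<Rightarrow> real \<Rightarrow> real) \<Rightarrow> (real \<Rightarrow> real \<Rightarrow> real) \<Rightarrow>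
    real \<Rightarrow> real \<Rightarrow> real \<Rightarrow> real" where
  "R_of \<rho>\<^sub>0 F B x \<tau> t = F (x - \<tau>) t - B (x + \<tau>) t + torus_integral \<rho>\<^sub>0 / (2 * pi)"


text \<open>
  The mesh with parameter \<open>N\<close> has \<open>N + 1\<close> cells. Grid functions are indexed by all integers; as
  the cell averages of a periodic function are \<open>(N + 1)\<close>-periodic in the index and the scheme
  preserves this, it amounts to indices modulo \<open>N + 1\<close>.
\<close>

definition mesh_width :: "nat \<Rightarrow> real" where
  "mesh_width N = 2 * pi / (real N + 1)"

definition cell_average :: "real \<Rightarrow> (real \<Rightarrow> real) \<Rightarrow> int \<Rightarrow> real" where
  "cell_average h Q\<^sub>0 i =
     (LINT x:{(of_int i - 1/2) * h..<(of_int i + 1/2) * h}|lborel. Q\<^sub>0 x) / h"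

definition roe_speed :: "real \<Rightarrow> real \<Rightarrow> (int \<Rightarrow> real) \<Rightarrow> int \<Rightarrow> real" where
  "roe_speed \<alpha> \<beta> q i = \<alpha> * (q i + q (i - 1)) + \<beta>"

definition roe_flux_difference :: "real \<Rightarrow> real \<Rightarrow> (int \<Rightarrow> real) \<Rightarrow> int \<Rightarrow> real" where
  "roe_flux_difference \<alpha> \<beta> q i =
     flux \<alpha> \<beta> (q (i + 1)) - flux \<alpha> \<beta> (q (i - 1))
     - \<bar>roe_speed \<alpha> \<beta> q (i + 1)\<bar> * (q (i + 1) - q i)
     + \<bar>roe_speed \<alpha> \<beta> q i\<bar> * (q i - q (i - 1))"

primrec roe_scheme ::
    "real \<Rightarrow> real \<Rightarrow> real \<Rightarrow> real \<Rightarrow> (real \<Rightarrow> real) \<Rightarrow> nat \<Rightarrow> int \<Rightarrow> real" where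
  "roe_scheme \<alpha> \<beta> h k Q\<^sub>0 0 = cell_average h Q\<^sub>0"
| "roe_scheme \<alpha> \<beta> h k Q\<^sub>0 (Suc n) =
     (\<lambda>i. roe_scheme \<alpha> \<beta> h k Q\<^sub>0 n i
        - k / (2 * h) * roe_flux_difference \<alpha> \<beta> (roe_scheme \<alpha> \<beta> h k Q\<^sub>0 n) i)"

text \<open>
  The floors pick the \<open>i\<close> and \<open>n\<close> with \<open>(i - 1/2) h \<le> x < (i + 1/2) h\<close> and
  \<open>n k \<le> t < (n + 1) k\<close>.
\<close>

definition roe_approximation ::
    "real \<Rightarrow> real \<Rightarrow> real \<Rightarrow> real \<Rightarrow> (real \<Rightarrow> real) \<Rightarrow> real \<Rightarrow> real \<Rightarrow> real" where
  "roe_approximation \<alpha> \<beta> h k Q\<^sub>0 x t = roe_scheme \<alpha> \<beta> h k Q\<^sub>0 (nat \<lfloor>t / k\<rfloor>) \<lfloor>x / h + 1/2\<rfloor>"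

definition cfl_condition ::
    "real \<Rightarrow> real \<Rightarrow> real \<Rightarrow> nat \<Rightarrow> real \<Rightarrow> (real \<Rightarrow> real) \<Rightarrow> bool" where
  "cfl_condition \<alpha> \<beta> T N k Q\<^sub>0 \<longleftrightarrow>
     (\<forall>n. real n * k < T \<longrightarrow>
        k / mesh_width N *
        Max ((\<lambda>i. \<bar>roe_speed \<alpha> \<beta> (roe_scheme \<alpha> \<beta> (mesh_width N) k Q\<^sub>0 n) i\<bar>) ` {0..int N}) \<le> 1)"

definition F_num :: "real \<Rightarrow> (real \<Rightarrow> real) \<Rightarrow> (real \<Rightarrow> real) \<Rightarrow> nat \<Rightarrow> real \<Rightarrow> real \<Rightarrow> real \<Rightarrow> real" where
  "F_num \<gamma> u\<^sub>0 \<rho>\<^sub>0 N k =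
     roe_approximation (alpha \<gamma>) (beta_plus \<gamma> u\<^sub>0 \<rho>\<^sub>0) (mesh_width N) k (F_init u\<^sub>0 \<rho>\<^sub>0)"

definition B_num :: "real \<Rightarrow> (real \<Rightarrow> real) \<Rightarrow> (real \<Rightarrow> real) \<Rightarrow> nat \<Rightarrow> real \<Rightarrow> real \<Rightarrow> real \<Rightarrow> real" where
  "B_num \<gamma> u\<^sub>0 \<rho>\<^sub>0 N k =
     roe_approximation (alpha \<gamma>) (beta_minus \<gamma> u\<^sub>0 \<rho>\<^sub>0) (mesh_width N) k (B_init u\<^sub>0 \<rho>\<^sub>0)"

text \<open>
  The limit \<open>h \<rightarrow> 0\<close> over all meshes \<open>(N, k)\<close> that satisfy the CFL condition for both schemes;
  nothing else ties \<open>k\<close> to \<open>h\<close>.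
\<close>

definition mesh_refinement ::
    "real \<Rightarrow> real \<Rightarrow> (real \<Rightarrow> real) \<Rightarrow> (real \<Rightarrow> real) \<Rightarrow> (nat \<times> real) filter" where
  "mesh_refinement \<gamma> T u\<^sub>0 \<rho>\<^sub>0 =
     inf (filtercomap (\<lambda>(N, k). mesh_width N) (at_right 0))
         (principal {(N, k). 0 < k \<and>
            cfl_condition (alpha \<gamma>) (beta_plus \<gamma> u\<^sub>0 \<rho>\<^sub>0) T N k (F_init u\<^sub>0 \<rho>\<^sub>0) \<and>
            cfl_condition (alpha \<gamma>) (beta_minus \<gamma> u\<^sub>0 \<rho>\<^sub>0) T N k (B_init u\<^sub>0 \<rho>\<^sub>0)})"

definition tendsto_L1 :: "'a measure \<Rightarrow> ('i \<Rightarrow> 'a \<Rightarrow> real) \<Rightarrow> ('a \<Rightarrow> real) \<Rightarrow> 'i filter \<Rightarrow> bool" where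
  "tendsto_L1 M f g \<F> \<longleftrightarrow>
     integrable M g \<and> (\<forall>\<^sub>F i in \<F>. integrable M (f i)) \<and>
     ((\<lambda>i. \<integral>z. \<bar>f i z - g z\<bar> \<partial>M) \<longlongrightarrow> 0) \<F>"

definition time_torus :: "real \<Rightarrow> (real \<times> real) measure" where
  "time_torus T = restrict_space lborel ({0..<T} \<times> {0..<2 * pi})"

definition truncation_error ::
    "real \<Rightarrow> real \<Rightarrow> real \<Rightarrow> real \<Rightarrow> (real \<Rightarrow> real \<Rightarrow> real) \<Rightarrow> int \<Rightarrow> nat \<Rightarrow> real" where
  "truncation_error \<alpha> \<beta> h k q i n =
     (q (of_int i * h) (real n * k) - q (of_int i * h) (real (Suc n) * k)) / k
     - roe_flux_difference \<alpha> \<beta> (\<lambda>j. q (of_int j * h) (real n * k)) i / (2 * h)"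

text \<open>
  The constant is uniform over all meshes and all grid points up to the horizon \<open>T\<close>.
\<close>

definition first_order_accurate ::
    "real \<Rightarrow> real \<Rightarrow> real \<Rightarrow> (real \<Rightarrow> real \<Rightarrow> real) \<Rightarrow> bool" where
  "first_order_accurate \<alpha> \<beta> T q \<longleftrightarrow>
     (\<exists>C. \<forall>N k i n. 0 < k \<longrightarrow> real (Suc n) * k < T \<longrightarrow>
        \<bar>truncation_error \<alpha> \<beta> (mesh_width N) k q i n\<bar> \<le> C * (mesh_width N + k))"

end

theory Submission
  imports Defs
begin

text \<open>
  Both components solve the same scalar problem: a smooth solution \<open>Q\<close> of
  \<open>Q_t + (\<alpha> Q\<^sup>2 + \<beta> Q)_x = 0\<close> and its Roe approximation. The profiles \<open>U\<close> and \<open>R\<close> are sums and differences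
  of translates of two such solutions, so everything reduces to one equation.

  Roe's scheme does not satisfy an entropy condition, hence compactness (a total variation bound and a
  convergent subsequence) would only produce some weak solution. What saves the scheme is that the
  limit is known to be smooth up to any time \<open>b < T\<close>, so that it can be compared with the numerical
  solution directly. In upwind form the step is
  \<open>q i - k/h (a\<^sup>+ (q i - q (i - 1)) + a\<^sup>- (q (i + 1) - q i))\<close>, where \<open>a\<^sup>+\<close> is taken at the left and \<open>a\<^sup>-\<close> at the
  right edge of the cell. The error satisfies the same recursion, up to the difference of the two
  speeds multiplied by increments of the \<^emph>\<open>smooth\<close> solution, which are of size \<open>h\<close>, and up to the truncation
  error. If the transport part is a convex combination, a Gronwall argument in the
  maximum norm closes (\<open>upwind_step_error\<close>, \<open>upwind_error_growth\<close>). The CFL condition bounds \<open>a\<^sup>+\<close> and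
  \<open>\<bar>a\<^sup>-\<bar>\<close> separately but not their sum; both are nonzero only at a compressive sonic cell, and there the
  sum is \<open>\<alpha> (q (i - 1) - q (i + 1))\<close>, which is small as long as the numerical solution is close to the
  smooth one. The induction over the time steps maintains exactly this closeness.

  Two points remain. First, nothing but the CFL condition relates \<open>k\<close> to \<open>h\<close>. If the characteristic speed is
  not identically zero at time 0, the CFL condition at the first step bounds \<open>k/h\<close>
  (\<open>cfl_bounds_time_step\<close>); if it is, then the solution and the scheme are both stationary. Secondly, on
  \<open>[b, T)\<close> the derivatives of \<open>Q\<close> may blow up. There uniform bounds suffice for \<open>L\<^sup>1\<close> convergence:
  the maximum principle for \<open>Q\<close>, and for the scheme the decay of the total variation together with
  conservation of the mean (\<open>num_bounded\<close>).

  The truncation error (\<open>truncation_error_bound\<close>) is controlled by the moduli of continuity of \<open>Q_x\<close> in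
  space and in time. For \<open>s \<ge> 2\<close> the derivative \<open>Q_x\<close> is continuous, which gives consistency; for \<open>s \<ge> 3\<close> it is
  Lipschitz in space, and the equation turns this into a Lipschitz bound in time
  (\<open>slope_time_lipschitz\<close>), which gives first order.

  As regularity is expressed by Fourier coefficients while the scheme uses point values, a Sobolev
  embedding is needed (\<open>sobolev_embedding\<close>). It rests on pointwise Fourier inversion at points of
  differentiability, for which an argument of Chernoff is used (\<open>fourier_inversion_symmetric\<close>).
\<close>

section \<open>Pointwise Fourier inversion\<close>

lemma integral_periodic_shift:
  fixes G :: "real \<Rightarrow> 'a::euclidean_space"
  assumes cont: "continuous_on UNIV G" and per: "\<And>x. G (x + p) = G x"
    and a: "0 \<le> a" "a \<le> p"
  shows "integral {0..p} (\<lambda>x. G (x + a)) = integral {0..p} G"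
proof -
  have int: "G integrable_on {c..d}" for c d
    by (rule integrable_continuous_interval) (rule continuous_on_subset[OF cont], simp)
  have "integral {0..p} (\<lambda>x. G (x + a)) = integral {a..a+p} G"
    using integral_shift_real_ivl[of a a "a+p" G] by simp
  also have "\<dots> = integral {a..p} G + integral {p..a+p} G"
    using Henstock_Kurzweil_Integration.integral_combine[of a p "a+p" G] a int by simp
  also have "integral {p..a+p} G = integral {0..a} G"
    using integral_shift_real_ivl[of p p "a+p" G] per by simp
  also have "integral {a..p} G + integral {0..a} G = integral {0..p} G"
    using Henstock_Kurzweil_Integration.integral_combine[of 0 a p G] a int by (simp add: add.commute)
  finally show ?thesis .
qed

definition circle_coeff :: "(real \<Rightarrow> complex) \<Rightarrow> int \<Rightarrow> complex" where
  "circle_coeff g n = integral {0..2 * pi} (\<lambda>x. g x * cis (- (of_int n * x))) / (2 * pi)"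

text \<open>
  Translation by half a period of \<open>exp (- i n x)\<close> changes the sign of this character. Averaging the integral with
  its translate therefore replaces \<open>g\<close> by a difference of nearby values.
\<close>

lemma circle_coeff_half_period:
  assumes cont: "continuous_on UNIV g" and per: "\<And>x. g (x + 2 * pi) = g x" and n: "n \<noteq> 0"
  shows "2 * circle_coeff g n =
    integral {0..2 * pi} (\<lambda>x. (g x - g (x + pi / \<bar>of_int n\<bar>)) * cis (- (of_int n * x))) / (2 * pi)"
proof -
  define a where "a = pi / \<bar>real_of_int n\<bar>"
  define G where "G x = g x * cis (- (of_int n * x))" for x
  have n1: "1 \<le> \<bar>real_of_int n\<bar>" using n by linarith
  have a: "0 \<le> a" "a \<le> 2 * pi"
    using n1 by (auto simp: a_def divide_le_eq intro: order_trans[of _ "pi * 1"])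
  have contG: "continuous_on UNIV G"
    unfolding G_def by (intro continuous_intros cont)
  have perG: "G (x + 2 * pi) = G x" for x
  proof -
    have "cis (- (of_int n * (x + 2 * pi))) = cis (- (of_int n * x)) * cis (2 * pi * of_int (- n))"
      by (simp add: cis_mult algebra_simps)
    moreover have "cis (2 * pi * of_int (- n)) = 1" by (rule cis_multiple_2pi) simp
    ultimately show ?thesis by (simp add: G_def per)
  qed
  have half: "cis (- (of_int n * (x + a))) = - cis (- (of_int n * x))" for x
  proof (cases "n > 0")
    case True
    then have "- (of_int n * (x + a)) = - (of_int n * x) - pi"
      by (simp add: a_def field_simps)
    then show ?thesis by (simp add: complex_eq_iff cos_diff sin_diff)
  next
    case False
    then have "- (of_int n * (x + a)) = - (of_int n * x) + pi"
      using n by (simp add: a_def field_simps abs_if)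
    then show ?thesis by (simp add: complex_eq_iff cos_add sin_add)
  qed
  have shift: "integral {0..2 * pi} (\<lambda>x. G (x + a)) = integral {0..2 * pi} G"
    by (rule integral_periodic_shift[OF contG perG a])
  have int1: "G integrable_on {0..2 * pi}"
    by (rule integrable_continuous_interval) (rule continuous_on_subset[OF contG], simp)
  have int2: "(\<lambda>x. G (x + a)) integrable_on {0..2 * pi}"
    by (rule integrable_continuous_interval)
       (rule continuous_on_compose2[OF contG], auto intro!: continuous_intros)
  have "integral {0..2 * pi} (\<lambda>x. (g x - g (x + a)) * cis (- (of_int n * x)))
      = integral {0..2 * pi} (\<lambda>x. G x + G (x + a))"
    unfolding G_def half by (simp add: algebra_simps)
  also have "\<dots> = 2 * integral {0..2 * pi} G"
    using integral_add[OF int1 int2] shift by simp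
  finally show ?thesis
    by (simp add: circle_coeff_def G_def[abs_def] a_def)
qed

text \<open>
  Immediate from the previous identity and uniform continuity: the translation by \<open>pi / \<bar>n\<bar>\<close> is small.
  Since it leaves \<open>[0, 2 pi]\<close>, uniform continuity is taken on \<open>[0, 3 pi]\<close>.
\<close>

lemma riemann_lebesgue:
  assumes cont: "continuous_on UNIV g" and per: "\<And>x. g (x + 2 * pi) = g x" and e: "0 < e"
  shows "\<exists>N. \<forall>n. N \<le> \<bar>n\<bar> \<longrightarrow> cmod (circle_coeff g n) \<le> e"
proof -
  have "uniformly_continuous_on {0..3 * pi} g"
    by (rule compact_uniformly_continuous) (auto intro: continuous_on_subset[OF cont])
  then obtain d where d: "0 < d"
      "\<And>x y. \<lbrakk>x \<in> {0..3 * pi}; y \<in> {0..3 * pi}; dist y x < d\<rbrakk> \<Longrightarrow> dist (g y) (g x) < e"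
    unfolding uniformly_continuous_on_def using e by metis
  define N where "N = \<lceil>pi / d\<rceil> + 1"
  have "cmod (circle_coeff g n) \<le> e" if n: "N \<le> \<bar>n\<bar>" for n
  proof -
    have "pi / d < \<bar>real_of_int n\<bar>" using n unfolding N_def by linarith
    moreover have "0 < pi / d" using d by simp
    ultimately have n0: "n \<noteq> 0" and npos: "0 < \<bar>real_of_int n\<bar>" by auto
    have small: "pi / \<bar>real_of_int n\<bar> < d"
      using \<open>pi / d < _\<close> npos d(1) by (simp only: divide_less_eq mult.commute) simp
    have n1: "1 \<le> \<bar>real_of_int n\<bar>" using n0 by linarith
    define a where "a = pi / \<bar>real_of_int n\<bar>"
    have a: "0 \<le> a" "a \<le> pi" "a < d"
      using n1 small by (auto simp: a_def divide_le_eq)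
    have bound: "norm ((g x - g (x + a)) * cis (- (of_int n * x))) \<le> e" if "x \<in> {0..2 * pi}" for x
    proof -
      have "dist (g x) (g (x + a)) < e"
        using that a by (intro d) (auto simp: dist_real_def)
      then show ?thesis by (simp add: norm_mult dist_norm)
    qed
    have "norm (integral {0..2 * pi} (\<lambda>x. (g x - g (x + a)) * cis (- (of_int n * x)))) \<le> e * (2 * pi - 0)"
      by (rule integral_bound)
         (auto intro!: continuous_intros continuous_on_compose2[OF cont] bound)
    moreover have "norm (2 * circle_coeff g n) =
      norm (integral {0..2 * pi} (\<lambda>x. (g x - g (x + a)) * cis (- (of_int n * x)))) / (2 * pi)"
      unfolding circle_coeff_half_period[OF cont per n0] a_def by (simp add: norm_divide norm_mult)
    ultimately have "norm (2 * circle_coeff g n) \<le> e"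
      by (simp only: pos_divide_le_eq) (simp add: pos_divide_le_eq)
    then have "2 * norm (circle_coeff g n) \<le> e" by (simp add: norm_mult)
    then show ?thesis using e norm_ge_zero[of "circle_coeff g n"] by linarith
  qed
  then show ?thesis by blast
qed

lemma circle_coeff_const:
  "circle_coeff (\<lambda>x. c) n = (if n = 0 then c else 0)"
proof (cases "n = 0")
  case True
  then show ?thesis by (simp add: circle_coeff_def scaleR_conv_of_real)
next
  case False
  then show ?thesis using circle_coeff_half_period[of "\<lambda>x. c" n] by simp
qed

lemma periodic_int_multiple:
  fixes f :: "'b::comm_ring_1 \<Rightarrow> 'a"
  assumes per: "\<And>x. f (x + p) = f x"
  shows "f (x + of_int k * p) = f x"
proof -
  have nat: "f (x + of_nat m * p) = f x" for m x
  proof (induction m)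
    case (Suc m)
    have "f (x + of_nat (Suc m) * p) = f ((x + of_nat m * p) + p)" by (simp add: algebra_simps)
    then show ?case using per Suc by simp
  qed simp
  show ?thesis
  proof (cases k)
    case (nonneg n)
    then show ?thesis using nat[of x n] by simp
  next
    case (neg n)
    have eq: "x + of_int k * p + of_nat (Suc n) * p = x"
      unfolding neg of_int_minus of_int_of_nat_eq by (simp add: algebra_simps)
    show ?thesis using nat[of "x + of_int k * p" "Suc n"] unfolding eq by (rule sym)
  qed
qed

text \<open>
  Chernoff's quotient. At the zeros of the denominator, which are simple, differentiability of
  \<open>f\<close> provides the limit of the quotient; with these values filled in the quotient is continuous and
  periodic, so the Riemann-Lebesgue lemma applies to it.
\<close>

lemma chernoff_quotient_continuous:
  fixes f :: "real \<Rightarrow> real" and z :: real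
  assumes per: "\<And>x. f (x + 2 * pi) = f x" and diff: "\<And>x. f differentiable (at x)"
  defines "g \<equiv> \<lambda>x. if cis x = cis z then complex_of_real (deriv f x) / (\<i> * cis x)
                    else complex_of_real (f x - f z) / (cis x - cis z)"
  shows "continuous_on UNIV g" "\<And>x. g (x + 2 * pi) = g x"
    "\<And>x. complex_of_real (f x - f z) = g x * (cis x - cis z)"
proof -
  have D: "(f has_real_derivative deriv f x) (at x)" for x
    using diff[of x] by (simp add: DERIV_deriv_iff_real_differentiable)
  have same: "f x = f z" if cc: "cis x = cis z" for x
  proof -
    have "sin x = sin z \<and> cos x = cos z" using cc by (simp add: complex_eq_iff)
    then obtain k :: int where "x = z + of_int k * (2 * pi)"
      unfolding sin_cos_eq_iff by (auto simp: mult_ac)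
    then show ?thesis using periodic_int_multiple[of f "2 * pi" z k] per by simp
  qed
  have contf: "isCont f x" for x using D DERIV_isCont by blast
  have cisd: "((\<lambda>y. (cis y - cis x) / of_real (y - x)) \<longlongrightarrow> \<i> * cis x) (at x)" for x
  proof -
    have "((\<lambda>w. exp (\<i> * w)) has_field_derivative \<i> * cis x) (at (of_real x))"
      by (auto intro!: derivative_eq_intros simp: cis_conv_exp)
    then have "((\<lambda>w. (exp (\<i> * w) - cis x) / (w - of_real x)) \<longlongrightarrow> \<i> * cis x) (at (of_real x))"
      by (simp add: has_field_derivative_iff cis_conv_exp)
    moreover have "filterlim complex_of_real (at (of_real x)) (at x)"
      by (auto simp: filterlim_at eventually_at_filter intro!: tendsto_intros)
    ultimately have "((\<lambda>y. (exp (\<i> * of_real y) - cis x) / (of_real y - of_real x))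
        \<longlongrightarrow> \<i> * cis x) (at x)"
      by (rule filterlim_compose)
    then show ?thesis by (simp add: cis_conv_exp)
  qed
  have contcis: "isCont cis x" for x
    unfolding isCont_def by (rule tendsto_cis[OF tendsto_ident_at])
  have "isCont g x" for x
  proof (cases "cis x = cis z")
    case False
    have "\<forall>\<^sub>F y in at x. cis y \<noteq> cis z"
      using tendsto_imp_eventually_ne[OF contcis[of x, unfolded isCont_def] False] .
    then have "\<forall>\<^sub>F y in at x. complex_of_real (f y - f z) / (cis y - cis z) = g y"
      by eventually_elim (simp add: g_def)
    moreover have "((\<lambda>y. complex_of_real (f y - f z) / (cis y - cis z)) \<longlongrightarrow> g x) (at x)"
      unfolding g_def if_not_P[OF False] using contf[of x] contcis[of x] False
      by (auto intro!: tendsto_intros simp: isCont_def)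
    ultimately show ?thesis unfolding isCont_def by (rule Lim_transform_eventually[rotated])
  next
    case True
    have nz: "\<i> * cis x \<noteq> 0" by simp
    have "\<forall>\<^sub>F y in at x. (cis y - cis x) / of_real (y - x) \<noteq> 0"
      using tendsto_imp_eventually_ne[OF cisd[of x] nz] .
    moreover have "\<forall>\<^sub>F y in at x. y \<noteq> x" by (simp add: eventually_at_filter)
    ultimately have "\<forall>\<^sub>F y in at x. complex_of_real ((f y - f x) / (y - x)) /
        ((cis y - cis x) / of_real (y - x)) = g y"
    proof eventually_elim
      case (elim y)
      then show ?case using True same[OF True] by (auto simp: g_def)
    qed
    moreover have "((\<lambda>y. complex_of_real ((f y - f x) / (y - x)) /
        ((cis y - cis x) / of_real (y - x))) \<longlongrightarrow> g x) (at x)"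
      unfolding g_def if_P[OF True] using D[of x, unfolded has_field_derivative_iff]
      by (intro tendsto_divide tendsto_of_real cisd nz)
    ultimately show ?thesis unfolding isCont_def by (rule Lim_transform_eventually[rotated])
  qed
  then show "continuous_on UNIV g" by (simp add: continuous_on_eq_continuous_at)
  have "deriv f (x + 2 * pi) = deriv f x" for x
  proof -
    have "((\<lambda>y. f (y + 2 * pi)) has_real_derivative deriv f (x + 2 * pi)) (at x)"
      using D[of "x + 2 * pi"] by (simp add: DERIV_shift)
    then show ?thesis using per by (simp add: DERIV_imp_deriv)
  qed
  then show "g (x + 2 * pi) = g x" for x
    by (simp add: g_def per flip: cis_mult)
  show "complex_of_real (f x - f z) = g x * (cis x - cis z)" for x
    using same[of x] by (cases "cis x = cis z") (simp_all add: g_def)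
qed

text \<open>
  Comparing coefficients in \<open>f x - f x0 = g x (cis x - cis x0)\<close>, the terms of the Fourier series of
  \<open>f - f x0\<close> at \<open>x0\<close> are consecutive differences of \<open>b n = cis ((n + 1) x0) * circle_coeff g n\<close>. The
  symmetric partial sums telescope and the two boundary terms tend to 0.
\<close>

lemma fourier_inversion_symmetric:
  fixes f :: "real \<Rightarrow> real"
  assumes per: "\<And>x. f (x + 2 * pi) = f x" and diff: "\<And>x. f differentiable (at x)"
  shows "(\<lambda>N. \<Sum>n=-int N..int N. circle_coeff (\<lambda>x. of_real (f x)) n * cis (of_int n * x0))
           \<longlonglongrightarrow> of_real (f x0)"
proof -
  obtain g where cont: "continuous_on UNIV g" and gper: "\<And>x. g (x + 2 * pi) = g x"
    and g: "\<And>x. complex_of_real (f x - f x0) = g x * (cis x - cis x0)"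
    by (rule that[OF chernoff_quotient_continuous[where f = f and z = x0, OF per diff]])
  define b where "b n = cis (of_int (n + 1) * x0) * circle_coeff g n" for n
  have contf: "continuous_on A f" for A
    using diff by (meson continuous_at_imp_continuous_on differentiable_imp_continuous_within)
  have step: "circle_coeff (\<lambda>x. of_real (f x)) n * cis (of_int n * x0)
      = (b (n - 1) - b n) + (if n = 0 then of_real (f x0) else 0)" for n
  proof -
    define E where "E m x = g x * cis (- (of_int m * x))" for m x
    have intE: "E m integrable_on {0..2 * pi}" for m
      unfolding E_def
      by (intro integrable_continuous_interval continuous_intros continuous_on_subset[OF cont]) simp
    have intc: "(\<lambda>x. complex_of_real (f x0) * cis (- (of_int n * x))) integrable_on {0..2 * pi}"
      by (intro integrable_continuous_interval continuous_intros)
    have eq: "of_real (f x) * cis (- (of_int n * x)) =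
        (E (n - 1) x - cis x0 * E n x) + of_real (f x0) * cis (- (of_int n * x))" for x
    proof -
      have fx: "of_real (f x) = g x * (cis x - cis x0) + of_real (f x0)"
        unfolding g[symmetric] by simp
      have "cis (- (of_int (n - 1) * x)) = cis x * cis (- (of_int n * x))"
        by (simp add: cis_mult algebra_simps)
      then show ?thesis unfolding E_def fx by (simp add: algebra_simps)
    qed
    have "integral {0..2 * pi} (\<lambda>x. of_real (f x) * cis (- (of_int n * x))) =
        integral {0..2 * pi} (E (n - 1)) - cis x0 * integral {0..2 * pi} (E n)
        + integral {0..2 * pi} (\<lambda>x. complex_of_real (f x0) * cis (- (of_int n * x)))"
      unfolding eq
      by (intro integral_unique has_integral_add has_integral_diff has_integral_mult_right
          integrable_integral intE intc)
    then have coeff: "circle_coeff (\<lambda>x. of_real (f x)) n =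
        circle_coeff g (n - 1) - cis x0 * circle_coeff g n + circle_coeff (\<lambda>x. of_real (f x0)) n"
      unfolding circle_coeff_def E_def
      by (simp only: add_divide_distrib diff_divide_distrib times_divide_eq_right)
    have next_cis: "cis (of_int (n + 1) * x0) = cis x0 * cis (of_int n * x0)"
      by (simp add: cis_mult algebra_simps)
    show ?thesis
      unfolding coeff b_def next_cis circle_coeff_const by (simp add: algebra_simps)
  qed
  have sum: "(\<Sum>n=-int N..int N. circle_coeff (\<lambda>x. of_real (f x)) n * cis (of_int n * x0))
      = b (- int N - 1) - b (int N) + of_real (f x0)" for N
  proof -
    have tele: "(\<Sum>n=-int N..int N. b (n - 1) - b n) = b (- int N - 1) - b (int N)" for N
    proof (induction N)
      case (Suc N)
      have "{- int (Suc N)..int (Suc N)} = insert (- int N - 1) (insert (int N + 1) {-int N..int N})"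
        by auto
      then show ?case using Suc by (simp add: add.commute)
    qed simp
    show ?thesis unfolding step sum.distrib tele by simp
  qed
  have "(\<lambda>N. b (int N)) \<longlonglongrightarrow> 0" "(\<lambda>N. b (- int N - 1)) \<longlonglongrightarrow> 0"
  proof -
    have nb: "norm (b n) = norm (circle_coeff g n)" for n by (simp add: b_def norm_mult)
    have "\<exists>M. \<forall>N\<ge>M. norm (b (int N)) < e \<and> norm (b (- int N - 1)) < e" if e: "0 < e" for e
    proof -
      obtain M where M: "\<And>n. M \<le> \<bar>n\<bar> \<Longrightarrow> norm (b n) \<le> e / 2"
        using riemann_lebesgue[OF cont gper, of "e / 2"] e unfolding nb by auto
      have "norm (b (int N)) < e \<and> norm (b (- int N - 1)) < e" if "N \<ge> nat M" for N
        using that M[of "int N"] M[of "- int N - 1"] e by force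
      then show ?thesis by blast
    qed
    then show "(\<lambda>N. b (int N)) \<longlonglongrightarrow> 0" "(\<lambda>N. b (- int N - 1)) \<longlonglongrightarrow> 0"
      unfolding LIMSEQ_iff by (auto; metis)+
  qed
  from tendsto_add[OF tendsto_diff[OF this(2) this(1)] tendsto_const[of "complex_of_real (f x0)"]]
  show ?thesis unfolding sum by simp
qed

lemma set_integral_half_open:
  fixes f :: "real \<Rightarrow> 'a::euclidean_space"
  assumes "continuous_on UNIV f"
  shows "(LINT x:{a..<b}|lborel. f x) = integral {a..b} f"
proof -
  have "set_integrable lborel {a..b} f"
    by (rule borel_integrable_atLeastAtMost') (rule continuous_on_subset[OF assms], simp)
  then have "set_integrable lborel {a..<b} f"
    by (rule set_integrable_subset) auto
  then have "(LINT x:{a..<b}|lborel. f x) = integral {a..<b} f"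
    by (rule set_borel_integral_eq_integral)
  also have "\<dots> = integral {a..b} f"
    by (rule integral_subset_negligible) (auto intro: negligible_subset[of "{b}"])
  finally show ?thesis .
qed

lemma fourier_coeff_eq_circle_coeff:
  assumes "continuous_on UNIV f"
  shows "fourier_coeff f n = circle_coeff (\<lambda>x. of_real (f x)) n"
proof -
  define E where "E x = complex_of_real (f x) * cis (- (of_int n * x))" for x
  have E: "E x = complex_of_real (f x) * exp (- \<i> * of_int n * of_real x)" for x
    by (simp add: E_def cis_conv_exp mult_ac)
  have "continuous_on UNIV E"
    unfolding E_def by (intro continuous_intros assms)
  then have "(LINT x:{0..<2 * pi}|lborel. E x) = integral {0..2 * pi} E"
    by (rule set_integral_half_open)
  then show ?thesis
    unfolding fourier_coeff_def circle_coeff_def E_def[symmetric] E[symmetric] by simp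
qed

section \<open>Sobolev embedding on the torus\<close>

text \<open>
  The explicit bound is the telescoping estimate \<open>2 / (1 + (M + 1)\<^sup>2) \<le> 4 / (M + 1) - 4 / (M + 2)\<close>; it keeps
  the constant of the embedding elementary.
\<close>

lemma sum_inverse_one_plus_square:
  "(\<Sum>n=-int M..int M. 1 / (1 + (real_of_int n)\<^sup>2)) \<le> 5 - 4 / (real M + 1)"
proof (induction M)
  case (Suc M)
  have "{- int (Suc M)..int (Suc M)} = insert (- int M - 1) (insert (int M + 1) {-int M..int M})"
    by auto
  then have "(\<Sum>n=-int (Suc M)..int (Suc M). 1 / (1 + (real_of_int n)\<^sup>2)) =
      2 / (1 + (real M + 1)\<^sup>2) + (\<Sum>n=-int M..int M. 1 / (1 + (real_of_int n)\<^sup>2))"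
    by (simp add: power2_eq_square algebra_simps)
  moreover have "2 / (1 + (real M + 1)\<^sup>2) \<le> 4 / (real M + 1) - 4 / (real M + 2)"
  proof -
    have "4 / (real M + 1) - 4 / (real M + 2) = 4 / ((real M + 1) * (real M + 2))"
      by (simp add: divide_simps)
    moreover have "(real M + 1) * (real M + 2) \<le> 2 * (1 + (real M + 1)\<^sup>2)"
      by (simp add: power2_eq_square algebra_simps)
    moreover have "2 / X = 4 / (2 * X)" for X :: real
      by simp
    note this[of "1 + (real M + 1)\<^sup>2"]
    ultimately show ?thesis
      by (simp only:) (rule frac_le, simp_all)
  qed
  ultimately show ?case using Suc by (simp add: add.commute)
qed simp

definition sobolev_term :: "real \<Rightarrow> (real \<Rightarrow> real) \<Rightarrow> int \<Rightarrow> real" where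
  "sobolev_term s f n = (1 + (of_int n)\<^sup>2) powr s * (cmod (fourier_coeff f n))\<^sup>2"

lemma sobolev_term_nonneg [simp]: "0 \<le> sobolev_term s f n"
  by (simp add: sobolev_term_def)

lemma sobolev_norm_altdef: "sobolev_norm s f = sqrt (\<Sum>\<^sub>\<infinity>n. sobolev_term s f n)"
  by (simp add: sobolev_norm_def sobolev_term_def)

lemma sobolevD:
  assumes "f \<in> sobolev s"
  shows "f \<in> borel_measurable borel" "\<And>x. f (x + 2 * pi) = f x" "sobolev_term s f summable_on UNIV"
  using assms by (simp_all add: sobolev_def sobolev_term_def[abs_def])

lemma sobolev_norm_nonneg [simp]: "0 \<le> sobolev_norm s f"
  by (simp add: sobolev_norm_altdef infsum_nonneg)

text \<open>
  Cauchy-Schwarz, splitting the summand into \<open>\<bar>n\<bar>\<^sup>p (1 + n\<^sup>2) powr (- s / 2)\<close>, whose square is at most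
  \<open>1 / (1 + n\<^sup>2)\<close> as \<open>p + 1 \<le> s\<close>, and a factor whose square is a term of the Sobolev norm. The constant 3
  is the square root of a bound for the sum of the \<open>1 / (1 + n\<^sup>2)\<close>.
\<close>

lemma weighted_coeff_sum_le:
  assumes f: "f \<in> sobolev s" and p: "real p + 1 \<le> s"
  shows "(\<Sum>n=-int M..int M. \<bar>of_int n\<bar> ^ p * cmod (fourier_coeff f n)) \<le> 3 * sobolev_norm s f"
proof -
  let ?A = "{-int M..int M}"
  define u where "u n = \<bar>real_of_int n\<bar> ^ p * (1 + (real_of_int n)\<^sup>2) powr (- (s / 2))" for n
  define v where "v n = (1 + (real_of_int n)\<^sup>2) powr (s / 2) * cmod (fourier_coeff f n)" for n
  have pos: "0 < 1 + (real_of_int n)\<^sup>2" for n by (simp add: add_pos_nonneg)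
  have uv: "\<bar>of_int n\<bar> ^ p * cmod (fourier_coeff f n) = \<bar>u n\<bar> * \<bar>v n\<bar>" for n
  proof -
    have "(1 + (real_of_int n)\<^sup>2) powr (- (s / 2)) * (1 + (real_of_int n)\<^sup>2) powr (s / 2) = 1"
      using pos[of n] by (simp flip: powr_add)
    then show ?thesis by (simp add: u_def v_def abs_mult power_abs mult_ac)
  qed
  have v2: "(v n)\<^sup>2 = sobolev_term s f n" for n
    by (simp add: v_def sobolev_term_def power_mult_distrib power2_eq_square[of "_ powr _"] flip: powr_add)
  have u2: "(u n)\<^sup>2 \<le> 1 / (1 + (real_of_int n)\<^sup>2)" for n
  proof -
    have "(u n)\<^sup>2 = ((real_of_int n)\<^sup>2) ^ p * (1 + (real_of_int n)\<^sup>2) powr (- s)"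
      by (simp add: u_def power_mult_distrib power2_eq_square[of "_ powr _"] flip: powr_add)
         (simp add: power_mult[symmetric] mult.commute power_even_abs)
    also have "\<dots> \<le> (1 + (real_of_int n)\<^sup>2) ^ p * (1 + (real_of_int n)\<^sup>2) powr (- s)"
      by (intro mult_right_mono power_mono) auto
    also have "\<dots> = (1 + (real_of_int n)\<^sup>2) powr (real p - s)"
      using pos[of n] by (simp flip: powr_realpow powr_add)
    also have "\<dots> \<le> (1 + (real_of_int n)\<^sup>2) powr (- 1)"
      using p by (intro powr_mono) auto
    finally show ?thesis using pos[of n] by (simp add: powr_minus_divide)
  qed
  have "L2_set u ?A \<le> sqrt 9"
  proof -
    have "(\<Sum>n\<in>?A. (u n)\<^sup>2) \<le> (\<Sum>n\<in>?A. 1 / (1 + (real_of_int n)\<^sup>2))" by (intro sum_mono u2)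
    also have "\<dots> \<le> 5 - 4 / (real M + 1)" by (rule sum_inverse_one_plus_square)
    also have "\<dots> \<le> 9" by (simp add: add_pos_nonneg field_simps)
    finally show ?thesis unfolding L2_set_def by (rule real_sqrt_le_mono)
  qed
  then have Lu: "L2_set u ?A \<le> 3" by (simp add: real_sqrt_eq_iff[symmetric])
  have Lv: "L2_set v ?A \<le> sobolev_norm s f"
    unfolding L2_set_def sobolev_norm_altdef v2
    by (intro real_sqrt_le_mono finite_sum_le_infsum sobolevD(3)[OF f]) auto
  have "(\<Sum>n\<in>?A. \<bar>u n\<bar> * \<bar>v n\<bar>) \<le> L2_set u ?A * L2_set v ?A" by (rule L2_set_mult_ineq)
  also have "\<dots> \<le> 3 * sobolev_norm s f" using Lu Lv by (intro mult_mono) auto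
  finally show ?thesis unfolding uv .
qed

text \<open>
  The modes \<open>m\<close> and \<open>- m\<close> are grouped so that the Fourier series becomes a series over the natural numbers
  whose partial sums are the symmetric ones. These weights majorise the grouped series (\<open>p = 0\<close>), its
  derivative (\<open>p = 1\<close>) and the Lipschitz constants of the derivative (\<open>p = 2\<close>).
\<close>

definition coeff_weight :: "nat \<Rightarrow> (real \<Rightarrow> real) \<Rightarrow> nat \<Rightarrow> real" where
  "coeff_weight p f m = real m ^ p *
     (cmod (fourier_coeff f (int m)) + (if m = 0 then 0 else cmod (fourier_coeff f (- int m))))"

lemma coeff_weight_nonneg [simp]: "0 \<le> coeff_weight p f m"
  by (simp add: coeff_weight_def)

lemma sum_symmetric_int:
  fixes g :: "int \<Rightarrow> 'a::comm_monoid_add"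
  shows "(\<Sum>m\<le>N. g (int m) + (if m = 0 then 0 else g (- int m))) = (\<Sum>n=-int N..int N. g n)"
proof (induction N)
  case (Suc N)
  have "{- int (Suc N)..int (Suc N)} = insert (- int N - 1) (insert (int N + 1) {-int N..int N})"
    by auto
  moreover have "- int M - 1 = - int (Suc M)" "int M + 1 = int (Suc M)" for M by simp_all
  ultimately have "sum g {- int (Suc N)..int (Suc N)}
      = g (- int (Suc N)) + (g (int (Suc N)) + sum g {-int N..int N})"
    by simp
  then show ?case unfolding sum.atMost_Suc Suc by (simp add: ac_simps)
qed simp

lemma coeff_weight_sums:
  assumes f: "f \<in> sobolev s" and p: "real p + 1 \<le> s"
  shows "summable (coeff_weight p f)" "suminf (coeff_weight p f) \<le> 3 * sobolev_norm s f"
proof -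
  have le: "(\<Sum>m\<le>N. coeff_weight p f m) \<le> 3 * sobolev_norm s f" for N
  proof -
    have "coeff_weight p f m = \<bar>real_of_int (int m)\<bar> ^ p * cmod (fourier_coeff f (int m)) +
        (if m = 0 then 0 else \<bar>real_of_int (- int m)\<bar> ^ p * cmod (fourier_coeff f (- int m)))" for m
      by (simp add: coeff_weight_def distrib_left)
    then have "(\<Sum>m\<le>N. coeff_weight p f m) =
        (\<Sum>n=-int N..int N. \<bar>real_of_int n\<bar> ^ p * cmod (fourier_coeff f n))"
      by (simp only: sum_symmetric_int[of "\<lambda>n. \<bar>real_of_int n\<bar> ^ p * cmod (fourier_coeff f n)" N])
    then show ?thesis using weighted_coeff_sum_le[OF f p, of N] by simp
  qed
  show "summable (coeff_weight p f)"
    by (rule bounded_imp_summable[OF _ le]) simp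
  have "(\<Sum>m<N. coeff_weight p f m) \<le> 3 * sobolev_norm s f" for N
    by (rule order_trans[OF sum_mono2 le[of N]]) auto
  then show "suminf (coeff_weight p f) \<le> 3 * sobolev_norm s f"
    by (intro suminf_le_const \<open>summable (coeff_weight p f)\<close>)
qed

text \<open>
  The real part of \<open>c * cis (n x)\<close>, written with real functions so that it can be differentiated
  as a function of one real variable.
\<close>

definition mode :: "complex \<Rightarrow> int \<Rightarrow> real \<Rightarrow> real" where
  "mode c n x = Re c * cos (of_int n * x) - Im c * sin (of_int n * x)"

definition mode_deriv :: "complex \<Rightarrow> int \<Rightarrow> real \<Rightarrow> real" where
  "mode_deriv c n x = - of_int n * (Re c * sin (of_int n * x) + Im c * cos (of_int n * x))"

lemma mode_eq_Re: "mode c n x = Re (c * cis (of_int n * x))"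
  by (simp add: mode_def)

lemma mode_deriv_eq_Im: "mode_deriv c n x = - of_int n * Im (c * cis (of_int n * x))"
  by (simp add: mode_deriv_def)

lemma DERIV_mode: "(mode c n has_real_derivative mode_deriv c n x) (at x within S)"
  unfolding mode_def[abs_def] mode_deriv_def
  by (auto intro!: derivative_eq_intros simp: algebra_simps)

lemma abs_mode_le: "\<bar>mode c n x\<bar> \<le> cmod c"
proof -
  have "\<bar>mode c n x\<bar> \<le> cmod (c * cis (of_int n * x))" unfolding mode_eq_Re by (rule abs_Re_le_cmod)
  then show ?thesis by (simp add: norm_mult)
qed

lemma abs_mode_deriv_le: "\<bar>mode_deriv c n x\<bar> \<le> \<bar>of_int n\<bar> * cmod c"
proof -
  have "\<bar>Im (c * cis (of_int n * x))\<bar> \<le> cmod (c * cis (of_int n * x))" by (rule abs_Im_le_cmod)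
  then show ?thesis by (simp add: mode_deriv_eq_Im abs_mult norm_mult mult_left_mono)
qed

lemma mode_deriv_lipschitz:
  "\<bar>mode_deriv c n x - mode_deriv c n y\<bar> \<le> (of_int n)\<^sup>2 * cmod c * \<bar>x - y\<bar>"
proof -
  have D: "(mode_deriv c n has_real_derivative - (of_int n)\<^sup>2 * mode c n z) (at z within UNIV)" for z
    unfolding mode_deriv_def[abs_def] mode_def
    by (auto intro!: derivative_eq_intros simp: algebra_simps power2_eq_square)
  have B: "norm (- (of_int n)\<^sup>2 * mode c n z) \<le> (of_int n)\<^sup>2 * cmod c" for z
    using abs_mode_le[of c n z] by (simp add: abs_mult mult_left_mono)
  show ?thesis
    using field_differentiable_bound[OF convex_UNIV D B, of x y] by simp
qed

definition symmetric_mode :: "(real \<Rightarrow> real) \<Rightarrow> nat \<Rightarrow> real \<Rightarrow> real" where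
  "symmetric_mode f m x = mode (fourier_coeff f (int m)) (int m) x
     + (if m = 0 then 0 else mode (fourier_coeff f (- int m)) (- int m) x)"

definition symmetric_mode_deriv :: "(real \<Rightarrow> real) \<Rightarrow> nat \<Rightarrow> real \<Rightarrow> real" where
  "symmetric_mode_deriv f m x = mode_deriv (fourier_coeff f (int m)) (int m) x
     + (if m = 0 then 0 else mode_deriv (fourier_coeff f (- int m)) (- int m) x)"

lemma DERIV_symmetric_mode:
  "(symmetric_mode f m has_real_derivative symmetric_mode_deriv f m x) (at x within S)"
  unfolding symmetric_mode_def[abs_def] symmetric_mode_deriv_def
  by (cases "m = 0") (auto intro!: derivative_intros DERIV_mode)

lemma abs_symmetric_mode_le: "\<bar>symmetric_mode f m x\<bar> \<le> coeff_weight 0 f m"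
  using abs_mode_le[of "fourier_coeff f (int m)" "int m" x]
    abs_mode_le[of "fourier_coeff f (- int m)" "- int m" x]
  by (auto simp: symmetric_mode_def coeff_weight_def)

lemma abs_symmetric_mode_deriv_le: "\<bar>symmetric_mode_deriv f m x\<bar> \<le> coeff_weight 1 f m"
  using abs_mode_deriv_le[of "fourier_coeff f (int m)" "int m" x]
    abs_mode_deriv_le[of "fourier_coeff f (- int m)" "- int m" x]
  by (auto simp: symmetric_mode_deriv_def coeff_weight_def distrib_left)

lemma symmetric_mode_deriv_lipschitz:
  "\<bar>symmetric_mode_deriv f m x - symmetric_mode_deriv f m y\<bar> \<le> coeff_weight 2 f m * \<bar>x - y\<bar>"
  using mode_deriv_lipschitz[of "fourier_coeff f (int m)" "int m" x y]
    mode_deriv_lipschitz[of "fourier_coeff f (- int m)" "- int m" x y]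
  by (auto simp: symmetric_mode_deriv_def coeff_weight_def distrib_left distrib_right)

lemma fourier_series_sums:
  assumes f: "f \<in> sobolev s" and diff: "\<And>x. f differentiable (at x)"
  shows "(\<lambda>m. symmetric_mode f m x) sums f x"
proof -
  have cont: "continuous_on UNIV f"
    using diff by (meson continuous_at_imp_continuous_on differentiable_imp_continuous_within)
  have "(\<lambda>N. \<Sum>n=-int N..int N. fourier_coeff f n * cis (of_int n * x)) \<longlonglongrightarrow> of_real (f x)"
    using fourier_inversion_symmetric[of f x, OF sobolevD(2)[OF f] diff]
    by (simp add: fourier_coeff_eq_circle_coeff[OF cont])
  then have "(\<lambda>N. Re (\<Sum>n=-int N..int N. fourier_coeff f n * cis (of_int n * x))) \<longlonglongrightarrow> f x"
    using tendsto_Re by fastforce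
  moreover have "Re (\<Sum>n=-int N..int N. fourier_coeff f n * cis (of_int n * x))
      = (\<Sum>m\<le>N. symmetric_mode f m x)" for N
    unfolding symmetric_mode_def sum_symmetric_int[of "\<lambda>n. mode (fourier_coeff f n) n x"]
    by (simp only: Re_sum mode_eq_Re)
  ultimately show ?thesis by (simp add: sums_def_le)
qed

text \<open>
  The grouped Fourier series and its derived series are dominated by \<open>coeff_weight\<close>, whose
  sums are bounded by the Sobolev norm; termwise differentiation gives all four claims. Because \<open>f\<close> is
  differentiable at every point, inversion holds at every point, and it is \<open>f\<close> itself and
  not merely a representative of its class that is estimated.
\<close>

lemma sobolev_embedding:
  assumes f: "f \<in> sobolev s" and diff: "\<And>x. f differentiable (at x)" and s: "2 \<le> s"
  shows sobolev_sup_bound: "\<bar>f x\<bar> \<le> 3 * sobolev_norm s f"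
    and sobolev_deriv_bound: "\<bar>deriv f x\<bar> \<le> 3 * sobolev_norm s f"
    and sobolev_deriv_continuous: "continuous_on UNIV (deriv f)"
    and sobolev_deriv_lipschitz:
      "3 \<le> s \<Longrightarrow> \<bar>deriv f x - deriv f y\<bar> \<le> 3 * sobolev_norm s f * \<bar>x - y\<bar>"
proof -
  note sums0 = coeff_weight_sums[OF f, of 0] and sums1 = coeff_weight_sums[OF f, of 1]
  have s0: "summable (coeff_weight 0 f)" "suminf (coeff_weight 0 f) \<le> 3 * sobolev_norm s f"
    and s1: "summable (coeff_weight 1 f)" "suminf (coeff_weight 1 f) \<le> 3 * sobolev_norm s f"
    using sums0 sums1 s by auto
  have f_eq: "f = (\<lambda>x. \<Sum>m. symmetric_mode f m x)"
    using fourier_series_sums[OF f diff] by (simp add: sums_iff fun_eq_iff)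
  show "\<bar>f x\<bar> \<le> 3 * sobolev_norm s f"
  proof -
    have "norm (\<Sum>m. symmetric_mode f m x) \<le> suminf (coeff_weight 0 f)"
      by (rule norm_suminf_le[OF _ s0(1)]) (simp add: abs_symmetric_mode_le)
    then show ?thesis using s0(2) f_eq by (metis order_trans real_norm_def)
  qed
  have unif: "uniform_limit UNIV (\<lambda>N x. \<Sum>m<N. symmetric_mode_deriv f m x)
      (\<lambda>x. \<Sum>m. symmetric_mode_deriv f m x) sequentially"
    by (rule Weierstrass_m_test[OF _ s1(1)]) (simp only: real_norm_def abs_symmetric_mode_deriv_le)
  have deriv_eq: "deriv f = (\<lambda>x. \<Sum>m. symmetric_mode_deriv f m x)"
  proof
    fix x
    have "((\<lambda>x. \<Sum>m. symmetric_mode f m x) has_real_derivative (\<Sum>m. symmetric_mode_deriv f m x)) (at x)"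
      using unif fourier_series_sums[OF f diff, of x]
      by (intro has_field_derivative_series'(2)[of UNIV _ _ x])
         (auto intro: DERIV_symmetric_mode uniformly_convergentI sums_summable)
    then show "deriv f x = (\<Sum>m. symmetric_mode_deriv f m x)"
      using f_eq DERIV_imp_deriv by metis
  qed
  have abs1: "norm (symmetric_mode_deriv f m x) \<le> coeff_weight 1 f m" for m x
    using abs_symmetric_mode_deriv_le by simp
  have summ: "summable (\<lambda>m. symmetric_mode_deriv f m x)" for x
    by (rule summable_comparison_test'[OF s1(1)]) (rule abs1)
  show "\<bar>deriv f x\<bar> \<le> 3 * sobolev_norm s f"
    using norm_suminf_le[OF abs1[of _ x] s1(1)] s1(2) unfolding deriv_eq by simp
  have cont: "continuous_on UNIV (symmetric_mode_deriv f m)" for m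
    unfolding symmetric_mode_deriv_def[abs_def] mode_deriv_def
    by (cases "m = 0") (auto intro!: continuous_intros)
  show "continuous_on UNIV (deriv f)"
    unfolding deriv_eq
    by (rule uniform_limit_theorem[OF _ unif])
       (auto intro!: always_eventually continuous_on_sum cont)
  show "\<bar>deriv f x - deriv f y\<bar> \<le> 3 * sobolev_norm s f * \<bar>x - y\<bar>" if "3 \<le> s"
  proof -
    have s2: "summable (coeff_weight 2 f)" "suminf (coeff_weight 2 f) \<le> 3 * sobolev_norm s f"
      using coeff_weight_sums[OF f, of 2] that by auto
    have "deriv f x - deriv f y = (\<Sum>m. symmetric_mode_deriv f m x - symmetric_mode_deriv f m y)"
      unfolding deriv_eq by (rule suminf_diff[OF summ summ])
    also have "norm \<dots> \<le> (\<Sum>m. coeff_weight 2 f m * \<bar>x - y\<bar>)"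
      by (rule norm_suminf_le) (use symmetric_mode_deriv_lipschitz summable_mult2[OF s2(1)] in auto)
    also have "\<dots> = suminf (coeff_weight 2 f) * \<bar>x - y\<bar>"
      by (rule suminf_mult2[OF s2(1), symmetric])
    also have "\<dots> \<le> 3 * sobolev_norm s f * \<bar>x - y\<bar>" by (rule mult_right_mono[OF s2(2)]) simp
    finally show ?thesis by simp
  qed
qed

lemma fourier_coeff_diff:
  assumes "continuous_on UNIV f" "continuous_on UNIV g"
  shows "fourier_coeff (\<lambda>x. f x - g x) n = fourier_coeff f n - fourier_coeff g n"
proof -
  have int: "(\<lambda>x. complex_of_real (h x) * cis (- (of_int n * x))) integrable_on {0..2 * pi}"
    if "continuous_on UNIV h" for h
    by (intro integrable_continuous_interval continuous_intros continuous_on_subset[OF that]) simp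
  have "integral {0..2 * pi} (\<lambda>x. complex_of_real (f x - g x) * cis (- (of_int n * x))) =
      integral {0..2 * pi} (\<lambda>x. complex_of_real (f x) * cis (- (of_int n * x))) -
      integral {0..2 * pi} (\<lambda>x. complex_of_real (g x) * cis (- (of_int n * x)))"
    unfolding of_real_diff left_diff_distrib
    by (rule integral_diff) (intro int assms)+
  then show ?thesis
    unfolding fourier_coeff_eq_circle_coeff[OF assms(1)] fourier_coeff_eq_circle_coeff[OF assms(2)]
      fourier_coeff_eq_circle_coeff[OF continuous_on_diff[OF assms]] circle_coeff_def
    by (simp only: diff_divide_distrib)
qed

lemma cmod_sum_squared_le: "(cmod (a + b))\<^sup>2 \<le> 2 * (cmod a)\<^sup>2 + 2 * (cmod b)\<^sup>2"
proof -
  have "(cmod (a + b))\<^sup>2 \<le> (cmod a + cmod b)\<^sup>2"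
    by (rule power_mono[OF norm_triangle_ineq]) simp
  also have "\<dots> \<le> 2 * (cmod a)\<^sup>2 + 2 * (cmod b)\<^sup>2"
    using zero_le_power2[of "cmod a - cmod b"] unfolding power2_sum power2_diff by linarith
  finally show ?thesis .
qed

lemma sobolev_term_diff_le:
  assumes "continuous_on UNIV f" "continuous_on UNIV g"
  shows "sobolev_term s (\<lambda>x. f x - g x) n \<le> 2 * sobolev_term s f n + 2 * sobolev_term s g n"
    "sobolev_term s f n \<le> 2 * sobolev_term s (\<lambda>x. f x - g x) n + 2 * sobolev_term s g n"
  unfolding sobolev_term_def fourier_coeff_diff[OF assms]
  using mult_left_mono[OF cmod_sum_squared_le[of "fourier_coeff f n" "- fourier_coeff g n"],
      of "(1 + (real_of_int n)\<^sup>2) powr s"]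
    mult_left_mono[OF cmod_sum_squared_le[of "fourier_coeff f n - fourier_coeff g n" "fourier_coeff g n"],
      of "(1 + (real_of_int n)\<^sup>2) powr s"]
  by (simp_all add: algebra_simps)

lemma sobolev_diff:
  assumes f: "f \<in> sobolev s" "continuous_on UNIV f" and g: "g \<in> sobolev s" "continuous_on UNIV g"
  shows "(\<lambda>x. f x - g x) \<in> sobolev s"
proof -
  have "(\<lambda>n. 2 * sobolev_term s f n + 2 * sobolev_term s g n) summable_on UNIV"
    by (intro summable_on_add summable_on_cmult_right sobolevD(3) f g)
  then have "sobolev_term s (\<lambda>x. f x - g x) summable_on UNIV"
    by (rule summable_on_comparison_test) (use sobolev_term_diff_le[OF f(2) g(2)] in auto)
  moreover have "set_integrable lborel {0..<2 * pi} (\<lambda>x. (f x - g x)\<^sup>2)"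
    by (rule set_integrable_subset[OF borel_integrable_atLeastAtMost'[of 0 "2 * pi"]])
       (auto intro!: continuous_intros continuous_on_subset[OF f(2)] continuous_on_subset[OF g(2)])
  ultimately show ?thesis
    using sobolevD(1,2)[OF f(1)] sobolevD(1,2)[OF g(1)]
    by (simp add: sobolev_def sobolev_term_def[abs_def])
qed

text \<open>
  A triangle inequality with constant 2 is enough to pass from continuity in time to boundedness on
  compact time intervals.
\<close>

lemma sobolev_norm_le_diff:
  assumes f: "f \<in> sobolev s" "continuous_on UNIV f" and g: "g \<in> sobolev s" "continuous_on UNIV g"
  shows "sobolev_norm s f \<le> 2 * sobolev_norm s (\<lambda>x. f x - g x) + 2 * sobolev_norm s g"
proof -
  let ?d = "\<lambda>x. f x - g x"
  let ?S = "\<lambda>f. \<Sum>\<^sub>\<infinity>n. sobolev_term s f n"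
  have sum: "sobolev_term s ?d summable_on UNIV" "sobolev_term s g summable_on UNIV"
    by (intro sobolevD(3) sobolev_diff f g)+
  have "?S f \<le> (\<Sum>\<^sub>\<infinity>n. 2 * sobolev_term s ?d n + 2 * sobolev_term s g n)"
    by (intro infsum_mono summable_on_add summable_on_cmult_right sum sobolevD(3)[OF f(1)]
        sobolev_term_diff_le f g)
  also have "\<dots> = 2 * ?S ?d + 2 * ?S g"
    by (simp add: infsum_add infsum_cmult_right summable_on_cmult_right sum)
  also have "\<dots> \<le> (2 * sqrt (?S ?d) + 2 * sqrt (?S g))\<^sup>2"
    by (simp add: power2_sum power_mult_distrib infsum_nonneg)
  finally show ?thesis
    unfolding sobolev_norm_altdef by (intro real_le_lsqrt) (simp_all add: infsum_nonneg)
qed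

section \<open>Transport equations and smooth solutions of the conservation law\<close>

lemma periodic_representative:
  fixes x :: real
  assumes "0 < p"
  obtains y k where "y \<in> {0..<p}" "x = y + of_int k * p"
proof
  show "x - of_int \<lfloor>x / p\<rfloor> * p \<in> {0..<p}"
    using floor_divide_lower[OF assms, of x] floor_divide_upper[OF assms, of x]
    by (auto simp: algebra_simps)
  show "x = x - of_int \<lfloor>x / p\<rfloor> * p + of_int \<lfloor>x / p\<rfloor> * p" by simp
qed

text \<open>
  Continuity in space at each time, together with continuity in time for the supremum norm in space,
  is joint continuity.
\<close>

lemma continuous_on_pairs:
  fixes g :: "real \<Rightarrow> real \<Rightarrow> real"
  assumes cont: "\<And>t. t \<in> I \<Longrightarrow> continuous_on UNIV (\<lambda>x. g x t)"
    and bound: "\<And>x t r. \<lbrakk>t \<in> I; r \<in> I\<rbrakk> \<Longrightarrow> \<bar>g x r - g x t\<bar> \<le> N r t"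
    and lim: "\<And>t. t \<in> I \<Longrightarrow> ((\<lambda>r. N r t) \<longlongrightarrow> 0) (at t within I)"
  shows "continuous_on (UNIV \<times> I) (\<lambda>(x, t). g x t)"
proof -
  have "((\<lambda>(y, r). g y r) \<longlongrightarrow> g x t) (at (x, t) within UNIV \<times> I)" if t: "t \<in> I" for x t
  proof (rule tendstoI)
    fix e :: real assume e: "0 < e"
    obtain d1 where d1: "0 < d1" "\<And>y. \<bar>y - x\<bar> < d1 \<Longrightarrow> \<bar>g y t - g x t\<bar> < e / 2"
      using cont[OF t] e unfolding continuous_on_iff
      by (metis UNIV_I dist_real_def half_gt_zero)
    have "\<forall>\<^sub>F r in at t within I. N r t < e / 2"
      using order_tendstoD(2)[OF lim[OF t], of "e / 2"] e by simp
    then obtain d2 where d2: "0 < d2" "\<And>r. \<lbrakk>r \<in> I; r \<noteq> t; \<bar>r - t\<bar> < d2\<rbrakk> \<Longrightarrow> N r t < e / 2"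
      unfolding eventually_at by (auto simp: dist_real_def)
    have near: "\<bar>g y r - g y t\<bar> < e / 2" if "r \<in> I" "\<bar>r - t\<bar> < d2" for y r
      using d2(2)[of r] that bound[OF t that(1), of y] e by (cases "r = t") auto
    have "dist (g y r) (g x t) < e" if r: "r \<in> I" and d: "dist (y, r) (x, t) < min d1 d2" for y r
    proof -
      have "\<bar>y - x\<bar> < d1" "\<bar>r - t\<bar> < d2"
        using d dist_fst_le[of "(y, r)" "(x, t)"] dist_snd_le[of "(y, r)" "(x, t)"]
        by (auto simp: dist_real_def)
      then have "\<bar>g y t - g x t\<bar> < e / 2" "\<bar>g y r - g y t\<bar> < e / 2" using d1(2) near[OF r] by auto
      then show ?thesis unfolding dist_real_def by linarith
    qed
    then show "\<forall>\<^sub>F z in at (x, t) within UNIV \<times> I. dist (case z of (y, r) \<Rightarrow> g y r) (g x t) < e"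
      unfolding eventually_at using d1(1) d2(1) by (intro exI[of _ "min d1 d2"]) auto
  qed
  then show ?thesis unfolding continuous_on_def by auto
qed

text \<open>
  Periodicity reduces a pair of points on the line to a compact rectangle. The rectangle is one unit
  wider than the period on both sides, so that the second point stays inside.
\<close>

lemma periodic_uniformly_continuous:
  fixes g :: "real \<Rightarrow> real \<Rightarrow> real"
  assumes cont: "continuous_on (UNIV \<times> {0..b}) (\<lambda>(x, t). g x t)" and e: "0 < e" and p: "0 < p"
    and per: "\<And>x t. t \<in> {0..b} \<Longrightarrow> g (x + p) t = g x t"
  shows "\<exists>d>0. \<forall>x y t r. t \<in> {0..b} \<and> r \<in> {0..b} \<and> \<bar>x - y\<bar> < d \<and> \<bar>t - r\<bar> < d
           \<longrightarrow> \<bar>g x t - g y r\<bar> < e"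
proof -
  have "uniformly_continuous_on ({-1..p + 1} \<times> {0..b}) (\<lambda>(x, t). g x t)"
    by (rule compact_uniformly_continuous)
       (auto intro!: compact_Times continuous_on_subset[OF cont])
  then obtain d where d: "0 < d" and unif: "\<And>z w. \<lbrakk>z \<in> {-1..p + 1} \<times> {0..b}; w \<in> {-1..p + 1} \<times> {0..b};
      dist w z < d\<rbrakk> \<Longrightarrow> dist ((\<lambda>(x, t). g x t) w) ((\<lambda>(x, t). g x t) z) < e"
    unfolding uniformly_continuous_on_def using e by metis
  define d' where "d' = min 1 (d / 2)"
  have "\<bar>g x t - g y r\<bar> < e"
    if tr: "t \<in> {0..b}" "r \<in> {0..b}" and xy: "\<bar>x - y\<bar> < d'" "\<bar>t - r\<bar> < d'" for x y t r
  proof -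
    obtain z k where z: "z \<in> {0..<p}" "x = z + of_int k * p" using periodic_representative[OF p] .
    define w where "w = y - of_int k * p"
    have y: "y = w + of_int k * p" by (simp add: w_def)
    have eq: "g x t = g z t" "g y r = g w r"
      unfolding z y by (rule periodic_int_multiple[of "\<lambda>x. g x _", OF per]; fact tr)+
    have wz: "\<bar>z - w\<bar> < d'" using xy(1) unfolding z(2) y by simp
    have "dist (z, t) (w, r) \<le> \<bar>z - w\<bar> + \<bar>t - r\<bar>"
      by (simp add: dist_Pair_Pair dist_real_def sqrt_sum_squares_le_sum_abs)
    also have "\<dots> < d" using wz xy(2) by (simp add: d'_def)
    finally have "dist ((\<lambda>(x, t). g x t) (z, t)) ((\<lambda>(x, t). g x t) (w, r)) < e"
      using z(1) wz tr by (intro unif) (auto simp: d'_def)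
    then show ?thesis by (simp add: eq dist_real_def)
  qed
  moreover have "0 < d'" using d by (simp add: d'_def)
  ultimately show ?thesis by blast
qed

text \<open>
  If the bound failed, \<open>q - e t\<close> with small \<open>e > 0\<close> would attain its maximum at a positive time. The space
  derivative vanishes there, so the equation makes the time derivative equal to \<open>- e < 0\<close>, and slightly
  earlier values would be larger.
\<close>

lemma transport_maximum_principle:
  fixes q qx a :: "real \<Rightarrow> real \<Rightarrow> real"
  assumes cont: "continuous_on (UNIV \<times> {0..<T}) (\<lambda>(x, t). q x t)" and p: "0 < p"
    and per: "\<And>x t. t \<in> {0..<T} \<Longrightarrow> q (x + p) t = q x t"
    and Dx: "\<And>x t. t \<in> {0..<T} \<Longrightarrow> ((\<lambda>y. q y t) has_real_derivative qx x t) (at x)"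
    and Dt: "\<And>x t. t \<in> {0..<T} \<Longrightarrow>
      ((\<lambda>r. q x r) has_real_derivative - a x t * qx x t) (at t within {0..<T})"
    and init: "\<And>x. q x 0 \<le> M" and t: "t \<in> {0..<T}"
  shows "q x t \<le> M"
proof (rule ccontr)
  assume "\<not> q x t \<le> M"
  then have gt: "M < q x t" by simp
  define e where "e = (q x t - M) / 2 / (t + 1)"
  have e: "0 < e" using gt t by (simp add: e_def)
  have "e * t \<le> e * (t + 1)" using e by simp
  also have "\<dots> = (q x t - M) / 2"
  proof -
    have "t + 1 \<noteq> 0" using t by auto
    from nonzero_eq_divide_eq[THEN iffD1, OF this e_def] show ?thesis .
  qed
  also have "\<dots> < q x t - M" using gt by simp
  finally have et: "M < q x t - e * t" by simp
  define w where "w y r = q y r - e * r" for y r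
  have contw: "continuous_on ({0..p} \<times> {0..t}) (\<lambda>(x, t). w x t)"
  proof -
    have "{0..p} \<times> {0..t} \<subseteq> UNIV \<times> {0..<T}" using t by auto
    from continuous_on_subset[OF cont this]
    have "continuous_on ({0..p} \<times> {0..t}) (\<lambda>z. q (fst z) (snd z))" by (simp add: split_beta)
    then show ?thesis unfolding w_def split_beta by (intro continuous_intros)
  qed
  have ne: "{0..p} \<times> {0..t} \<noteq> {}" using p t by auto
  have comp: "compact ({0..p} \<times> {0..t})" by (intro compact_Times compact_Icc)
  obtain y r where y: "y \<in> {0..p}" and r: "r \<in> {0..t}"
    and sup: "\<And>z u. \<lbrakk>z \<in> {0..p}; u \<in> {0..t}\<rbrakk> \<Longrightarrow> w z u \<le> w y r"
    using continuous_attains_sup[OF comp ne contw] by fastforce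
  have rT: "r \<in> {0..<T}" using r t by auto
  have sup': "w z u \<le> w y r" if u: "u \<in> {0..t}" for z u
  proof -
    obtain z' k where z': "z' \<in> {0..<p}" "z = z' + of_int k * p" using periodic_representative[OF p] .
    have "u \<in> {0..<T}" using u t by auto
    then have "q z u = q z' u"
      unfolding z'(2) by (intro periodic_int_multiple[of "\<lambda>x. q x u"] per)
    then show ?thesis using sup[of z' u] z'(1) u by (simp add: w_def)
  qed
  have "M < w y r" using sup'[of t x] et t by (simp add: w_def)
  then have "r \<noteq> 0" using init[of y] by (auto simp: w_def)
  then have r0: "0 < r" using r by auto
  have "qx y r = 0"
  proof (rule DERIV_local_max[OF Dx[OF rT, of y] zero_less_one])
    show "\<forall>z. \<bar>y - z\<bar> < 1 \<longrightarrow> q z r \<le> q y r" using sup'[OF r] by (auto simp: w_def)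
  qed
  then have "((\<lambda>u. w y u) has_real_derivative - e) (at r within {0..<T})"
    unfolding w_def using Dt[OF rT, of y] by (auto intro!: derivative_eq_intros)
  then obtain d where d: "0 < d" "\<And>h. \<lbrakk>0 < h; r - h \<in> {0..<T}; h < d\<rbrakk> \<Longrightarrow> w y r < w y (r - h)"
    using has_real_derivative_neg_dec_left[of "\<lambda>u. w y u" "- e" r "{0..<T}"] e by auto
  define h where "h = min (d / 2) r"
  have "w y r < w y (r - h)" using d(1) r0 rT by (intro d(2)) (auto simp: h_def)
  moreover have "w y (r - h) \<le> w y r" using d(1) r0 r by (intro sup') (auto simp: h_def)
  ultimately show False by simp
qed

locale smooth_solution =
  fixes \<alpha> \<beta> T s :: real and Q\<^sub>0 :: "real \<Rightarrow> real" and Q :: "real \<Rightarrow> real \<Rightarrow> real"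
  assumes solution: "conservation_law_solution \<alpha> \<beta> T s Q\<^sub>0 Q" and s_ge_2: "2 \<le> s" and T_pos: "0 < T"
    and Q\<^sub>0_measurable: "Q\<^sub>0 \<in> borel_measurable borel"
begin

definition Qx :: "real \<Rightarrow> real \<Rightarrow> real" where
  "Qx x t = deriv (\<lambda>y. Q y t) x"

definition speed :: "real \<Rightarrow> real \<Rightarrow> real" where
  "speed x t = 2 * \<alpha> * Q x t + \<beta>"

lemma slice:
  assumes "t \<in> {0..<T}"
  shows slice_sobolev: "(\<lambda>x. Q x t) \<in> sobolev s"
    and slice_differentiable: "\<And>x. (\<lambda>y. Q y t) differentiable (at x)"
    and slice_mean: "torus_integral (\<lambda>x. Q x t) = 0"
  using assms solution by (auto simp: conservation_law_solution_def continuous_in_sobolev_def)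

lemma DERIV_space:
  assumes "t \<in> {0..<T}"
  shows "((\<lambda>y. Q y t) has_real_derivative Qx x t) (at x)"
  using slice_differentiable[OF assms] unfolding Qx_def
  by (simp add: DERIV_deriv_iff_real_differentiable)

lemma DERIV_time:
  assumes t: "t \<in> {0..<T}"
  shows "((\<lambda>r. Q x r) has_real_derivative - speed x t * Qx x t) (at t within {0..<T})"
proof -
  have "((\<lambda>y. flux \<alpha> \<beta> (Q y t)) has_real_derivative speed x t * Qx x t) (at x)"
    unfolding flux_def speed_def
    by (auto intro!: derivative_eq_intros DERIV_space[OF t] simp: algebra_simps)
  then have "deriv (\<lambda>y. flux \<alpha> \<beta> (Q y t)) x = speed x t * Qx x t" by (rule DERIV_imp_deriv)
  moreover have "((\<lambda>r. Q x r) has_real_derivative - deriv (\<lambda>y. flux \<alpha> \<beta> (Q y t)) x) (at t within {0..<T})"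
    using solution t by (simp add: conservation_law_solution_def)
  ultimately show ?thesis by simp
qed

lemma continuous_slice:
  assumes "t \<in> {0..<T}"
  shows "continuous_on UNIV (\<lambda>x. Q x t)"
  using DERIV_space[OF assms] DERIV_isCont by (blast intro: continuous_at_imp_continuous_on)

lemma Q_periodic: "t \<in> {0..<T} \<Longrightarrow> Q (x + 2 * pi) t = Q x t"
  using sobolevD(2)[OF slice_sobolev] by auto

lemma Qx_periodic:
  assumes "t \<in> {0..<T}"
  shows "Qx (x + 2 * pi) t = Qx x t"
proof -
  have "((\<lambda>y. Q (y + 2 * pi) t) has_real_derivative Qx (x + 2 * pi) t) (at x)"
    using DERIV_space[OF assms, of "x + 2 * pi"] by (simp add: DERIV_shift)
  then show ?thesis unfolding Q_periodic[OF assms] using DERIV_space[OF assms] DERIV_unique by blast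
qed

lemma slice_bounds:
  assumes "t \<in> {0..<T}" "sobolev_norm s (\<lambda>x. Q x t) \<le> M"
  shows "\<bar>Q x t\<bar> \<le> 3 * M" "\<bar>Qx x t\<bar> \<le> 3 * M" "3 \<le> s \<Longrightarrow> \<bar>Qx x t - Qx y t\<bar> \<le> 3 * M * \<bar>x - y\<bar>"
proof -
  note emb = sobolev_embedding[OF slice_sobolev[OF assms(1)] slice_differentiable[OF assms(1)] s_ge_2]
  show "\<bar>Q x t\<bar> \<le> 3 * M" "\<bar>Qx x t\<bar> \<le> 3 * M"
    using emb(1)[of x] emb(2)[of x] assms(2) unfolding Qx_def by linarith+
  show "\<bar>Qx x t - Qx y t\<bar> \<le> 3 * M * \<bar>x - y\<bar>" if "3 \<le> s"
    using order_trans[OF emb(4)[OF that, of x y] mult_right_mono] assms(2) unfolding Qx_def by force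
qed

lemma slice_difference:
  assumes t: "t \<in> {0..<T}" and r: "r \<in> {0..<T}"
  defines "N \<equiv> 3 * sobolev_norm s (\<lambda>x. Q x r - Q x t)"
  shows "\<bar>Q x r - Q x t\<bar> \<le> N" "\<bar>Qx x r - Qx x t\<bar> \<le> N"
proof -
  have D: "((\<lambda>x. Q x r - Q x t) has_real_derivative Qx x r - Qx x t) (at x)" for x
    by (intro derivative_intros DERIV_space t r)
  have mem: "(\<lambda>x. Q x r - Q x t) \<in> sobolev s"
    by (intro sobolev_diff slice_sobolev continuous_slice t r)
  have diff: "(\<lambda>x. Q x r - Q x t) differentiable (at x)" for x
    using D by (auto simp: real_differentiable_def)
  note emb = sobolev_embedding[OF mem diff s_ge_2]
  show "\<bar>Q x r - Q x t\<bar> \<le> N" unfolding N_def by (rule emb(1))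
  show "\<bar>Qx x r - Qx x t\<bar> \<le> N" unfolding N_def using emb(2)[of x] DERIV_imp_deriv[OF D] by simp
qed

lemma slice_difference_tendsto:
  assumes "t \<in> {0..<T}"
  shows "((\<lambda>r. 3 * sobolev_norm s (\<lambda>x. Q x r - Q x t)) \<longlongrightarrow> 0) (at t within {0..<T})"
  using solution assms
  by (auto simp: conservation_law_solution_def continuous_in_sobolev_def intro: tendsto_mult_right_zero)

lemma continuous_Q: "continuous_on (UNIV \<times> {0..<T}) (\<lambda>(x, t). Q x t)"
  by (rule continuous_on_pairs[OF continuous_slice slice_difference(1) slice_difference_tendsto])

lemma continuous_Qx: "continuous_on (UNIV \<times> {0..<T}) (\<lambda>(x, t). Qx x t)"
proof (rule continuous_on_pairs[OF _ slice_difference(2) slice_difference_tendsto])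
  show "continuous_on UNIV (\<lambda>x. Qx x t)" if "t \<in> {0..<T}" for t
    using sobolev_embedding(3)[OF slice_sobolev slice_differentiable s_ge_2, OF that that]
    unfolding Qx_def .
qed

text \<open>
  Continuity in time bounds the norm near each time by twice its value there plus a constant; finitely
  many such neighbourhoods cover \<open>[0, b]\<close>.
\<close>

lemma sobolev_norm_locally_bounded:
  assumes b: "b < T"
  obtains M where "\<And>t. t \<in> {0..b} \<Longrightarrow> sobolev_norm s (\<lambda>x. Q x t) \<le> M"
proof -
  have sub: "t \<in> {0..<T}" if "t \<in> {0..b}" for t using that b by auto
  have "\<exists>d>0. \<forall>r\<in>{0..b}. \<bar>r - t\<bar> < d \<longrightarrow>
      sobolev_norm s (\<lambda>x. Q x r) \<le> 2 + 2 * sobolev_norm s (\<lambda>x. Q x t)" if t: "t \<in> {0..b}" for t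
  proof -
    have "\<forall>\<^sub>F r in at t within {0..<T}. 3 * sobolev_norm s (\<lambda>x. Q x r - Q x t) < 1"
      using order_tendstoD(2)[OF slice_difference_tendsto[OF sub[OF t]], of 1] by simp
    then obtain d where d: "0 < d" "\<And>r. \<lbrakk>r \<in> {0..<T}; r \<noteq> t; \<bar>r - t\<bar> < d\<rbrakk> \<Longrightarrow>
        3 * sobolev_norm s (\<lambda>x. Q x r - Q x t) < 1"
      unfolding eventually_at by (auto simp: dist_real_def)
    have "sobolev_norm s (\<lambda>x. Q x r) \<le> 2 + 2 * sobolev_norm s (\<lambda>x. Q x t)"
      if r: "r \<in> {0..b}" "\<bar>r - t\<bar> < d" for r
    proof (cases "r = t")
      case True
      then show ?thesis using sobolev_norm_nonneg[of s "\<lambda>x. Q x t"] by simp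
    next
      case False
      note rT = sub[OF r(1)] and tT = sub[OF t]
      have "sobolev_norm s (\<lambda>x. Q x r) \<le>
          2 * sobolev_norm s (\<lambda>x. Q x r - Q x t) + 2 * sobolev_norm s (\<lambda>x. Q x t)"
        by (rule sobolev_norm_le_diff[OF slice_sobolev[OF rT] continuous_slice[OF rT]
              slice_sobolev[OF tT] continuous_slice[OF tT]])
      then show ?thesis using d(2)[OF rT False r(2)] by linarith
    qed
    then show ?thesis using d(1) by blast
  qed
  then obtain d where d: "\<And>t. t \<in> {0..b} \<Longrightarrow> 0 < d t"
    and dN: "\<And>t r. \<lbrakk>t \<in> {0..b}; r \<in> {0..b}; \<bar>r - t\<bar> < d t\<rbrakk> \<Longrightarrow>
      sobolev_norm s (\<lambda>x. Q x r) \<le> 2 + 2 * sobolev_norm s (\<lambda>x. Q x t)"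
    by metis
  have "{0..b} \<subseteq> (\<Union>t\<in>{0..b}. ball t (d t))" using d by force
  then obtain C where C: "C \<subseteq> {0..b}" "finite C" "{0..b} \<subseteq> (\<Union>t\<in>C. ball t (d t))"
    using compactE_image[OF compact_Icc[of 0 b], of "{0..b}" "\<lambda>t. ball t (d t)"] open_ball by metis
  have "sobolev_norm s (\<lambda>x. Q x r) \<le> (\<Sum>t\<in>C. 2 + 2 * sobolev_norm s (\<lambda>x. Q x t))"
    if r: "r \<in> {0..b}" for r
  proof -
    obtain t where t: "t \<in> C" "\<bar>r - t\<bar> < d t"
      using C(3) r by (auto simp: dist_real_def abs_minus_commute)
    have "sobolev_norm s (\<lambda>x. Q x r) \<le> 2 + 2 * sobolev_norm s (\<lambda>x. Q x t)"
      using t C(1) r by (intro dN) auto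
    also have "\<dots> \<le> (\<Sum>t\<in>C. 2 + 2 * sobolev_norm s (\<lambda>x. Q x t))"
      using C(2) t(1) by (intro member_le_sum) auto
    finally show ?thesis .
  qed
  then show thesis by (rule that)
qed

lemma maximum_principle:
  assumes init: "\<And>x. \<bar>Q x 0\<bar> \<le> M" and t: "t \<in> {0..<T}"
  shows "\<bar>Q x t\<bar> \<le> M"
proof -
  have 1: "Q y 0 \<le> M" "- Q y 0 \<le> M" for y using init[of y] by linarith+
  have 2: "0 < 2 * pi" by simp
  have neg: "continuous_on (UNIV \<times> {0..<T}) (\<lambda>(x, t). - Q x t)"
    using continuous_on_minus[OF continuous_Q] by (simp add: split_beta)
  have neg_per: "- Q (y + 2 * pi) r = - Q y r" if "r \<in> {0..<T}" for y r
    using Q_periodic[OF that] by simp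
  have neg_Dt: "((\<lambda>r. - Q y r) has_real_derivative - speed y r * - Qx y r) (at r within {0..<T})"
    if "r \<in> {0..<T}" for y r
    using DERIV_minus[OF DERIV_time[OF that]] by simp
  have "Q x t \<le> M"
    by (rule transport_maximum_principle[where qx = Qx and a = speed, OF continuous_Q 2 Q_periodic
          DERIV_space DERIV_time 1(1) t])
  moreover have "- Q x t \<le> M"
    by (rule transport_maximum_principle[where q = "\<lambda>x t. - Q x t" and qx = "\<lambda>x t. - Qx x t"
          and a = speed, OF neg 2 neg_per DERIV_minus[OF DERIV_space] neg_Dt 1(2) t])
  ultimately show ?thesis by simp
qed

lemma space_lipschitz:
  assumes "t \<in> {0..<T}" "\<And>x. \<bar>Qx x t\<bar> \<le> L"
  shows "\<bar>Q x t - Q y t\<bar> \<le> L * \<bar>x - y\<bar>"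
  using field_differentiable_bound[of UNIV "\<lambda>y. Q y t" "\<lambda>x. Qx x t" L x y] DERIV_space[OF assms(1)] assms(2)
  by simp

lemma time_lipschitz:
  assumes I: "I \<subseteq> {0..<T}" "convex I" and L: "\<And>x t. t \<in> I \<Longrightarrow> \<bar>Qx x t\<bar> \<le> L"
    and V: "\<And>x t. t \<in> I \<Longrightarrow> \<bar>speed x t\<bar> \<le> V" and tr: "t \<in> I" "r \<in> I"
  shows "\<bar>Q x t - Q x r\<bar> \<le> V * L * \<bar>t - r\<bar>"
proof -
  have D: "((\<lambda>u. Q x u) has_real_derivative - speed x u * Qx x u) (at u within I)" if "u \<in> I" for u
    using DERIV_time[of u x] that I(1) by (meson DERIV_subset subsetD)
  have "norm (- speed x u * Qx x u) \<le> V * L" if "u \<in> I" for u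
    using mult_mono[OF V[OF that, of x] L[OF that, of x]] order_trans[OF abs_ge_zero V[OF that, of x]]
    by (simp add: abs_mult)
  then show ?thesis using field_differentiable_bound[OF I(2) D, of "V * L" t r] tr by simp
qed

text \<open>
  The slope itself need not be differentiable in time, but a spatial difference quotient of \<open>Q\<close> is. By the equation its time derivative is a difference quotient of
  \<open>speed * Qx\<close>, which is Lipschitz in space with the constant below. The bound survives the
  limit of the difference quotients.
\<close>

lemma slope_time_lipschitz:
  assumes I: "I \<subseteq> {0..<T}" "convex I" and L: "\<And>x t. t \<in> I \<Longrightarrow> \<bar>Qx x t\<bar> \<le> L"
    and V: "\<And>x t. t \<in> I \<Longrightarrow> \<bar>speed x t\<bar> \<le> V"
    and K: "\<And>x y t. t \<in> I \<Longrightarrow> \<bar>Qx x t - Qx y t\<bar> \<le> K * \<bar>x - y\<bar>" and tr: "t \<in> I" "r \<in> I"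
  shows "\<bar>Qx x t - Qx x r\<bar> \<le> (V * K + 2 * \<bar>\<alpha>\<bar> * L * L) * \<bar>t - r\<bar>"
proof -
  define P where "P = V * K + 2 * \<bar>\<alpha>\<bar> * L * L"
  have flux: "\<bar>speed x u * Qx x u - speed y u * Qx y u\<bar> \<le> P * \<bar>x - y\<bar>" if u: "u \<in> I" for x y u
  proof -
    have "u \<in> {0..<T}" using u I(1) by auto
    then have "\<bar>Q x u - Q y u\<bar> \<le> L * \<bar>x - y\<bar>" by (rule space_lipschitz[OF _ L[OF u]])
    then have sp: "\<bar>speed x u - speed y u\<bar> \<le> 2 * \<bar>\<alpha>\<bar> * (L * \<bar>x - y\<bar>)"
      unfolding speed_def by (simp add: abs_mult mult_left_mono flip: right_diff_distrib)
    have "\<bar>speed x u * Qx x u - speed y u * Qx y u\<bar>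
        \<le> \<bar>speed x u\<bar> * \<bar>Qx x u - Qx y u\<bar> + \<bar>speed x u - speed y u\<bar> * \<bar>Qx y u\<bar>"
      unfolding abs_mult[symmetric] by (rule order_trans[OF _ abs_triangle_ineq]) (simp add: algebra_simps)
    also have "\<dots> \<le> V * (K * \<bar>x - y\<bar>) + (2 * \<bar>\<alpha>\<bar> * (L * \<bar>x - y\<bar>)) * L"
      by (intro add_mono mult_mono V[OF u] K[OF u] L[OF u] sp order_trans[OF abs_ge_zero V[OF u]]
          order_trans[OF abs_ge_zero sp]) auto
    finally show ?thesis by (simp add: P_def algebra_simps)
  qed
  have diff: "\<bar>(Q (x + h) t - Q x t) / h - (Q (x + h) r - Q x r) / h\<bar> \<le> P * \<bar>t - r\<bar>" if h: "h \<noteq> 0" for h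
  proof -
    have D: "((\<lambda>u. Q (x + h) u - Q x u) has_real_derivative
        - speed (x + h) u * Qx (x + h) u - (- speed x u * Qx x u)) (at u within I)" if "u \<in> I" for u
      using that I(1) by (intro DERIV_diff DERIV_subset[OF DERIV_time]) auto
    have "norm (- speed (x + h) u * Qx (x + h) u - (- speed x u * Qx x u)) \<le> P * \<bar>h\<bar>" if "u \<in> I" for u
      using flux[OF that, of x "x + h"] by simp
    then have "\<bar>(Q (x + h) t - Q x t) - (Q (x + h) r - Q x r)\<bar> \<le> P * \<bar>h\<bar> * \<bar>t - r\<bar>"
      using field_differentiable_bound[OF I(2) D, of "P * \<bar>h\<bar>" t r] tr by simp
    then show ?thesis using h by (simp add: divide_le_eq mult_ac flip: diff_divide_distrib)
  qed
  have lim: "((\<lambda>h. (Q (x + h) u - Q x u) / h) \<longlongrightarrow> Qx x u) (at 0)" if "u \<in> I" for u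
    using DERIV_space[of u x] that I(1) by (auto simp: DERIV_def)
  have "((\<lambda>h. \<bar>(Q (x + h) t - Q x t) / h - (Q (x + h) r - Q x r) / h\<bar>) \<longlongrightarrow> \<bar>Qx x t - Qx x r\<bar>) (at 0)"
    by (intro tendsto_intros lim tr)
  then show ?thesis
    unfolding P_def[symmetric]
    by (rule tendsto_upperbound) (auto simp: eventually_at_filter diff)
qed

end

section \<open>Roe's scheme as an upwind scheme\<close>

definition upwind_step :: "real \<Rightarrow> real \<Rightarrow> real \<Rightarrow> (int \<Rightarrow> real) \<Rightarrow> int \<Rightarrow> real" where
  "upwind_step \<alpha> \<beta> \<mu> q i = q i - \<mu> * (max (roe_speed \<alpha> \<beta> q i) 0 * (q i - q (i - 1))
     + min (roe_speed \<alpha> \<beta> q (i + 1)) 0 * (q (i + 1) - q i))"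

lemma flux_difference_eq: "flux \<alpha> \<beta> x - flux \<alpha> \<beta> y = (\<alpha> * (x + y) + \<beta>) * (x - y)"
  by (simp add: flux_def power2_eq_square algebra_simps)

text \<open>
  The Roe speed at an edge is the exact slope of the flux between the two adjacent values, so each flux
  increment is the Roe speed times the jump, and subtracting the modulus leaves its negative or
  positive part.
\<close>

lemma roe_flux_difference_upwind:
  "roe_flux_difference \<alpha> \<beta> q i = 2 * (max (roe_speed \<alpha> \<beta> q i) 0 * (q i - q (i - 1))
     + min (roe_speed \<alpha> \<beta> q (i + 1)) 0 * (q (i + 1) - q i))"
proof -
  have "flux \<alpha> \<beta> (q (i + 1)) - flux \<alpha> \<beta> (q (i - 1)) =
      roe_speed \<alpha> \<beta> q (i + 1) * (q (i + 1) - q i) + roe_speed \<alpha> \<beta> q i * (q i - q (i - 1))"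
    using flux_difference_eq[of \<alpha> \<beta> "q (i + 1)" "q i"] flux_difference_eq[of \<alpha> \<beta> "q i" "q (i - 1)"]
    by (simp add: roe_speed_def)
  then have "roe_flux_difference \<alpha> \<beta> q i =
      (roe_speed \<alpha> \<beta> q (i + 1) - \<bar>roe_speed \<alpha> \<beta> q (i + 1)\<bar>) * (q (i + 1) - q i)
      + (roe_speed \<alpha> \<beta> q i + \<bar>roe_speed \<alpha> \<beta> q i\<bar>) * (q i - q (i - 1))"
    by (simp add: roe_flux_difference_def algebra_simps)
  moreover have "x - \<bar>x\<bar> = 2 * min x 0" "x + \<bar>x\<bar> = 2 * max x 0" for x :: real by auto
  ultimately show ?thesis by (simp add: algebra_simps)
qed

lemma roe_scheme_Suc:
  "roe_scheme \<alpha> \<beta> h k Q\<^sub>0 (Suc n) = upwind_step \<alpha> \<beta> (k / h) (roe_scheme \<alpha> \<beta> h k Q\<^sub>0 n)"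
proof
  fix i
  have "k / (2 * h) * (2 * X) = k / h * X" for X by simp
  then show "roe_scheme \<alpha> \<beta> h k Q\<^sub>0 (Suc n) i = upwind_step \<alpha> \<beta> (k / h) (roe_scheme \<alpha> \<beta> h k Q\<^sub>0 n) i"
    by (simp only: roe_scheme.simps upwind_step_def roe_flux_difference_upwind)
qed

lemma periodic_mod:
  fixes q :: "int \<Rightarrow> 'a"
  assumes "\<And>i. q (i + p) = q i"
  shows "q (i mod p) = q i"
proof -
  have "q (i mod p + of_int (i div p) * p) = q (i mod p)" by (rule periodic_int_multiple[of q p, OF assms])
  then show ?thesis by simp
qed

lemma sum_period_shift:
  fixes g :: "int \<Rightarrow> 'a::ab_group_add"
  assumes per: "\<And>i. g (i + (int N + 1)) = g i"
  shows "(\<Sum>i=0..int N. g (i + 1)) = (\<Sum>i=0..int N. g i)"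
proof -
  have "(\<Sum>i=0..int N. g (i + 1)) = (\<Sum>i=1..int N + 1. g i)"
    by (rule sum.reindex_bij_witness[of _ "\<lambda>i. i - 1" "\<lambda>i. i + 1"]) auto
  also have "{1..int N + 1} = insert (int N + 1) {1..int N}" by auto
  also have "(\<Sum>i\<in>insert (int N + 1) {1..int N}. g i) = g (int N + 1) + (\<Sum>i=1..int N. g i)" by simp
  also have "g (int N + 1) = g 0" using per[of 0] by simp
  also have "g 0 + (\<Sum>i=1..int N. g i) = (\<Sum>i\<in>insert 0 {1..int N}. g i)" by simp
  also have "insert 0 {1..int N} = {0..int N}" by auto
  finally show ?thesis .
qed

lemma sum_period_shift_back:
  fixes g :: "int \<Rightarrow> 'a::ab_group_add"
  assumes per: "\<And>i. g (i + (int N + 1)) = g i"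
  shows "(\<Sum>i=0..int N. g (i - 1)) = (\<Sum>i=0..int N. g i)"
proof -
  have "g (i + (int N + 1) - 1) = g (i - 1)" for i using per[of "i - 1"] by (simp add: algebra_simps)
  from sum_period_shift[of "\<lambda>i. g (i - 1)" N, OF this] show ?thesis by simp
qed

lemma roe_speed_periodic:
  assumes "\<And>i. q (i + p) = q i"
  shows "roe_speed \<alpha> \<beta> q (i + p) = roe_speed \<alpha> \<beta> q i"
proof -
  have "q (i + p - 1) = q (i - 1)" using assms[of "i - 1"] by (simp add: algebra_simps)
  then show ?thesis by (simp add: roe_speed_def assms)
qed

lemma upwind_step_periodic:
  assumes per: "\<And>i. q (i + p) = q i"
  shows "upwind_step \<alpha> \<beta> \<mu> q (i + p) = upwind_step \<alpha> \<beta> \<mu> q i"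
proof -
  have "q (i + p + 1) = q (i + 1)" "q (i + p - 1) = q (i - 1)"
    and "roe_speed \<alpha> \<beta> q (i + p + 1) = roe_speed \<alpha> \<beta> q (i + 1)"
    using per[of "i + 1"] per[of "i - 1"] roe_speed_periodic[of q p \<alpha> \<beta> "i + 1", OF per]
    by (simp_all add: algebra_simps)
  then show ?thesis by (simp add: upwind_step_def per roe_speed_periodic[of q p, OF per])
qed

definition total_variation :: "nat \<Rightarrow> (int \<Rightarrow> real) \<Rightarrow> real" where
  "total_variation N q = (\<Sum>i=0..int N. \<bar>q i - q (i - 1)\<bar>)"

text \<open>
  Harten's argument: a new jump is a combination of three old ones. The CFL condition makes the
  coefficients nonnegative, and after summation over a period each old jump is counted with total
  weight one.
\<close>

lemma upwind_step_total_variation: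
  assumes per: "\<And>i. q (i + (int N + 1)) = q i" and \<mu>: "0 \<le> \<mu>"
    and cfl: "\<And>i. \<mu> * \<bar>roe_speed \<alpha> \<beta> q i\<bar> \<le> 1"
  shows "total_variation N (upwind_step \<alpha> \<beta> \<mu> q) \<le> total_variation N q"
proof -
  define a where "a = roe_speed \<alpha> \<beta> q"
  define d where "d i = \<bar>q i - q (i - 1)\<bar>" for i
  have per_a: "a (i + (int N + 1)) = a i" for i
    unfolding a_def by (rule roe_speed_periodic[of q, OF per])
  have per_d: "d (i + (int N + 1)) = d i" for i
    using per[of i] per[of "i - 1"] by (simp add: d_def algebra_simps)
  let ?L = "\<lambda>i. \<mu> * max (a i) 0 * d i" and ?R = "\<lambda>i. - \<mu> * min (a i) 0 * d i"
  have jump: "\<bar>upwind_step \<alpha> \<beta> \<mu> q i - upwind_step \<alpha> \<beta> \<mu> q (i - 1)\<bar>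
      \<le> (1 - \<mu> * \<bar>a i\<bar>) * d i + ?R (i + 1) + ?L (i - 1)" for i
  proof -
    have abs: "\<bar>x\<bar> = max x 0 - min x 0" for x :: real by auto
    have "upwind_step \<alpha> \<beta> \<mu> q i - upwind_step \<alpha> \<beta> \<mu> q (i - 1) =
        (1 - \<mu> * \<bar>a i\<bar>) * (q i - q (i - 1)) + (- \<mu> * min (a (i + 1)) 0) * (q (i + 1) - q i)
        + (\<mu> * max (a (i - 1)) 0) * (q (i - 1) - q (i - 1 - 1))"
      unfolding upwind_step_def a_def[symmetric] abs by (simp add: algebra_simps)
    also have "\<bar>\<dots>\<bar> \<le> \<bar>(1 - \<mu> * \<bar>a i\<bar>) * (q i - q (i - 1))\<bar>
        + \<bar>(- \<mu> * min (a (i + 1)) 0) * (q (i + 1) - q i)\<bar>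
        + \<bar>(\<mu> * max (a (i - 1)) 0) * (q (i - 1) - q (i - 1 - 1))\<bar>"
      by linarith
    also have "\<dots> = (1 - \<mu> * \<bar>a i\<bar>) * d i + ?R (i + 1) + ?L (i - 1)"
    proof -
      have "\<bar>1 - \<mu> * \<bar>a i\<bar>\<bar> = 1 - \<mu> * \<bar>a i\<bar>" using cfl[of i] by (simp add: a_def)
      moreover have "\<bar>- \<mu> * min (a (i + 1)) 0\<bar> = - \<mu> * min (a (i + 1)) 0"
        using \<mu> by (simp add: abs_mult)
      moreover have "\<bar>\<mu> * max (a (i - 1)) 0\<bar> = \<mu> * max (a (i - 1)) 0" using \<mu> by simp
      ultimately show ?thesis unfolding abs_mult[of _ "q _ - q _"] d_def by simp
    qed
    finally show ?thesis .
  qed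
  have "total_variation N (upwind_step \<alpha> \<beta> \<mu> q)
      \<le> (\<Sum>i=0..int N. (1 - \<mu> * \<bar>a i\<bar>) * d i + ?R (i + 1) + ?L (i - 1))"
    unfolding total_variation_def by (rule sum_mono) (rule jump)
  also have "\<dots> = (\<Sum>i=0..int N. (1 - \<mu> * \<bar>a i\<bar>) * d i) + (\<Sum>i=0..int N. ?R (i + 1))
      + (\<Sum>i=0..int N. ?L (i - 1))"
    by (simp only: sum.distrib)
  also have "(\<Sum>i=0..int N. ?R (i + 1)) = (\<Sum>i=0..int N. ?R i)"
    by (rule sum_period_shift) (simp only: per_a per_d)
  also have "(\<Sum>i=0..int N. ?L (i - 1)) = (\<Sum>i=0..int N. ?L i)"
    by (rule sum_period_shift_back) (simp only: per_a per_d)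
  also have "(\<Sum>i=0..int N. (1 - \<mu> * \<bar>a i\<bar>) * d i) + (\<Sum>i=0..int N. ?R i) + (\<Sum>i=0..int N. ?L i)
      = (\<Sum>i=0..int N. d i)"
    unfolding sum.distrib[symmetric]
    by (rule sum.cong) (auto simp: max_def min_def abs_if algebra_simps)
  finally show ?thesis unfolding total_variation_def d_def .
qed

text \<open>
  The flux difference is a difference of numerical fluxes \<open>G\<close> at the two edges of the cell, so the sum over a
  period telescopes.
\<close>

lemma upwind_step_sum:
  assumes per: "\<And>i. q (i + (int N + 1)) = q i"
  shows "(\<Sum>i=0..int N. upwind_step \<alpha> \<beta> \<mu> q i) = (\<Sum>i=0..int N. q i)"
proof -
  define G where "G i = flux \<alpha> \<beta> (q i) + flux \<alpha> \<beta> (q (i - 1))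
    - \<bar>roe_speed \<alpha> \<beta> q i\<bar> * (q i - q (i - 1))" for i
  have "G (i + (int N + 1)) = G i" for i
    using per[of i] per[of "i - 1"] roe_speed_periodic[of q "int N + 1" \<alpha> \<beta> i, OF per]
    by (simp add: G_def algebra_simps)
  then have shift: "(\<Sum>i=0..int N. G (i + 1)) = (\<Sum>i=0..int N. G i)" by (rule sum_period_shift)
  have "upwind_step \<alpha> \<beta> \<mu> q i = q i - \<mu> / 2 * (G (i + 1) - G i)" for i
  proof -
    have "roe_flux_difference \<alpha> \<beta> q i = G (i + 1) - G i"
      by (simp add: G_def roe_flux_difference_def)
    then show ?thesis
      using roe_flux_difference_upwind[of \<alpha> \<beta> q i] by (simp add: upwind_step_def)
  qed
  then show ?thesis
    by (simp only: sum_subtractf sum_distrib_left[symmetric] shift) simp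
qed

lemma difference_le_total_variation:
  assumes ij: "0 \<le> i" "i \<le> j" "j \<le> int N"
  shows "\<bar>q j - q i\<bar> \<le> total_variation N q"
proof -
  have "\<bar>q (i + int m) - q i\<bar> \<le> (\<Sum>l=i+1..i+int m. \<bar>q l - q (l - 1)\<bar>)" for m
  proof (induction m)
    case (Suc m)
    have "{i+1..i+int (Suc m)} = insert (i + int m + 1) {i+1..i+int m}" by auto
    then have "(\<Sum>l=i+1..i+int (Suc m). \<bar>q l - q (l - 1)\<bar>)
        = \<bar>q (i + int m + 1) - q (i + int m)\<bar> + (\<Sum>l=i+1..i+int m. \<bar>q l - q (l - 1)\<bar>)" by simp
    moreover have "i + int (Suc m) = i + int m + 1" by simp
    ultimately show ?case using Suc by (simp only:)
  qed simp
  from this[of "nat (j - i)"] have "\<bar>q j - q i\<bar> \<le> (\<Sum>l=i+1..j. \<bar>q l - q (l - 1)\<bar>)"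
    using ij by simp
  also have "\<dots> \<le> total_variation N q"
    unfolding total_variation_def using ij by (intro sum_mono2) auto
  finally show ?thesis .
qed

lemma sup_le_mean_plus_variation:
  assumes per: "\<And>i. q (i + (int N + 1)) = q i"
    and mean: "\<bar>\<Sum>i=0..int N. q i\<bar> \<le> (real N + 1) * M"
  shows "\<bar>q j\<bar> \<le> M + total_variation N q"
proof -
  define j' where "j' = j mod (int N + 1)"
  have j': "0 \<le> j'" "j' \<le> int N" "q j = q j'"
    using periodic_mod[of q "int N + 1" j, OF per] pos_mod_bound[of "int N + 1" j]
    by (auto simp: j'_def)
  have osc: "\<bar>q j' - q i\<bar> \<le> total_variation N q" if "i \<in> {0..int N}" for i
    using difference_le_total_variation[of i j' N q] difference_le_total_variation[of j' i N q] that j'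
    by (cases "i \<le> j'") (auto simp: abs_minus_commute)
  have "(real N + 1) * q j' = (\<Sum>i=0..int N. q j')" by (simp add: algebra_simps)
  also have "\<dots> = (\<Sum>i=0..int N. q i) + (\<Sum>i=0..int N. q j' - q i)" by (simp add: sum_subtractf)
  also have "\<bar>\<dots>\<bar> \<le> (real N + 1) * M + (\<Sum>i=0..int N. total_variation N q)"
    by (intro order_trans[OF abs_triangle_ineq] add_mono mean order_trans[OF sum_abs] sum_mono osc)
  also have "\<dots> = (real N + 1) * (M + total_variation N q)" by (simp add: algebra_simps)
  finally have "(real N + 1) * \<bar>q j'\<bar> \<le> (real N + 1) * (M + total_variation N q)"
    by (simp add: abs_mult)
  then have "\<bar>q j'\<bar> \<le> M + total_variation N q"
    by (rule mult_left_le_imp_le) (simp add: add_nonneg_pos)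
  then show ?thesis by (simp add: j')
qed

lemma convex_combination_bound:
  fixes a b x y z E :: real
  assumes "0 \<le> a" "0 \<le> b" "a + b \<le> 1" "\<bar>x\<bar> \<le> E" "\<bar>y\<bar> \<le> E" "\<bar>z\<bar> \<le> E"
  shows "\<bar>(1 - a - b) * x + a * y + b * z\<bar> \<le> E"
proof -
  have "\<bar>(1 - a - b) * x + a * y + b * z\<bar> \<le> (1 - a - b) * \<bar>x\<bar> + a * \<bar>y\<bar> + b * \<bar>z\<bar>"
    using assms(1-3) by (intro order_trans[OF abs_triangle_ineq] add_mono) (simp_all add: abs_mult)
  also have "\<dots> \<le> (1 - a - b) * E + a * E + b * E"
    using assms by (intro add_mono mult_left_mono) auto
  finally show ?thesis by (simp add: algebra_simps)
qed

text \<open>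
  One step of the error recursion. The numerical speeds transport the error, and the
  exact speeds differ from them by at most \<open>2 \<bar>\<alpha>\<bar> E\<close>; this difference multiplies increments of \<open>p\<close>, not
  of \<open>q\<close>, which keeps the recursion linear in \<open>E\<close>. The smallness assumption is what makes the transport
  part a convex combination at compressive sonic cells, where the CFL condition alone is not enough.
\<close>

lemma upwind_step_error:
  fixes q p p' \<tau> :: "int \<Rightarrow> real"
  assumes h: "0 < h" and k: "0 < k" and L: "0 \<le> L"
    and cfl: "\<And>i. k / h * \<bar>roe_speed \<alpha> \<beta> q i\<bar> \<le> 1"
    and err: "\<And>i. \<bar>q i - p i\<bar> \<le> E"
    and lip: "\<And>i. \<bar>p i - p (i - 1)\<bar> \<le> L * h"
    and small: "k / h * \<bar>\<alpha>\<bar> * (2 * E + 2 * L * h) \<le> 1"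
    and step: "\<And>i. p' i = upwind_step \<alpha> \<beta> (k / h) p i - k * \<tau> i" and \<tau>: "\<And>i. \<bar>\<tau> i\<bar> \<le> \<epsilon>"
  shows "\<bar>upwind_step \<alpha> \<beta> (k / h) q i - p' i\<bar> \<le> (1 + 4 * \<bar>\<alpha>\<bar> * L * k) * E + k * \<epsilon>"
proof -
  define \<mu> where "\<mu> = k / h"
  have \<mu>: "0 < \<mu>" "\<mu> * h = k" using h k by (auto simp: \<mu>_def)
  define a b where "a = roe_speed \<alpha> \<beta> q" and "b = roe_speed \<alpha> \<beta> p"
  define e where "e i = q i - p i" for i
  have E: "0 \<le> E" using err[of 0] by linarith
  have ab: "\<bar>a j - b j\<bar> \<le> 2 * \<bar>\<alpha>\<bar> * E" for j
  proof -
    have "a j - b j = \<alpha> * (e j + e (j - 1))" by (simp add: a_def b_def roe_speed_def e_def algebra_simps)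
    then have "\<bar>a j - b j\<bar> = \<bar>\<alpha>\<bar> * \<bar>e j + e (j - 1)\<bar>" by (simp add: abs_mult)
    also have "\<dots> \<le> \<bar>\<alpha>\<bar> * (E + E)"
      using err[of j] err[of "j - 1"] unfolding e_def by (intro mult_left_mono) auto
    finally show ?thesis by simp
  qed
  have lipab: "\<bar>max x 0 - max y 0\<bar> \<le> \<bar>x - y\<bar>" "\<bar>min x 0 - min y 0\<bar> \<le> \<bar>x - y\<bar>" for x y :: real by auto
  have coeff: "\<mu> * max (a i) 0 + \<mu> * - min (a (i + 1)) 0 \<le> 1"
  \<comment> \<open>both speeds enter only at a compressive sonic cell; elsewhere the CFL condition suffices\<close>
  proof (cases "0 < a i \<and> a (i + 1) < 0")
    case True
    then have "\<mu> * max (a i) 0 + \<mu> * - min (a (i + 1)) 0 = \<mu> * (a i - a (i + 1))"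
      by (simp add: algebra_simps)
    also have "a i - a (i + 1) = \<alpha> * (q (i - 1) - q (i + 1))"
      by (simp add: a_def roe_speed_def algebra_simps)
    also have "\<dots> \<le> \<bar>\<alpha>\<bar> * \<bar>q (i - 1) - q (i + 1)\<bar>" by (metis abs_ge_self abs_mult)
    also have "\<bar>q (i - 1) - q (i + 1)\<bar> \<le> 2 * E + 2 * L * h"
      using err[of "i - 1"] err[of "i + 1"] lip[of i] lip[of "i + 1"] by (simp add: abs_le_iff)
    finally have "\<mu> * max (a i) 0 + \<mu> * - min (a (i + 1)) 0 \<le> \<mu> * (\<bar>\<alpha>\<bar> * (2 * E + 2 * L * h))"
      using \<mu> by (simp add: mult_left_mono)
    also have "\<dots> \<le> 1" using small by (simp add: \<mu>_def mult.assoc)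
    finally show ?thesis .
  next
    case False
    moreover have "\<mu> * \<bar>a j\<bar> \<le> 1" for j using cfl[of j] by (simp add: \<mu>_def a_def)
    note this[of i] this[of "i + 1"]
    ultimately show ?thesis by (auto simp: max_def min_def abs_if split: if_splits)
  qed
  have "upwind_step \<alpha> \<beta> \<mu> q i - p' i =
      ((1 - \<mu> * max (a i) 0 - \<mu> * - min (a (i + 1)) 0) * e i + \<mu> * max (a i) 0 * e (i - 1)
        + \<mu> * - min (a (i + 1)) 0 * e (i + 1))
      - \<mu> * ((max (a i) 0 - max (b i) 0) * (p i - p (i - 1))
           + (min (a (i + 1)) 0 - min (b (i + 1)) 0) * (p (i + 1) - p i)) + k * \<tau> i"
    unfolding step \<mu>_def[symmetric] upwind_step_def a_def[symmetric] b_def[symmetric] e_def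
    by (simp add: algebra_simps)
  also have "\<bar>\<dots>\<bar> \<le> E + \<mu> * (2 * \<bar>\<alpha>\<bar> * E * (L * h) + 2 * \<bar>\<alpha>\<bar> * E * (L * h)) + k * \<epsilon>"
  proof -
    have 1: "\<bar>(1 - \<mu> * max (a i) 0 - \<mu> * - min (a (i + 1)) 0) * e i + \<mu> * max (a i) 0 * e (i - 1)
        + \<mu> * - min (a (i + 1)) 0 * e (i + 1)\<bar> \<le> E"
      using \<mu>(1) coeff err by (intro convex_combination_bound) (auto simp: e_def mult_nonneg_nonpos)
    have lip': "\<bar>p (i + 1) - p i\<bar> \<le> L * h" using lip[of "i + 1"] by simp
    have 2: "\<bar>(max (a i) 0 - max (b i) 0) * (p i - p (i - 1))
           + (min (a (i + 1)) 0 - min (b (i + 1)) 0) * (p (i + 1) - p i)\<bar>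
        \<le> 2 * \<bar>\<alpha>\<bar> * E * (L * h) + 2 * \<bar>\<alpha>\<bar> * E * (L * h)"
      by (intro order_trans[OF abs_triangle_ineq] add_mono; simp only: abs_mult)
         (intro mult_mono order_trans[OF lipab(1) ab] order_trans[OF lipab(2) ab] lip lip'; simp add: E)+
    have 3: "\<bar>k * \<tau> i\<bar> \<le> k * \<epsilon>" using \<tau>[of i] k by (simp add: abs_mult)
    have 4: "\<bar>\<mu> * ((max (a i) 0 - max (b i) 0) * (p i - p (i - 1))
           + (min (a (i + 1)) 0 - min (b (i + 1)) 0) * (p (i + 1) - p i))\<bar>
        \<le> \<mu> * (2 * \<bar>\<alpha>\<bar> * E * (L * h) + 2 * \<bar>\<alpha>\<bar> * E * (L * h))"
      unfolding abs_mult[of \<mu>] using \<mu>(1) 2 by (simp add: mult_left_mono)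
    have "\<bar>x - y + z\<bar> \<le> E + y' + z'" if "\<bar>x\<bar> \<le> E" "\<bar>y\<bar> \<le> y'" "\<bar>z\<bar> \<le> z'" for x y z y' z' :: real
      using that by linarith
    from this[OF 1 4 3] show ?thesis .
  qed
  also have "\<dots> = (1 + 4 * \<bar>\<alpha>\<bar> * L * k) * E + k * \<epsilon>"
    unfolding \<mu>(2)[symmetric] by (simp add: algebra_simps)
  finally show ?thesis by (simp add: \<mu>_def)
qed

text \<open>
  Discrete Gronwall. The smallness assumption is stated for the final bound, which dominates the error at
  all steps up to \<open>m\<close>, so the one-step estimate can be applied throughout.
\<close>

lemma upwind_error_growth:
  fixes Q p \<tau> :: "nat \<Rightarrow> int \<Rightarrow> real"
  assumes h: "0 < h" and k: "0 < k" and L: "0 \<le> L" and \<epsilon>: "0 \<le> \<epsilon>" and E: "0 \<le> E"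
    and m: "real m * k \<le> b"
    and scheme: "\<And>n. Q (Suc n) = upwind_step \<alpha> \<beta> (k / h) (Q n)"
    and cfl: "\<And>n i. n < m \<Longrightarrow> k / h * \<bar>roe_speed \<alpha> \<beta> (Q n) i\<bar> \<le> 1"
    and init: "\<And>i. \<bar>Q 0 i - p 0 i\<bar> \<le> E"
    and lip: "\<And>n i. n < m \<Longrightarrow> \<bar>p n i - p n (i - 1)\<bar> \<le> L * h"
    and small: "k / h * \<bar>\<alpha>\<bar> * (2 * (exp (4 * \<bar>\<alpha>\<bar> * L * b) * (E + b * \<epsilon>)) + 2 * L * h) \<le> 1"
    and step: "\<And>n i. n < m \<Longrightarrow> p (Suc n) i = upwind_step \<alpha> \<beta> (k / h) (p n) i - k * \<tau> n i"
    and \<tau>: "\<And>n i. n < m \<Longrightarrow> \<bar>\<tau> n i\<bar> \<le> \<epsilon>"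
  shows "n \<le> m \<Longrightarrow> \<bar>Q n i - p n i\<bar> \<le> exp (4 * \<bar>\<alpha>\<bar> * L * b) * (E + b * \<epsilon>)"
proof -
  define c where "c = 4 * \<bar>\<alpha>\<bar> * L"
  have c: "0 \<le> c" using L by (simp add: c_def)
  define D where "D n = exp (c * (real n * k)) * (E + real n * k * \<epsilon>)" for n
  have D_le: "D n \<le> exp (4 * \<bar>\<alpha>\<bar> * L * b) * (E + b * \<epsilon>)" if "n \<le> m" for n
  proof -
    have "real n * k \<le> b" using that m k by (meson mult_right_mono of_nat_le_iff order_trans less_imp_le)
    then show ?thesis
      unfolding D_def c_def[symmetric] using c \<epsilon> E k
      by (intro mult_mono add_mono mult_right_mono) (auto simp: mult_left_mono intro: add_nonneg_nonneg)
  qed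
  have "\<bar>Q n i - p n i\<bar> \<le> D n" if "n \<le> m" for n i
    using that
  proof (induction n arbitrary: i)
    case 0
    then show ?case using init by (simp add: D_def)
  next
    case (Suc n)
    then have n: "n < m" by simp
    have "k / h * \<bar>\<alpha>\<bar> * (2 * D n + 2 * L * h)
        \<le> k / h * \<bar>\<alpha>\<bar> * (2 * (exp (4 * \<bar>\<alpha>\<bar> * L * b) * (E + b * \<epsilon>)) + 2 * L * h)"
      using D_le[of n] n h k by (intro mult_left_mono) auto
    then have small': "k / h * \<bar>\<alpha>\<bar> * (2 * D n + 2 * L * h) \<le> 1" using small by linarith
    have "\<bar>Q (Suc n) i - p (Suc n) i\<bar> \<le> (1 + 4 * \<bar>\<alpha>\<bar> * L * k) * D n + k * \<epsilon>"
      unfolding scheme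
      by (rule upwind_step_error[OF h k L cfl[OF n] _ lip[OF n] small' step[OF n] \<tau>[OF n]])
         (use Suc in auto)
    also have "(1 + 4 * \<bar>\<alpha>\<bar> * L * k) * D n \<le> exp (c * k) * D n"
      using exp_ge_add_one_self[of "c * k"] E \<epsilon> k by (intro mult_right_mono) (auto simp: c_def D_def)
    also have "exp (c * k) * D n = exp (c * (real (Suc n) * k)) * (E + real n * k * \<epsilon>)"
      by (simp add: D_def algebra_simps flip: exp_add)
    also have "k * \<epsilon> \<le> exp (c * (real (Suc n) * k)) * (k * \<epsilon>)"
      using mult_right_mono[of 1 "exp (c * (real (Suc n) * k))" "k * \<epsilon>"] c k \<epsilon> by simp
    finally show ?case by (simp add: D_def algebra_simps)
  qed
  then show "n \<le> m \<Longrightarrow> \<bar>Q n i - p n i\<bar> \<le> exp (4 * \<bar>\<alpha>\<bar> * L * b) * (E + b * \<epsilon>)"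
    using D_le order_trans by blast
qed

section \<open>Consistency and a priori bounds\<close>

lemma mesh_width_pos [simp]: "0 < mesh_width N"
  by (simp add: mesh_width_def add_nonneg_pos)

lemma mesh_width_mult: "(real N + 1) * mesh_width N = 2 * pi"
  using add_nonneg_pos[of "real N" 1] by (simp add: mesh_width_def)

lemma cell_average_integral:
  assumes "continuous_on UNIV q"
  shows "cell_average h q i = integral {(of_int i - 1/2) * h..(of_int i + 1/2) * h} q / h"
  by (simp add: cell_average_def set_integral_half_open[OF assms])

lemma cell_average_near_midpoint:
  assumes lip: "\<And>x y. \<bar>q x - q y\<bar> \<le> L * \<bar>x - y\<bar>" and cont: "continuous_on UNIV q"
    and h: "0 < h" and L: "0 \<le> L"
  shows "\<bar>cell_average h q i - q (of_int i * h)\<bar> \<le> L * h"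
proof -
  define a b where "a = (of_int i - 1/2) * h" and "b = (of_int i + 1/2) * h"
  have ab: "a \<le> b" "b - a = h" using h by (simp_all add: a_def b_def algebra_simps)
  let ?c = "q (of_int i * h)"
  have int: "q integrable_on {a..b}"
    by (rule integrable_continuous_interval) (rule continuous_on_subset[OF cont], simp)
  have "\<bar>q x - ?c\<bar> \<le> L * h" if "x \<in> {a..b}" for x
  proof -
    have "\<bar>x - of_int i * h\<bar> \<le> h" using that h by (auto simp: a_def b_def algebra_simps abs_le_iff)
    then show ?thesis using lip[of x "of_int i * h"] L by (meson mult_left_mono order_trans)
  qed
  then have "norm (integral {a..b} (\<lambda>x. q x - ?c)) \<le> (L * h) * (b - a)"
    using ab(1) by (intro integral_bound) (auto intro!: continuous_intros continuous_on_subset[OF cont])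
  also have "integral {a..b} (\<lambda>x. q x - ?c) = integral {a..b} q - h * ?c"
    using integral_unique[OF has_integral_diff[OF integrable_integral[OF int] has_integral_const_real[of ?c a b]]] ab
    by simp
  finally have "\<bar>integral {a..b} q - h * ?c\<bar> \<le> (L * h) * h" by (simp add: ab(2))
  then have "\<bar>integral {a..b} q - h * ?c\<bar> / h \<le> L * h" using h by (simp add: pos_divide_le_eq)
  moreover have "cell_average h q i - ?c = (integral {a..b} q - h * ?c) / h"
    using h by (simp add: cell_average_integral[OF cont] a_def b_def field_simps)
  ultimately show ?thesis using h by simp
qed

lemma cell_average_periodic:
  assumes per: "\<And>x. q (x + 2 * pi) = q x" and cont: "continuous_on UNIV q"
  shows "cell_average (mesh_width N) q (i + (int N + 1)) = cell_average (mesh_width N) q i"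
proof -
  let ?h = "mesh_width N"
  define a b where "a = (of_int i - 1/2) * ?h" and "b = (of_int i + 1/2) * ?h"
  have "(of_int (i + (int N + 1)) - 1/2) * ?h = a + (real N + 1) * ?h"
    "(of_int (i + (int N + 1)) + 1/2) * ?h = b + (real N + 1) * ?h"
    by (simp_all add: a_def b_def algebra_simps)
  then have ends: "(of_int (i + (int N + 1)) - 1/2) * ?h = a + 2 * pi"
    "(of_int (i + (int N + 1)) + 1/2) * ?h = b + 2 * pi"
    unfolding mesh_width_mult by simp_all
  have "integral {a + 2 * pi..b + 2 * pi} q = integral {a..b} q"
    using integral_shift_real_ivl[of "a + 2 * pi" "2 * pi" "b + 2 * pi" q] by (simp add: per)
  then show ?thesis
    unfolding cell_average_integral[OF cont] ends by (simp add: a_def b_def)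
qed

lemma eventually_small_multiple:
  assumes "0 < (c::real)"
  shows "\<forall>\<^sub>F h in at_right 0. C * h < c"
proof -
  have "((\<lambda>h. C * h) \<longlongrightarrow> C * 0) (at_right 0)" by (intro tendsto_intros)
  then show ?thesis using assms by (intro order_tendstoD(2)) auto
qed

context smooth_solution
begin

abbreviation num :: "nat \<Rightarrow> real \<Rightarrow> nat \<Rightarrow> int \<Rightarrow> real" where
  "num N k \<equiv> roe_scheme \<alpha> \<beta> (mesh_width N) k Q\<^sub>0"

lemma zero_in_times: "0 \<in> {0..<T}"
  using T_pos by simp

text \<open>
  The scheme sees the initial datum only through its averages, hence its values on null sets are irrelevant and
  the differentiable representative may be used instead.
\<close>

lemma initial_cell_average: "cell_average h Q\<^sub>0 i = cell_average h (\<lambda>x. Q x 0) i"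
proof -
  have "AE x in lborel. Q x 0 = Q\<^sub>0 x"
    using solution by (simp add: conservation_law_solution_def)
  then have "(LINT x:{(of_int i - 1/2) * h..<(of_int i + 1/2) * h}|lborel. Q\<^sub>0 x) =
      (LINT x:{(of_int i - 1/2) * h..<(of_int i + 1/2) * h}|lborel. Q x 0)"
    using Q\<^sub>0_measurable sobolevD(1)[OF slice_sobolev[OF zero_in_times]]
    by (intro set_lebesgue_integral_cong_AE) auto
  then show ?thesis by (simp add: cell_average_def)
qed

lemma num_periodic: "num N k n (i + (int N + 1)) = num N k n i"
proof (induction n arbitrary: i)
  case 0
  show ?case
    using cell_average_periodic[OF Q_periodic[OF zero_in_times] continuous_slice[OF zero_in_times], of N i]
    by (simp add: initial_cell_average)
next
  case (Suc n)
  then show ?case unfolding roe_scheme_Suc by (rule upwind_step_periodic)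
qed

lemma num_initial_error:
  assumes "\<And>x. \<bar>Qx x 0\<bar> \<le> L"
  shows "\<bar>num N k 0 i - Q (of_int i * mesh_width N) 0\<bar> \<le> L * mesh_width N"
  using cell_average_near_midpoint[OF space_lipschitz[OF zero_in_times assms]
      continuous_slice[OF zero_in_times] mesh_width_pos] order_trans[OF abs_ge_zero assms]
  by (simp add: initial_cell_average)

lemma cfl_everywhere:
  assumes cfl: "cfl_condition \<alpha> \<beta> T N k Q\<^sub>0" and k: "0 < k" and n: "real n * k < T"
  shows "k / mesh_width N * \<bar>roe_speed \<alpha> \<beta> (num N k n) i\<bar> \<le> 1"
proof -
  let ?a = "\<lambda>i. \<bar>roe_speed \<alpha> \<beta> (num N k n) i\<bar>"
  define i' where "i' = i mod (int N + 1)"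
  have i': "i' \<in> {0..int N}" using pos_mod_bound[of "int N + 1" i] by (auto simp: i'_def)
  have "roe_speed \<alpha> \<beta> (num N k n) i' = roe_speed \<alpha> \<beta> (num N k n) i"
    unfolding i'_def
    by (rule periodic_mod) (rule roe_speed_periodic[of "num N k n", OF num_periodic])
  then have "?a i = ?a i'" by simp
  also have "?a i' \<le> Max (?a ` {0..int N})" using i' by (intro Max_ge) auto
  finally have "k / mesh_width N * ?a i \<le> k / mesh_width N * Max (?a ` {0..int N})"
    using k by (intro mult_left_mono) (auto intro: less_imp_le)
  also have "\<dots> \<le> 1" using cfl n by (auto simp: cfl_condition_def)
  finally show ?thesis .
qed

text \<open>
  Total variation and mean of the discrete solution are controlled by those at time 0, and together they bound the
  maximum norm. Unlike the error estimate this holds up to \<open>T\<close>, where \<open>Q\<close> may lose its regularity.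
\<close>

lemma num_bounded:
  obtains M where "\<And>N k n i. \<lbrakk>0 < k; cfl_condition \<alpha> \<beta> T N k Q\<^sub>0; real n * k < T\<rbrakk> \<Longrightarrow> \<bar>num N k n i\<bar> \<le> M"
    and "\<And>x t. t \<in> {0..<T} \<Longrightarrow> \<bar>Q x t\<bar> \<le> M"
proof -
  define L where "L = 3 * sobolev_norm s (\<lambda>x. Q x 0)"
  have Q0: "\<bar>Q x 0\<bar> \<le> L" "\<bar>Qx x 0\<bar> \<le> L" for x
    using slice_bounds(1,2)[OF zero_in_times order_refl] by (auto simp: L_def)
  have L: "0 \<le> L" using Q0(1)[of 0] by linarith
  define M where "M = (L + 2 * pi * L) + 6 * pi * L"
  have "\<bar>num N k n i\<bar> \<le> M"
    if k: "0 < k" and cfl: "cfl_condition \<alpha> \<beta> T N k Q\<^sub>0" and n: "real n * k < T" for N k n i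
  proof -
    let ?h = "mesh_width N" and ?q = "num N k"
    have h: "0 < ?h" "?h \<le> 2 * pi" by (simp_all add: mesh_width_def divide_le_eq)
    note init = num_initial_error[OF Q0(2), of N k]
    have "\<bar>?q 0 i - ?q 0 (i - 1)\<bar> \<le> 3 * L * ?h" for i
    proof -
      have "\<bar>Q (of_int i * ?h) 0 - Q (of_int (i - 1) * ?h) 0\<bar> \<le> L * ?h"
        using space_lipschitz[OF zero_in_times Q0(2), of "of_int i * ?h" "of_int (i - 1) * ?h"]
        by (simp add: algebra_simps abs_of_pos)
      then show ?thesis using init[of i] init[of "i - 1"] by linarith
    qed
    then have "total_variation N (?q 0) \<le> (\<Sum>i=0..int N. 3 * L * ?h)"
      unfolding total_variation_def by (rule sum_mono)
    also have "\<dots> = 3 * L * ((real N + 1) * ?h)" by (simp add: algebra_simps)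
    also have "\<dots> = 6 * pi * L" unfolding mesh_width_mult by simp
    finally have tv0: "total_variation N (?q 0) \<le> 6 * pi * L" .
    have abs0: "\<bar>?q 0 i\<bar> \<le> L + 2 * pi * L" for i
    proof -
      have "L * ?h \<le> 2 * pi * L" using mult_left_mono[OF h(2) L] by (simp only: mult.commute)
      then show ?thesis using init[of i] Q0(1)[of "of_int i * ?h"] by linarith
    qed
    have "total_variation N (?q n) \<le> 6 * pi * L \<and> (\<Sum>i=0..int N. ?q n i) = (\<Sum>i=0..int N. ?q 0 i)"
      using n
    proof (induction n)
      case 0
      show ?case using tv0 by blast
    next
      case (Suc n)
      have nk: "real n * k < T" using Suc.prems k by (simp add: algebra_simps)
      have "total_variation N (?q (Suc n)) \<le> total_variation N (?q n)"
        unfolding roe_scheme_Suc using k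
        by (intro upwind_step_total_variation num_periodic cfl_everywhere cfl nk) (simp add: less_imp_le)
      moreover have "(\<Sum>i=0..int N. ?q (Suc n) i) = (\<Sum>i=0..int N. ?q n i)"
        unfolding roe_scheme_Suc by (rule upwind_step_sum[of "?q n", OF num_periodic])
      ultimately show ?case using Suc.IH[OF nk] by linarith
    qed
    then have tv: "total_variation N (?q n) \<le> 6 * pi * L"
      and sum: "(\<Sum>i=0..int N. ?q n i) = (\<Sum>i=0..int N. ?q 0 i)" by auto
    have "\<bar>\<Sum>i=0..int N. ?q 0 i\<bar> \<le> (\<Sum>i=0..int N. L + 2 * pi * L)"
      by (intro order_trans[OF sum_abs] sum_mono abs0)
    also have "\<dots> = (real N + 1) * (L + 2 * pi * L)" by simp
    finally have "\<bar>\<Sum>i=0..int N. ?q n i\<bar> \<le> (real N + 1) * (L + 2 * pi * L)" unfolding sum .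
    from sup_le_mean_plus_variation[of "?q n", OF num_periodic this, of i] tv
    show ?thesis unfolding M_def by linarith
  qed
  moreover have "\<bar>Q x t\<bar> \<le> M" if "t \<in> {0..<T}" for x t
  proof -
    have "0 \<le> 2 * pi * L" "0 \<le> 6 * pi * L" using L by auto
    then show ?thesis using maximum_principle[OF Q0(1) that, of x] unfolding M_def by linarith
  qed
  ultimately show thesis by (rule that)
qed

text \<open>
  The mean value theorem expresses the time difference by the equation at an intermediate time and
  the space differences by slopes at intermediate points. What is left are variations of the slope, \<open>\<omega>x\<close> and
  \<open>\<omega>t\<close>, and of the speed. Positive and negative part are Lipschitz, so a change of sign of the
  speed between neighbouring edges costs nothing extra.
\<close>

lemma truncation_error_bound:
  assumes h: "0 < h" and k: "0 < k" and I: "I \<subseteq> {0..<T}" "convex I"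
    and L: "\<And>x t. t \<in> I \<Longrightarrow> \<bar>Qx x t\<bar> \<le> L" and V: "\<And>x t. t \<in> I \<Longrightarrow> \<bar>speed x t\<bar> \<le> V"
    and \<omega>x: "\<And>x y t. \<lbrakk>t \<in> I; \<bar>x - y\<bar> \<le> h\<rbrakk> \<Longrightarrow> \<bar>Qx x t - Qx y t\<bar> \<le> \<omega>x"
    and \<omega>t: "\<And>x t r. \<lbrakk>t \<in> I; r \<in> I; \<bar>t - r\<bar> \<le> k\<rbrakk> \<Longrightarrow> \<bar>Qx x t - Qx x r\<bar> \<le> \<omega>t"
    and n: "real n * k \<in> I" "real (Suc n) * k \<in> I"
  shows "\<bar>truncation_error \<alpha> \<beta> h k Q i n\<bar> \<le> 2 * \<bar>\<alpha>\<bar> * L\<^sup>2 * (h + V * k) + V * (\<omega>x + \<omega>t)"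
proof -
  define t where "t = real n * k"
  define x where "x = of_int i * h"
  define p where "p j = Q (of_int j * h) t" for j
  have t: "t \<in> I" "t + k \<in> I" using n by (simp_all add: t_def algebra_simps)
  have tT: "t \<in> {0..<T}" using t I by auto
  have tI: "{t..t + k} \<subseteq> I" using closed_segment_subset[OF t I(2)] k by (simp add: closed_segment_eq_real_ivl)
  have L0: "0 \<le> L" and V0: "0 \<le> V" using order_trans[OF abs_ge_zero L[OF t(1)]] order_trans[OF abs_ge_zero V[OF t(1)]] by auto
  obtain r where r: "r \<in> {t<..<t + k}" "Q x (t + k) - Q x t = - speed x r * Qx x r * (t + k - t)"
  proof -
    have "((\<lambda>u. Q x u) has_derivative (*) (- speed x u * Qx x u)) (at u within {t..t + k})"
      if "t \<le> u" "u \<le> t + k" for u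
    proof -
      have sub: "{t..t + k} \<subseteq> {0..<T}" using tI I(1) by blast
      have "u \<in> {0..<T}" using subsetD[OF sub, of u] that by simp
      from DERIV_subset[OF DERIV_time[OF this] sub] show ?thesis
        unfolding has_field_derivative_def .
    qed
    from mvt_simple[OF _ this] k that show thesis by auto
  qed
  have rI: "r \<in> I" using r(1) tI by auto
  have slope: "\<exists>z. \<bar>z - x\<bar> \<le> h \<and> Q y t - Q y' t = h * Qx z t" if "y = x \<and> y' = x - h \<or> y = x + h \<and> y' = x" for y y'
  proof -
    have "y' < y" using that h by auto
    from MVT2[OF this DERIV_space[OF tT]] obtain z where "y' < z" "z < y" "Q y t - Q y' t = (y - y') * Qx z t"
      by blast
    then show ?thesis using that by (intro exI[of _ z]) auto
  qed
  obtain z1 where z1: "\<bar>z1 - x\<bar> \<le> h" "p i - p (i - 1) = h * Qx z1 t"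
    using slope[of x "x - h"] by (auto simp: p_def x_def algebra_simps)
  obtain z2 where z2: "\<bar>z2 - x\<bar> \<le> h" "p (i + 1) - p i = h * Qx z2 t"
    using slope[of "x + h" x] by (auto simp: p_def x_def algebra_simps)
  define v where "v = speed x t"
  define b1 b2 where "b1 = roe_speed \<alpha> \<beta> p i" and "b2 = roe_speed \<alpha> \<beta> p (i + 1)"
  have b1: "\<bar>b1 - v\<bar> \<le> \<bar>\<alpha>\<bar> * (h * L)"
  proof -
    have "b1 - v = - \<alpha> * (p i - p (i - 1))"
      by (simp add: b1_def v_def roe_speed_def speed_def p_def x_def algebra_simps)
    then show ?thesis unfolding z1(2) using L[OF t(1), of z1] h by (simp add: abs_mult mult_left_mono)
  qed
  have b2: "\<bar>b2 - v\<bar> \<le> \<bar>\<alpha>\<bar> * (h * L)"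
  proof -
    have "b2 - v = \<alpha> * (p (i + 1) - p i)"
      by (simp add: b2_def v_def roe_speed_def speed_def p_def x_def algebra_simps)
    then show ?thesis unfolding z2(2) using L[OF t(1), of z2] h by (simp add: abs_mult mult_left_mono)
  qed
  have lipmax: "\<bar>max a 0 - max b 0\<bar> \<le> \<bar>a - b\<bar>" "\<bar>min a 0 - min b 0\<bar> \<le> \<bar>a - b\<bar>" for a b :: real by auto
  have space: "\<bar>(max b1 0 * Qx z1 t + min b2 0 * Qx z2 t) - v * Qx x t\<bar>
      \<le> 2 * (\<bar>\<alpha>\<bar> * (h * L) * L) + V * \<omega>x"
  proof -
    have vsplit: "v = max v 0 + min v 0" "\<bar>v\<bar> = max v 0 + - min v 0" by auto
    have "(max b1 0 * Qx z1 t + min b2 0 * Qx z2 t) - v * Qx x t =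
        (max b1 0 - max v 0) * Qx z1 t + (min b2 0 - min v 0) * Qx z2 t
        + (max v 0 * (Qx z1 t - Qx x t) + min v 0 * (Qx z2 t - Qx x t))"
      by (subst vsplit(1)) (simp add: algebra_simps)
    also have "\<bar>\<dots>\<bar> \<le> \<bar>\<alpha>\<bar> * (h * L) * L + \<bar>\<alpha>\<bar> * (h * L) * L + \<bar>v\<bar> * \<omega>x"
    proof -
      have 1: "\<bar>(max b1 0 - max v 0) * Qx z1 t\<bar> \<le> \<bar>\<alpha>\<bar> * (h * L) * L"
        unfolding abs_mult using L0 h
        by (intro mult_mono order_trans[OF lipmax(1) b1] L[OF t(1)]) auto
      have 2: "\<bar>(min b2 0 - min v 0) * Qx z2 t\<bar> \<le> \<bar>\<alpha>\<bar> * (h * L) * L"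
        unfolding abs_mult using L0 h
        by (intro mult_mono order_trans[OF lipmax(2) b2] L[OF t(1)]) auto
      have 3: "\<bar>max v 0 * (Qx z1 t - Qx x t)\<bar> \<le> max v 0 * \<omega>x"
        using \<omega>x[OF t(1) z1(1)] by (simp add: abs_mult mult_left_mono)
      have 4: "\<bar>min v 0 * (Qx z2 t - Qx x t)\<bar> \<le> - min v 0 * \<omega>x"
      proof -
        have "\<bar>min v 0\<bar> = - min v 0" by simp
        then show ?thesis unfolding abs_mult using \<omega>x[OF t(1) z2(1)] by (simp only:) (rule mult_left_mono, auto)
      qed
      have "\<bar>v\<bar> * \<omega>x = max v 0 * \<omega>x + - min v 0 * \<omega>x"
        by (subst vsplit(2)) (simp only: distrib_right)
      moreover have "\<bar>A + B + (C + D)\<bar> \<le> a + b + (c + d)" if "\<bar>A\<bar> \<le> a" "\<bar>B\<bar> \<le> b" "\<bar>C\<bar> \<le> c" "\<bar>D\<bar> \<le> d"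
        for A B C D a b c d :: real using that by linarith
      note this[OF 1 2 3 4]
      ultimately show ?thesis by simp
    qed
    also have "\<bar>v\<bar> * \<omega>x \<le> V * \<omega>x"
      using V[OF t(1), of x] order_trans[OF abs_ge_zero \<omega>x[OF t(1) z1(1)]]
      unfolding v_def by (intro mult_right_mono)
    finally show ?thesis by (simp only: mult_2)
  qed
  have time: "\<bar>speed x r * Qx x r - v * Qx x t\<bar> \<le> V * \<omega>t + 2 * \<bar>\<alpha>\<bar> * (V * L * k) * L"
  proof -
    have rt: "\<bar>r - t\<bar> \<le> k" using r(1) by auto
    have "\<bar>Q x r - Q x t\<bar> \<le> V * L * \<bar>r - t\<bar>" by (rule time_lipschitz[OF I L V rI t(1)])
    also have "\<dots> \<le> V * L * k" using rt L0 V0 by (intro mult_left_mono) auto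
    finally have s: "\<bar>speed x r - v\<bar> \<le> 2 * \<bar>\<alpha>\<bar> * (V * L * k)"
      unfolding speed_def v_def by (simp add: abs_mult mult_left_mono flip: right_diff_distrib)
    have "speed x r * Qx x r - v * Qx x t = speed x r * (Qx x r - Qx x t) + (speed x r - v) * Qx x t"
      by (simp add: algebra_simps)
    also have "\<bar>\<dots>\<bar> \<le> V * \<omega>t + 2 * \<bar>\<alpha>\<bar> * (V * L * k) * L"
      by (intro order_trans[OF abs_triangle_ineq] add_mono; simp only: abs_mult)
         (intro mult_mono V[OF rI] \<omega>t[OF rI t(1) rt] s L[OF t(1)]; simp add: V0 L0 k less_imp_le)+
    finally show ?thesis .
  qed
  have "truncation_error \<alpha> \<beta> h k Q i n =
      speed x r * Qx x r - (max b1 0 * Qx z1 t + min b2 0 * Qx z2 t)"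
  proof -
    have "(Q x t - Q x (t + k)) / k = speed x r * Qx x r"
      using r(2) k by (simp add: field_simps)
    moreover have "roe_flux_difference \<alpha> \<beta> p i / (2 * h) = max b1 0 * Qx z1 t + min b2 0 * Qx z2 t"
      unfolding roe_flux_difference_upwind z1(2) z2(2) b1_def[symmetric] b2_def[symmetric]
      using h by (simp add: field_simps)
    moreover have "real (Suc n) * k = t + k" by (simp add: t_def algebra_simps)
    ultimately show ?thesis
      unfolding truncation_error_def p_def[abs_def] by (simp add: t_def x_def)
  qed
  then have "\<bar>truncation_error \<alpha> \<beta> h k Q i n\<bar> \<le>
      (V * \<omega>t + 2 * \<bar>\<alpha>\<bar> * (V * L * k) * L) + (2 * (\<bar>\<alpha>\<bar> * (h * L) * L) + V * \<omega>x)"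
    using space time by linarith
  also have "\<dots> = 2 * \<bar>\<alpha>\<bar> * L\<^sup>2 * (h + V * k) + V * (\<omega>x + \<omega>t)"
    by (simp add: algebra_simps power2_eq_square)
  finally show ?thesis .
qed

lemma speed_bound:
  assumes "\<bar>Q x t\<bar> \<le> M"
  shows "\<bar>speed x t\<bar> \<le> 2 * \<bar>\<alpha>\<bar> * M + \<bar>\<beta>\<bar>"
proof -
  have "\<bar>2 * \<alpha> * Q x t\<bar> \<le> 2 * \<bar>\<alpha>\<bar> * M" using assms by (simp add: abs_mult mult_left_mono)
  then show ?thesis unfolding speed_def by linarith
qed

text \<open>
  A bound of the Sobolev norm of order at least 3 makes the slope Lipschitz in space, hence in time, so both
  moduli of continuity in the truncation error are linear.
\<close>

lemma first_order_accurate_of_bounded_norm: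
  assumes s: "3 \<le> s" and b: "b \<le> T" and M: "\<And>t. t \<in> {0..<b} \<Longrightarrow> sobolev_norm s (\<lambda>x. Q x t) \<le> M"
  shows "first_order_accurate \<alpha> \<beta> b Q"
proof -
  define L where "L = 3 * M"
  define V where "V = 2 * \<bar>\<alpha>\<bar> * L + \<bar>\<beta>\<bar>"
  define P where "P = V * L + 2 * \<bar>\<alpha>\<bar> * L * L"
  define C where "C = 2 * \<bar>\<alpha>\<bar> * L\<^sup>2 * (1 + V) + V * (L + P)"
  have sub: "{0..<b} \<subseteq> {0..<T}" using b by auto
  have L: "\<bar>Qx x t\<bar> \<le> L" and V: "\<bar>speed x t\<bar> \<le> V" and K: "\<bar>Qx x t - Qx y t\<bar> \<le> L * \<bar>x - y\<bar>"
    if t: "t \<in> {0..<b}" for x y t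
  proof -
    have tT: "t \<in> {0..<T}" using t sub by auto
    note bounds = slice_bounds[OF tT M[OF t], folded L_def]
    show "\<bar>Qx x t\<bar> \<le> L" by (rule bounds(2))
    show "\<bar>speed x t\<bar> \<le> V" unfolding V_def by (rule speed_bound[OF bounds(1)])
    show "\<bar>Qx x t - Qx y t\<bar> \<le> L * \<bar>x - y\<bar>" by (rule bounds(3)[OF s])
  qed
  have "\<bar>truncation_error \<alpha> \<beta> (mesh_width N) k Q i n\<bar> \<le> C * (mesh_width N + k)"
    if k: "0 < k" and n: "real (Suc n) * k < b" for N k i n
  proof -
    let ?h = "mesh_width N"
    have h: "0 < ?h" by simp
    have mem: "real n * k \<in> {0..<b}" "real (Suc n) * k \<in> {0..<b}"
      using k n by (auto simp: algebra_simps intro: add_nonneg_nonneg)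
    have L0: "0 \<le> L" and V0: "0 \<le> V"
      using order_trans[OF abs_ge_zero L[OF mem(1)]] order_trans[OF abs_ge_zero V[OF mem(1)]] by auto
    have P0: "0 \<le> P" unfolding P_def using L0 V0 by simp
    have \<omega>x: "\<bar>Qx x t - Qx y t\<bar> \<le> L * ?h" if "t \<in> {0..<b}" "\<bar>x - y\<bar> \<le> ?h" for x y t
      using K[OF that(1), of x y] mult_left_mono[OF that(2) L0] by linarith
    have \<omega>t: "\<bar>Qx x t - Qx x r\<bar> \<le> P * k" if "t \<in> {0..<b}" "r \<in> {0..<b}" "\<bar>t - r\<bar> \<le> k" for x t r
      using slope_time_lipschitz[OF sub _ L V K that(1,2), of x] mult_left_mono[OF that(3) P0]
      unfolding P_def by force
    have "\<bar>truncation_error \<alpha> \<beta> ?h k Q i n\<bar> \<le> 2 * \<bar>\<alpha>\<bar> * L\<^sup>2 * (?h + V * k) + V * (L * ?h + P * k)"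
      by (rule truncation_error_bound[OF h k sub _ L V \<omega>x \<omega>t mem]) auto
    also have "\<dots> \<le> 2 * \<bar>\<alpha>\<bar> * L\<^sup>2 * ((1 + V) * (?h + k)) + V * ((L + P) * (?h + k))"
    proof (intro add_mono mult_left_mono)
      show "?h + V * k \<le> (1 + V) * (?h + k)"
        using k V0 h by (simp add: algebra_simps less_imp_le)
      show "L * ?h + P * k \<le> (L + P) * (?h + k)"
        using k L0 P0 h by (simp add: algebra_simps less_imp_le)
    qed (use V0 in auto)
    also have "\<dots> = C * (?h + k)" by (simp add: C_def algebra_simps)
    finally show ?thesis .
  qed
  then show ?thesis unfolding first_order_accurate_def by blast
qed

end

section \<open>Uniform convergence before the existence time\<close>

context smooth_solution
begin

lemma grid_values_step:
  assumes h: "0 < h" and k: "0 < k"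
  shows "Q (of_int i * h) (real (Suc n) * k) =
    upwind_step \<alpha> \<beta> (k / h) (\<lambda>j. Q (of_int j * h) (real n * k)) i
      - k * truncation_error \<alpha> \<beta> h k Q i n"
proof -
  let ?p = "\<lambda>j. Q (of_int j * h) (real n * k)" and ?p' = "Q (of_int i * h) (real (Suc n) * k)"
  let ?X = "max (roe_speed \<alpha> \<beta> ?p i) 0 * (?p i - ?p (i - 1))
     + min (roe_speed \<alpha> \<beta> ?p (i + 1)) 0 * (?p (i + 1) - ?p i)"
  have "c = a - k / h * X - k * ((a - c) / k - 2 * X / (2 * h))" for a c X :: real
    using h k by (simp add: field_simps)
  from this[of ?p' "?p i" ?X] show ?thesis
    unfolding truncation_error_def roe_flux_difference_upwind upwind_step_def .
qed

text \<open>
  Passing from grid values to the piecewise constant function adds the variation of \<open>Q\<close> within one cell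
  and one time step.
\<close>

lemma roe_approximation_error:
  assumes k: "0 < k" and t: "t \<in> {0..b}" and b: "b < T"
    and L: "\<And>x t. t \<in> {0..b} \<Longrightarrow> \<bar>Qx x t\<bar> \<le> L"
    and E: "\<And>n i. real n * k \<le> b \<Longrightarrow> \<bar>num N k n i - Q (of_int i * mesh_width N) (real n * k)\<bar> \<le> E"
    and W: "\<And>x r. \<lbrakk>r \<in> {0..b}; \<bar>t - r\<bar> \<le> k\<rbrakk> \<Longrightarrow> \<bar>Q x t - Q x r\<bar> \<le> W"
  shows "\<bar>roe_approximation \<alpha> \<beta> (mesh_width N) k Q\<^sub>0 x t - Q x t\<bar> \<le> E + L * mesh_width N + W"
proof -
  define n where "n = nat \<lfloor>t / k\<rfloor>"
  define i where "i = \<lfloor>x / mesh_width N + 1 / 2\<rfloor>"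
  let ?h = "mesh_width N"
  have h: "0 < ?h" by simp
  have "0 \<le> t / k" using t k by simp
  then have n: "real n = of_int \<lfloor>t / k\<rfloor>" by (simp add: n_def)
  have nk: "real n * k \<le> t" "t < real n * k + k"
    using floor_divide_lower[OF k, of t] floor_divide_upper[OF k, of t]
    by (simp_all add: n algebra_simps)
  have mem: "real n * k \<in> {0..b}" using nk t k by auto
  have memT: "real n * k \<in> {0..<T}" using mem b by auto
  have "of_int i \<le> x / ?h + 1 / 2" "x / ?h + 1 / 2 < of_int i + 1" unfolding i_def by linarith+
  then have "of_int i * ?h \<le> x + ?h / 2" "x + ?h / 2 < of_int i * ?h + ?h"
    using h by (simp_all add: field_simps)
  then have xi: "\<bar>of_int i * ?h - x\<bar> \<le> ?h" using h by (simp add: abs_le_iff)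
  have "\<bar>num N k n i - Q (of_int i * ?h) (real n * k)\<bar> \<le> E" using mem by (intro E) auto
  moreover have "\<bar>Q (of_int i * ?h) (real n * k) - Q x (real n * k)\<bar> \<le> L * ?h"
    using space_lipschitz[OF memT L[OF mem], of "of_int i * ?h" x]
      mult_left_mono[OF xi order_trans[OF abs_ge_zero L[OF mem]]] by linarith
  moreover have "\<bar>Q x t - Q x (real n * k)\<bar> \<le> W" using nk mem by (intro W) auto
  moreover have "roe_approximation \<alpha> \<beta> ?h k Q\<^sub>0 x t = num N k n i"
    by (simp add: roe_approximation_def n_def i_def)
  ultimately show ?thesis by linarith
qed

text \<open>
  A vanishing speed at time 0 means that either \<open>\<alpha> = \<beta> = 0\<close> or \<open>Q\<close> is constant at time 0; a constant is
  zero as the mean vanishes, and then \<open>\<beta> = 0\<close>. In both cases exact and discrete solution stay at their initial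
  values. This case is separate because \<open>k\<close> may then be arbitrarily large compared to \<open>h\<close>.
\<close>

lemma uniform_convergence_stationary:
  assumes still: "\<And>x. speed x 0 = 0" and b: "0 \<le> b" "b < T" and e: "0 < e"
  shows "\<forall>\<^sub>F h in at_right 0. \<forall>N k. h = mesh_width N \<longrightarrow> 0 < k \<longrightarrow>
    (\<forall>t\<in>{0..b}. \<forall>x. \<bar>roe_approximation \<alpha> \<beta> (mesh_width N) k Q\<^sub>0 x t - Q x t\<bar> \<le> e)"
proof -
  obtain M where M: "\<And>t. t \<in> {0..b} \<Longrightarrow> sobolev_norm s (\<lambda>x. Q x t) \<le> M"
    using sobolev_norm_locally_bounded[OF b(2)] by blast
  define L where "L = 3 * M"
  have L: "\<bar>Qx x t\<bar> \<le> L" if "t \<in> {0..b}" for x t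
    unfolding L_def using M[OF that] that b by (intro slice_bounds(2)) auto
  have L0: "\<bar>Qx x 0\<bar> \<le> L" for x using L b by simp
  have still0: "2 * \<alpha> * Q x 0 + \<beta> = 0" for x using still[of x] by (simp only: speed_def)
  have both: "Q x t = Q x 0 \<and> num N k n i = num N k 0 i"
    if t: "t \<in> {0..<T}" for x t N k n i
  proof (cases "\<alpha> = 0")
    case True
    have \<beta>: "\<beta> = 0" using still0[of 0] True by simp
    have sp: "speed x t = 0" for x t by (simp only: speed_def) (simp add: True \<beta>)
    have "((\<lambda>r. Q x r) has_real_derivative 0) (at r within {0..<T})" if "r \<in> {0..<T}" for r
      using DERIV_time[OF that, of x] by (simp add: sp)
    then have "\<bar>Q x t - Q x 0\<bar> \<le> 0 * \<bar>t - 0\<bar>"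
      using field_differentiable_bound[of "{0..<T}" "\<lambda>r. Q x r" "\<lambda>_. 0" 0 t 0] t zero_in_times by simp
    moreover have "num N k n = num N k 0"
      by (induction n)
        (auto simp: roe_scheme_Suc upwind_step_def roe_speed_def True \<beta> fun_eq_iff simp del: roe_scheme.simps(2))
    ultimately show ?thesis by simp
  next
    case False
    define c where "c = - \<beta> / (2 * \<alpha>)"
    have Qc: "Q x 0 = c" for x using still0[of x] False by (simp add: c_def field_simps)
    have "torus_integral (\<lambda>x. Q x 0) = 2 * pi * c"
      by (simp add: Qc torus_integral_def set_integral_half_open)
    then have c: "c = 0" using slice_mean[OF zero_in_times] by simp
    then have \<beta>: "\<beta> = 0" using False by (simp add: c_def)
    have Q0: "Q x 0 = 0" for x using Qc c by simp
    have "\<bar>Q x t\<bar> \<le> 0" by (rule maximum_principle[OF _ t]) (simp add: Q0)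
    moreover have num0: "num N k 0 i = 0" for i
      by (simp only: roe_scheme.simps initial_cell_average) (simp add: Q0 cell_average_def)
    moreover have "num N k n i = 0" for i
      by (induction n arbitrary: i) (simp_all only: num0 roe_scheme_Suc upwind_step_def roe_speed_def, simp)
    ultimately show ?thesis using Q0 by simp
  qed
  have "\<forall>\<^sub>F h in at_right 0. (2 * L) * h < e" using e by (rule eventually_small_multiple)
  then show ?thesis
  proof eventually_elim
    case (elim h)
    have "\<bar>roe_approximation \<alpha> \<beta> (mesh_width N) k Q\<^sub>0 x t - Q x t\<bar> \<le> e"
      if hN: "h = mesh_width N" and k: "0 < k" and t: "t \<in> {0..b}" for N k t x
    proof -
      have tT: "r \<in> {0..<T}" if "r \<in> {0..b}" for r using that b by auto
      have "\<bar>roe_approximation \<alpha> \<beta> (mesh_width N) k Q\<^sub>0 x t - Q x t\<bar>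
          \<le> L * mesh_width N + L * mesh_width N + 0"
      proof (rule roe_approximation_error[OF k t b(2) L])
        show "\<bar>num N k n i - Q (of_int i * mesh_width N) (real n * k)\<bar> \<le> L * mesh_width N"
          if "real n * k \<le> b" for n i
        proof -
          have "real n * k \<in> {0..<T}" using that b k by auto
          then show ?thesis using num_initial_error[OF L0, of N k i] both[of "real n * k"] by metis
        qed
        show "\<bar>Q x t - Q x r\<bar> \<le> 0" if "r \<in> {0..b}" for x r
          using both[OF tT[OF that], of x] both[OF tT[OF t], of x] by simp
      qed
      then show ?thesis using elim hN by simp
    qed
    then show ?case by blast
  qed
qed

text \<open>
  On a fine mesh some Roe speed of the initial step is in modulus at least half the speed at \<open>y\<close>, so the first instance of the
  CFL condition bounds \<open>k / h\<close>.
\<close>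

lemma cfl_bounds_time_step:
  assumes v: "0 < \<bar>speed y 0\<bar>" and L: "\<And>x. \<bar>Qx x 0\<bar> \<le> L"
    and small: "12 * \<bar>\<alpha>\<bar> * L * mesh_width N < \<bar>speed y 0\<bar>"
    and k: "0 < k" and cfl: "cfl_condition \<alpha> \<beta> T N k Q\<^sub>0"
  shows "k / mesh_width N \<le> 2 / \<bar>speed y 0\<bar>"
proof -
  let ?h = "mesh_width N" and ?v = "speed y 0"
  have h: "0 < ?h" by simp
  have L0: "0 \<le> L" using order_trans[OF abs_ge_zero L] .
  define i where "i = \<lfloor>y / ?h\<rfloor>"
  have i: "\<bar>of_int i * ?h - y\<bar> \<le> ?h"
    using floor_divide_lower[OF h, of y] floor_divide_upper[OF h, of y]
    by (auto simp: i_def abs_le_iff algebra_simps)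
  have near: "\<bar>num N k 0 j - Q y 0\<bar> \<le> L * ?h + L * (2 * ?h)" if "\<bar>of_int j * ?h - y\<bar> \<le> 2 * ?h" for j
    using num_initial_error[OF L, of N k j] space_lipschitz[OF zero_in_times L, of "of_int j * ?h" y]
      mult_left_mono[OF that L0] by linarith
  have "\<bar>num N k 0 i - Q y 0\<bar> \<le> L * ?h + L * (2 * ?h)" using i h by (intro near) auto
  moreover have "\<bar>num N k 0 (i - 1) - Q y 0\<bar> \<le> L * ?h + L * (2 * ?h)"
    using i h by (intro near) (auto simp: algebra_simps abs_le_iff)
  ultimately have "\<bar>(num N k 0 i - Q y 0) + (num N k 0 (i - 1) - Q y 0)\<bar> \<le> 6 * (L * ?h)" by linarith
  moreover have "roe_speed \<alpha> \<beta> (num N k 0) i - ?v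
      = \<alpha> * ((num N k 0 i - Q y 0) + (num N k 0 (i - 1) - Q y 0))"
    unfolding roe_speed_def speed_def by (simp only: algebra_simps)
  ultimately have "\<bar>roe_speed \<alpha> \<beta> (num N k 0) i - ?v\<bar> \<le> \<bar>\<alpha>\<bar> * (6 * (L * ?h))"
    by (simp only: abs_mult mult_left_mono abs_ge_zero)
  also have "\<dots> = 12 * \<bar>\<alpha>\<bar> * L * ?h / 2" by simp
  finally have "\<bar>?v\<bar> / 2 \<le> \<bar>roe_speed \<alpha> \<beta> (num N k 0) i\<bar>" using small by linarith
  then have "k / ?h * (\<bar>?v\<bar> / 2) \<le> k / ?h * \<bar>roe_speed \<alpha> \<beta> (num N k 0) i\<bar>"
    using k h by (intro mult_left_mono) (simp_all add: less_imp_le)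
  also have "\<dots> \<le> 1" using T_pos by (intro cfl_everywhere[OF cfl k]) simp
  finally have "k / ?h * (\<bar>?v\<bar> / 2) \<le> 1" .
  moreover have "x \<le> 2" if "x / 2 \<le> 1" for x :: real using that by simp
  ultimately have "k / ?h * \<bar>?v\<bar> \<le> 2" by (simp only: times_divide_eq_right)
  then show ?thesis by (simp only: pos_le_divide_eq[OF v])
qed

text \<open>
  Here \<open>k\<close> is at most \<open>\<Lambda> h\<close>, and the error estimate of the scheme applies once \<open>h\<close> is small. The
  target \<open>e'\<close> for the grid error is chosen below \<open>e\<close> and so small that the smallness
  condition of the error recursion holds with \<open>k / h\<close> replaced by \<open>\<Lambda>\<close>; \<open>\<epsilon>\<close> and \<open>\<omega>\<close> are the
  corresponding tolerances for the truncation error and for the variation of the slope.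
\<close>

lemma uniform_convergence_moving:
  assumes v: "0 < \<bar>speed y 0\<bar>" and b: "0 \<le> b" "b < T" and e: "0 < e"
  shows "\<forall>\<^sub>F h in at_right 0. \<forall>N k. h = mesh_width N \<longrightarrow> 0 < k \<longrightarrow> cfl_condition \<alpha> \<beta> T N k Q\<^sub>0 \<longrightarrow>
    (\<forall>t\<in>{0..b}. \<forall>x. \<bar>roe_approximation \<alpha> \<beta> (mesh_width N) k Q\<^sub>0 x t - Q x t\<bar> \<le> e)"
proof -
  obtain M where M: "\<And>t. t \<in> {0..b} \<Longrightarrow> sobolev_norm s (\<lambda>x. Q x t) \<le> M"
    using sobolev_norm_locally_bounded[OF b(2)] by blast
  have sub: "{0..b} \<subseteq> {0..<T}" using b by auto
  define L where "L = 3 * M"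
  define V where "V = 2 * \<bar>\<alpha>\<bar> * L + \<bar>\<beta>\<bar>"
  define \<Lambda> where "\<Lambda> = 2 / \<bar>speed y 0\<bar>"
  have L: "\<bar>Qx x t\<bar> \<le> L" and V: "\<bar>speed x t\<bar> \<le> V" if "t \<in> {0..b}" for x t
  proof -
    note bounds = slice_bounds[OF subsetD[OF sub that] M[OF that], folded L_def]
    show "\<bar>Qx x t\<bar> \<le> L" by (rule bounds(2))
    show "\<bar>speed x t\<bar> \<le> V" unfolding V_def by (rule speed_bound[OF bounds(1)])
  qed
  have L_init: "\<bar>Qx x 0\<bar> \<le> L" for x using L b by simp
  have L0: "0 \<le> L" and V0: "0 \<le> V"
    using order_trans[OF abs_ge_zero L] order_trans[OF abs_ge_zero V] b by auto
  have \<Lambda>0: "0 < \<Lambda>" using v by (simp add: \<Lambda>_def)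
  define K where "K = exp (4 * \<bar>\<alpha>\<bar> * L * b)"
  have K: "1 \<le> K" using L0 b by (simp add: K_def)
  define e' where "e' = min (e / 2) (1 / (4 * (\<Lambda> * \<bar>\<alpha>\<bar> + 1)))"
  have \<Lambda>\<alpha>: "0 \<le> \<Lambda> * \<bar>\<alpha>\<bar>" using \<Lambda>0 by simp
  have e': "0 < e'" "e' \<le> e / 2" using e \<Lambda>\<alpha> by (auto simp: e'_def)
  have e'\<Lambda>: "\<Lambda> * \<bar>\<alpha>\<bar> * (4 * e') \<le> 1"
  proof -
    have "\<Lambda> * \<bar>\<alpha>\<bar> * (4 * e') \<le> (\<Lambda> * \<bar>\<alpha>\<bar> + 1) * (4 * (1 / (4 * (\<Lambda> * \<bar>\<alpha>\<bar> + 1))))"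
      using \<Lambda>\<alpha> e' by (intro mult_mono) (auto simp: e'_def)
    also have "\<dots> = 1" using \<Lambda>\<alpha> by (simp add: field_simps)
    finally show ?thesis .
  qed
  define \<epsilon> where "\<epsilon> = e' / (2 * K * (b + 1))"
  have \<epsilon>: "0 < \<epsilon>" using e' K b by (simp add: \<epsilon>_def)
  have K\<epsilon>: "K * (b * \<epsilon>) \<le> e' / 2"
  proof -
    have "K * (b * \<epsilon>) \<le> K * ((b + 1) * \<epsilon>)" using K \<epsilon> by (intro mult_left_mono mult_right_mono) auto
    also have "\<dots> = e' / 2" using K b by (simp add: \<epsilon>_def)
    finally show ?thesis .
  qed
  define \<omega> where "\<omega> = \<epsilon> / (4 * (V + 1))"
  have \<omega>: "0 < \<omega>" using \<epsilon> V0 by (simp add: \<omega>_def)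
  have V\<omega>: "V * (\<omega> + \<omega>) \<le> \<epsilon> / 2"
  proof -
    have "V * (\<omega> + \<omega>) \<le> (V + 1) * (\<omega> + \<omega>)" using \<omega> by (intro mult_right_mono) auto
    also have "\<dots> = \<epsilon> / 2"
    proof -
      have "4 * (V + 1) \<noteq> 0" using V0 by simp
      from nonzero_eq_divide_eq[THEN iffD1, OF this \<omega>_def] show ?thesis by (simp add: algebra_simps)
    qed
    finally show ?thesis .
  qed
  have "\<exists>d>0. \<forall>x y t r. t \<in> {0..b} \<and> r \<in> {0..b} \<and> \<bar>x - y\<bar> < d \<and> \<bar>t - r\<bar> < d \<longrightarrow> \<bar>Qx x t - Qx y r\<bar> < \<omega>"
    by (rule periodic_uniformly_continuous[where p = "2 * pi", OF continuous_on_subset[OF continuous_Qx] \<omega> _ Qx_periodic])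
      (use sub in auto)
  then obtain d where d: "0 < d"
    and unif: "\<And>x y t r. \<lbrakk>t \<in> {0..b}; r \<in> {0..b}; \<bar>x - y\<bar> < d; \<bar>t - r\<bar> < d\<rbrakk> \<Longrightarrow> \<bar>Qx x t - Qx y r\<bar> < \<omega>"
    by blast
  have half: "0 < e' / (2 * K)" "0 < \<epsilon> / 2" "0 < e / 2" using e' K \<epsilon> e by auto
  have "\<forall>\<^sub>F h in at_right 0. 12 * \<bar>\<alpha>\<bar> * L * h < \<bar>speed y 0\<bar> \<and> L * h < e' / (2 * K) \<and>
      2 * \<bar>\<alpha>\<bar> * L\<^sup>2 * (1 + V * \<Lambda>) * h < \<epsilon> / 2 \<and> (1 + \<Lambda>) * h < d \<and> (L + V * L * \<Lambda>) * h < e / 2"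
    by (intro eventually_conj eventually_small_multiple v half d)
  then show ?thesis
  proof eventually_elim
    case (elim h)
    have "\<bar>roe_approximation \<alpha> \<beta> (mesh_width N) k Q\<^sub>0 x t - Q x t\<bar> \<le> e"
      if hN: "h = mesh_width N" and k: "0 < k" and cfl: "cfl_condition \<alpha> \<beta> T N k Q\<^sub>0"
        and t: "t \<in> {0..b}" for N k t x
    proof -
      have h: "0 < h" by (simp add: hN)
      have \<mu>: "k / h \<le> \<Lambda>"
        using elim unfolding \<Lambda>_def hN by (intro cfl_bounds_time_step[OF v L_init _ k cfl]) auto
      then have k\<Lambda>: "k \<le> \<Lambda> * h" using h by (simp add: pos_divide_le_eq)
      have "0 < \<Lambda> * h" "h + \<Lambda> * h < d" using elim h \<Lambda>0 by (simp_all add: distrib_right)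
      then have hd: "h < d" and kd: "k < d" using k\<Lambda> h by linarith+
      have Lh: "K * (L * h) \<le> e' / 2"
      proof -
        have "K * (L * h) \<le> K * (e' / (2 * K))" using elim K by (intro mult_left_mono) auto
        then show ?thesis using K by simp
      qed
      have err: "\<bar>num N k n i - Q (of_int i * h) (real n * k)\<bar> \<le> K * (L * h + b * \<epsilon>)"
        if n: "real n * k \<le> b" for n i
        unfolding K_def
      proof (rule upwind_error_growth[where m = n and Q = "num N k" and L = L
            and p = "\<lambda>n i. Q (of_int i * h) (real n * k)" and \<tau> = "\<lambda>n i. truncation_error \<alpha> \<beta> h k Q i n"
            and \<alpha> = \<alpha> and \<beta> = \<beta> and h = h and k = k])
        have mk: "real m * k \<le> real n * k" if "m \<le> n" for m using that k by simp
        show "num N k (Suc m) = upwind_step \<alpha> \<beta> (k / h) (num N k m)" for m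
          unfolding hN by (rule roe_scheme_Suc)
        show "k / h * \<bar>roe_speed \<alpha> \<beta> (num N k m) i\<bar> \<le> 1" if "m < n" for m i
          unfolding hN using mk[of m] that n b by (intro cfl_everywhere[OF cfl k]) auto
        show "\<bar>num N k 0 i - Q (of_int i * h) (real 0 * k)\<bar> \<le> L * h" for i
          using num_initial_error[OF L_init, of N k i] by (simp add: hN)
        show "\<bar>Q (of_int i * h) (real m * k) - Q (of_int (i - 1) * h) (real m * k)\<bar> \<le> L * h"
          if "m < n" for m i
        proof -
          have m: "real m * k \<in> {0..b}" using order_trans[OF mk n, of m] that k by simp
          have "\<bar>of_int i * h - of_int (i - 1) * h\<bar> = h" using h by (simp add: algebra_simps)
          then show ?thesis
            using space_lipschitz[OF subsetD[OF sub m] L[OF m], of "of_int i * h" "of_int (i - 1) * h"]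
            by simp
        qed
        have "k / h * \<bar>\<alpha>\<bar> * (2 * (K * (L * h + b * \<epsilon>)) + 2 * L * h) \<le> \<Lambda> * \<bar>\<alpha>\<bar> * (4 * e')"
        proof (intro mult_mono mult_right_mono \<mu>)
          have "L * h \<le> K * (L * h)" using mult_right_mono[OF K, of "L * h"] L0 h by simp
          then have "K * (L * h + b * \<epsilon>) \<le> e'" "2 * L * h \<le> e'"
            using Lh K\<epsilon> e'(1) by (simp_all add: distrib_left)
          then show "2 * (K * (L * h + b * \<epsilon>)) + 2 * L * h \<le> 4 * e'" using e'(1) by linarith
          show "0 \<le> 2 * (K * (L * h + b * \<epsilon>)) + 2 * L * h" using K L0 h b \<epsilon> by simp
        qed (use \<Lambda>\<alpha> \<Lambda>0 in auto)
        from order_trans[OF this e'\<Lambda>]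
        show "k / h * \<bar>\<alpha>\<bar> * (2 * (exp (4 * \<bar>\<alpha>\<bar> * L * b) * (L * h + b * \<epsilon>)) + 2 * L * h) \<le> 1"
          unfolding K_def .
        show "Q (of_int i * h) (real (Suc m) * k) =
            upwind_step \<alpha> \<beta> (k / h) (\<lambda>i. Q (of_int i * h) (real m * k)) i - k * truncation_error \<alpha> \<beta> h k Q i m"
          for m i by (rule grid_values_step[OF h k])
        show "\<bar>truncation_error \<alpha> \<beta> h k Q i m\<bar> \<le> \<epsilon>" if "m < n" for m i
        proof -
          have m: "real m * k \<in> {0..b}" "real (Suc m) * k \<in> {0..b}"
            using order_trans[OF mk n, of m] order_trans[OF mk n, of "Suc m"] that k by simp_all
          have "\<bar>truncation_error \<alpha> \<beta> h k Q i m\<bar> \<le> 2 * \<bar>\<alpha>\<bar> * L\<^sup>2 * (h + V * k) + V * (\<omega> + \<omega>)"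
          proof (rule truncation_error_bound[OF h k sub _ L V _ _ m])
            show "\<bar>Qx x t - Qx y t\<bar> \<le> \<omega>" if "t \<in> {0..b}" "\<bar>x - y\<bar> \<le> h" for x y t
              using unif[OF that(1,1), of x y] that(2) hd d by simp
            show "\<bar>Qx x t - Qx x r\<bar> \<le> \<omega>" if "t \<in> {0..b}" "r \<in> {0..b}" "\<bar>t - r\<bar> \<le> k" for x t r
              using unif[OF that(1,2), of x x] that(3) kd d by simp
          qed auto
          also have "\<dots> \<le> 2 * \<bar>\<alpha>\<bar> * L\<^sup>2 * ((1 + V * \<Lambda>) * h) + \<epsilon> / 2"
          proof (intro add_mono mult_left_mono V\<omega>)
            show "h + V * k \<le> (1 + V * \<Lambda>) * h"
              using mult_left_mono[OF k\<Lambda> V0] by (simp add: algebra_simps)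
          qed simp
          also have "\<dots> \<le> \<epsilon>" using elim by (simp add: mult.assoc)
          finally show ?thesis .
        qed
      qed (use h k L0 \<epsilon> n in \<open>auto simp: less_imp_le\<close>)
      have err': "\<bar>num N k n i - Q (of_int i * mesh_width N) (real n * k)\<bar> \<le> K * (L * h + b * \<epsilon>)"
        if "real n * k \<le> b" for n i
        using err[OF that] by (simp only: hN)
      have "\<bar>roe_approximation \<alpha> \<beta> (mesh_width N) k Q\<^sub>0 x t - Q x t\<bar>
          \<le> K * (L * h + b * \<epsilon>) + L * mesh_width N + V * L * (\<Lambda> * h)"
      proof (rule roe_approximation_error[OF k t b(2) L err'])
        show "\<bar>Q x t - Q x r\<bar> \<le> V * L * (\<Lambda> * h)" if "r \<in> {0..b}" "\<bar>t - r\<bar> \<le> k" for x r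
        proof -
          have "\<bar>Q x t - Q x r\<bar> \<le> V * L * \<bar>t - r\<bar>"
            using time_lipschitz[OF sub _ L V t that(1)] by simp
          also have "\<dots> \<le> V * L * (\<Lambda> * h)" using that(2) k\<Lambda> V0 L0 by (intro mult_left_mono) auto
          finally show ?thesis .
        qed
      qed
      also have "\<dots> = K * (L * h) + K * (b * \<epsilon>) + (L + V * L * \<Lambda>) * h"
        by (simp add: hN algebra_simps)
      also have "\<dots> \<le> e" using Lh K\<epsilon> e'(2) elim by linarith
      finally show ?thesis .
    qed
    then show ?case by blast
  qed
qed

lemma uniform_convergence:
  assumes b: "0 \<le> b" "b < T" and e: "0 < e"
  obtains \<delta> where "0 < \<delta>"
    "\<And>N k t x. \<lbrakk>mesh_width N < \<delta>; 0 < k; cfl_condition \<alpha> \<beta> T N k Q\<^sub>0; t \<in> {0..b}\<rbrakk>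
      \<Longrightarrow> \<bar>roe_approximation \<alpha> \<beta> (mesh_width N) k Q\<^sub>0 x t - Q x t\<bar> \<le> e"
proof -
  have "\<forall>\<^sub>F h in at_right 0. \<forall>N k. h = mesh_width N \<longrightarrow> 0 < k \<longrightarrow> cfl_condition \<alpha> \<beta> T N k Q\<^sub>0 \<longrightarrow>
      (\<forall>t\<in>{0..b}. \<forall>x. \<bar>roe_approximation \<alpha> \<beta> (mesh_width N) k Q\<^sub>0 x t - Q x t\<bar> \<le> e)"
  proof (cases "\<forall>y. speed y 0 = 0")
    case True
    then show ?thesis using uniform_convergence_stationary[OF _ b e] by (auto elim: eventually_mono)
  next
    case False
    then obtain y where "0 < \<bar>speed y 0\<bar>" by auto
    then show ?thesis by (rule uniform_convergence_moving[OF _ b e])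
  qed
  then obtain \<delta> where \<delta>: "0 < \<delta>"
    "\<forall>h>0. h < \<delta> \<longrightarrow> (\<forall>N k. h = mesh_width N \<longrightarrow> 0 < k \<longrightarrow> cfl_condition \<alpha> \<beta> T N k Q\<^sub>0 \<longrightarrow>
      (\<forall>t\<in>{0..b}. \<forall>x. \<bar>roe_approximation \<alpha> \<beta> (mesh_width N) k Q\<^sub>0 x t - Q x t\<bar> \<le> e))"
    unfolding eventually_at_right_field by auto
  show thesis
    by (rule that[OF \<delta>(1)]) (rule \<delta>(2)[rule_format, OF mesh_width_pos _ refl])
qed

end

section \<open>Convergence in the mean\<close>

lemma tendsto_L1_add:
  assumes f: "tendsto_L1 M f g \<F>" and f': "tendsto_L1 M f' g' \<F>"
  shows "tendsto_L1 M (\<lambda>i z. f i z + f' i z) (\<lambda>z. g z + g' z) \<F>"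
proof -
  have ev: "\<forall>\<^sub>F i in \<F>. integrable M (f i)" "\<forall>\<^sub>F i in \<F>. integrable M (f' i)"
    and g: "integrable M g" "integrable M g'"
    using f f' by (simp_all add: tendsto_L1_def)
  have lim: "((\<lambda>i. (\<integral>z. \<bar>f i z - g z\<bar> \<partial>M) + (\<integral>z. \<bar>f' i z - g' z\<bar> \<partial>M)) \<longlongrightarrow> 0) \<F>"
    using tendsto_add[of "\<lambda>i. \<integral>z. \<bar>f i z - g z\<bar> \<partial>M" 0 \<F> "\<lambda>i. \<integral>z. \<bar>f' i z - g' z\<bar> \<partial>M" 0] f f'
    by (simp add: tendsto_L1_def)
  have le: "\<forall>\<^sub>F i in \<F>. (\<integral>z. \<bar>(f i z + f' i z) - (g z + g' z)\<bar> \<partial>M) \<le>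
      (\<integral>z. \<bar>f i z - g z\<bar> \<partial>M) + (\<integral>z. \<bar>f' i z - g' z\<bar> \<partial>M)"
    using ev
  proof eventually_elim
    case (elim i)
    have "(\<integral>z. \<bar>(f i z + f' i z) - (g z + g' z)\<bar> \<partial>M) \<le>
        (\<integral>z. \<bar>f i z - g z\<bar> + \<bar>f' i z - g' z\<bar> \<partial>M)"
      using elim g by (intro integral_mono) auto
    also have "\<dots> = (\<integral>z. \<bar>f i z - g z\<bar> \<partial>M) + (\<integral>z. \<bar>f' i z - g' z\<bar> \<partial>M)"
      using elim g by (intro Bochner_Integration.integral_add) auto
    finally show ?case .
  qed
  have "((\<lambda>i. \<integral>z. \<bar>(f i z + f' i z) - (g z + g' z)\<bar> \<partial>M) \<longlongrightarrow> 0) \<F>"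
    by (rule tendsto_sandwich[OF _ le tendsto_const lim]) simp
  moreover have "\<forall>\<^sub>F i in \<F>. integrable M (\<lambda>z. f i z + f' i z)"
    using ev by eventually_elim simp
  ultimately show ?thesis using g by (simp add: tendsto_L1_def)
qed

lemma tendsto_L1_uminus:
  assumes "tendsto_L1 M f g \<F>"
  shows "tendsto_L1 M (\<lambda>i z. - f i z) (\<lambda>z. - g z) \<F>"
proof -
  have "\<bar>- f i z - - g z\<bar> = \<bar>f i z - g z\<bar>" for i z by simp
  then show ?thesis using assms by (simp add: tendsto_L1_def)
qed

lemma tendsto_L1_const:
  "integrable M g \<Longrightarrow> tendsto_L1 M (\<lambda>i. g) g \<F>"
  by (simp add: tendsto_L1_def)

lemma space_time_torus: "space (time_torus T) = {0..<T} \<times> {0..<2 * pi}"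
  by (simp add: time_torus_def space_restrict_space)

lemma rectangle_measurable:
  fixes A B :: "real set"
  assumes "A \<in> sets borel" "B \<in> sets borel"
  shows "A \<times> B \<in> sets borel"
  using assms unfolding borel_prod[symmetric] by (rule pair_measureI)

lemma measure_time_torus_slab:
  assumes b: "b \<le> T"
  shows "measure (time_torus T) (({b..T} \<times> {0..2 * pi}) \<inter> space (time_torus T)) \<le> 2 * pi * (T - b)"
proof -
  let ?C = "{b..T} \<times> {0..2 * pi}"
  have C: "?C = cbox (b, 0) (T, 2 * pi)" by (simp add: cbox_Pair_eq)
  have S: "{0..<T} \<times> {0..<2 * pi} \<in> sets lborel"
    unfolding sets_lborel by (intro rectangle_measurable) auto
  have "measure (time_torus T) (?C \<inter> space (time_torus T)) = measure lborel (?C \<inter> space (time_torus T))"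
    unfolding space_time_torus unfolding time_torus_def
    using S by (intro measure_restrict_space) auto
  also have "\<dots> \<le> measure lborel ?C"
    unfolding space_time_torus using S
    by (intro measure_mono_fmeasurable) (auto simp: C fmeasurable_cbox)
  also have "\<dots> = 2 * pi * (T - b)"
    unfolding C content_Pair using b by simp
  finally show ?thesis .
qed

lemma finite_measure_time_torus: "finite_measure (time_torus T)"
proof
  have "emeasure (time_torus T) (space (time_torus T)) = emeasure lborel ({0..<T} \<times> {0..<2 * pi})"
    unfolding space_time_torus unfolding time_torus_def
    by (rule emeasure_restrict_space) (auto intro!: rectangle_measurable)
  also have "\<dots> \<le> emeasure lborel (cbox (0, 0) (T, 2 * pi))"
    by (rule emeasure_mono) (auto simp: cbox_Pair_eq intro!: rectangle_measurable)
  also have "\<dots> < \<infinity>" by (rule emeasure_lborel_cbox_finite)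
  finally show "emeasure (time_torus T) (space (time_torus T)) \<noteq> \<infinity>" by simp
qed

text \<open>
  The time axis is split at \<open>b < T\<close>: before \<open>b\<close> the functions are uniformly close, and the slab
  after \<open>b\<close> contributes at most \<open>2 M\<close> times its small measure.
\<close>

lemma tendsto_L1_of_locally_uniform:
  fixes f :: "'i \<Rightarrow> real \<times> real \<Rightarrow> real" and g :: "real \<times> real \<Rightarrow> real"
  assumes T: "0 < T"
    and f_meas: "\<And>i. f i \<in> borel_measurable (time_torus T)"
    and g_meas: "g \<in> borel_measurable (time_torus T)"
    and f_bound: "\<forall>\<^sub>F i in \<F>. \<forall>t\<in>{0..<T}. \<forall>x. \<bar>f i (t, x)\<bar> \<le> M"
    and g_bound: "\<And>t x. t \<in> {0..<T} \<Longrightarrow> \<bar>g (t, x)\<bar> \<le> M"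
    and conv: "\<And>b e. \<lbrakk>0 \<le> b; b < T; 0 < e\<rbrakk> \<Longrightarrow>
      \<forall>\<^sub>F i in \<F>. \<forall>t\<in>{0..b}. \<forall>x. \<bar>f i (t, x) - g (t, x)\<bar> \<le> e"
  shows "tendsto_L1 (time_torus T) f g \<F>"
proof -
  let ?M = "time_torus T"
  interpret finite_measure ?M by (rule finite_measure_time_torus)
  have M: "0 \<le> M" using order_trans[OF abs_ge_zero g_bound[of 0]] T by auto
  have space: "z \<in> space ?M \<Longrightarrow> fst z \<in> {0..<T}" for z by (auto simp: space_time_torus)
  have g_int: "integrable ?M g"
  proof (rule integrable_const_bound[of _ M])
    show "AE z in ?M. norm (g z) \<le> M"
      using g_bound[of "fst z" "snd z" for z] space by (intro AE_I2) (metis prod.collapse real_norm_def)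
  qed (rule g_meas)
  have f_int: "integrable ?M (f i)" if "\<forall>t\<in>{0..<T}. \<forall>x. \<bar>f i (t, x)\<bar> \<le> M" for i
  proof (rule integrable_const_bound[of _ M])
    show "AE z in ?M. norm (f i z) \<le> M"
      using that space by (intro AE_I2) (metis prod.collapse real_norm_def)
  qed (rule f_meas)
  have "\<forall>\<^sub>F i in \<F>. (\<integral>z. \<bar>f i z - g z\<bar> \<partial>?M) < \<epsilon>" if \<epsilon>: "0 < \<epsilon>" for \<epsilon>
  proof -
    \<comment> \<open>both parts of the integral will be at most \<open>\<epsilon> / 4\<close>\<close>
    define e where "e = \<epsilon> / (8 * pi * T)"
    define b where "b = max 0 (T - \<epsilon> / (16 * pi * (M + 1)))"
    have e: "0 < e" using \<epsilon> T by (simp add: e_def)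
    have gap: "0 < \<epsilon> / (16 * pi * (M + 1))" using \<epsilon> M by simp
    have b: "0 \<le> b" "b < T" using T gap by (auto simp: b_def)
    have Tb: "T - b \<le> \<epsilon> / (16 * pi * (M + 1))" by (simp add: b_def)
    let ?C = "{b..T} \<times> {0..2 * pi}"
    have "\<forall>\<^sub>F i in \<F>. \<forall>t\<in>{0..b}. \<forall>x. \<bar>f i (t, x) - g (t, x)\<bar> \<le> e" by (rule conv[OF b e])
    with f_bound show ?thesis
    proof eventually_elim
      case (elim i)
      have C_meas: "?C \<inter> space ?M \<in> sets ?M"
      proof -
        have "{0..<T} \<times> {0..<2 * pi} \<in> sets lborel" "?C \<in> sets lborel"
          unfolding sets_lborel by (intro rectangle_measurable; simp)+
        then show ?thesis
          unfolding space_time_torus unfolding time_torus_def by (subst sets_restrict_space_iff) auto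
      qed
      have ind_int: "integrable ?M (indicat_real (?C \<inter> space ?M))"
        by (rule integrable_real_indicator[OF C_meas]) (simp add: less_top[symmetric])
      have "(\<integral>z. \<bar>f i z - g z\<bar> \<partial>?M) \<le> (\<integral>z. e + 2 * M * indicat_real (?C \<inter> space ?M) z \<partial>?M)"
      proof (rule integral_mono)
        show "integrable ?M (\<lambda>z. \<bar>f i z - g z\<bar>)" using f_int[OF elim(1)] g_int by auto
        show "integrable ?M (\<lambda>z. e + 2 * M * indicat_real (?C \<inter> space ?M) z)" using ind_int by auto
        show "\<bar>f i z - g z\<bar> \<le> e + 2 * M * indicat_real (?C \<inter> space ?M) z" if z: "z \<in> space ?M" for z
        proof (cases "fst z \<le> b")
          case True
          then have "\<bar>f i z - g z\<bar> \<le> e" using elim(2) space[OF z] by (cases z) auto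
          then show ?thesis using M by (simp add: indicator_def)
        next
          case False
          have "z \<in> ?C" using z False by (auto simp: space_time_torus)
          moreover have "\<bar>f i z\<bar> \<le> M" "\<bar>g z\<bar> \<le> M"
            using elim(1) g_bound[of "fst z" "snd z"] space[OF z] by (cases z; auto)+
          ultimately show ?thesis using z e by simp
        qed
      qed
      also have "\<dots> = e * measure ?M (space ?M) + 2 * M * measure ?M (?C \<inter> space ?M)"
        using ind_int by simp
      also have "\<dots> \<le> e * (2 * pi * T) + 2 * M * (2 * pi * (T - b))"
      proof (intro add_mono mult_left_mono)
        have "measure ?M (space ?M) = measure ?M (({0..T} \<times> {0..2 * pi}) \<inter> space ?M)"
          by (rule arg_cong[of _ _ "measure ?M"]) (auto simp: space_time_torus)
        also have "\<dots> \<le> 2 * pi * (T - 0)" using T by (intro measure_time_torus_slab) simp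
        finally show "measure ?M (space ?M) \<le> 2 * pi * T" by simp
        show "measure ?M (?C \<inter> space ?M) \<le> 2 * pi * (T - b)"
          using b by (intro measure_time_torus_slab) simp
      qed (use e M in auto)
      also have "\<dots> \<le> \<epsilon> / 4 + \<epsilon> / 4"
      proof (intro add_mono)
        show "e * (2 * pi * T) \<le> \<epsilon> / 4" using T by (simp add: e_def)
        have "2 * M * (2 * pi * (T - b)) \<le> 2 * (M + 1) * (2 * pi * (\<epsilon> / (16 * pi * (M + 1))))"
          using M Tb b gap by (intro mult_mono) auto
        also have "\<dots> = \<epsilon> / 4"
        proof -
          have "2 * m * (2 * pi * (\<epsilon> / (16 * pi * m))) = \<epsilon> / 4" if "m \<noteq> 0" for m
            using that by (simp add: field_simps)
          from this[of "M + 1"] show ?thesis using M by simp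
        qed
        finally show "2 * M * (2 * pi * (T - b)) \<le> \<epsilon> / 4" .
      qed
      also have "\<dots> < \<epsilon>" using \<epsilon> by simp
      finally show ?case .
    qed
  qed
  then have "((\<lambda>i. \<integral>z. \<bar>f i z - g z\<bar> \<partial>?M) \<longlongrightarrow> 0) \<F>"
    by (intro tendstoI) (simp add: dist_real_def abs_of_nonneg)
  moreover have "\<forall>\<^sub>F i in \<F>. integrable ?M (f i)" using f_bound by eventually_elim (rule f_int)
  ultimately show ?thesis using g_int by (simp add: tendsto_L1_def)
qed

lemma roe_approximation_measurable:
  "(\<lambda>(t, x). roe_approximation \<alpha> \<beta> h k Q\<^sub>0 (x + c) t) \<in> borel_measurable (time_torus T)"
proof -
  let ?P = "borel \<Otimes>\<^sub>M borel :: (real \<times> real) measure"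
  have i: "(\<lambda>z. \<lfloor>(snd z + c) / h + 1 / 2\<rfloor>) \<in> ?P \<rightarrow>\<^sub>M count_space UNIV"
    and n: "(\<lambda>z. nat \<lfloor>fst z / k\<rfloor>) \<in> ?P \<rightarrow>\<^sub>M count_space UNIV"
    by measurable
  have "(\<lambda>z. roe_scheme \<alpha> \<beta> h k Q\<^sub>0 n \<lfloor>(snd z + c) / h + 1 / 2\<rfloor>) \<in> borel_measurable ?P" for n
    by (rule measurable_compose_countable[OF _ i]) simp
  then have "(\<lambda>z. roe_scheme \<alpha> \<beta> h k Q\<^sub>0 (nat \<lfloor>fst z / k\<rfloor>) \<lfloor>(snd z + c) / h + 1 / 2\<rfloor>)
      \<in> borel_measurable ?P"
    by (rule measurable_compose_countable[OF _ n])
  then have "(\<lambda>(t, x). roe_approximation \<alpha> \<beta> h k Q\<^sub>0 (x + c) t) \<in> borel_measurable lborel"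
    by (simp add: roe_approximation_def case_prod_unfold borel_prod)
  then show ?thesis unfolding time_torus_def by (rule measurable_restrict_space1)
qed

context smooth_solution
begin

lemma Q_shift_measurable: "(\<lambda>(t, x). Q (x + c) t) \<in> borel_measurable (time_torus T)"
proof -
  let ?S = "{0..<T} \<times> {0..<2 * pi}"
  have "continuous_on ?S ((\<lambda>(x, t). Q x t) \<circ> (\<lambda>z. (snd z + c, fst z)))"
    by (rule continuous_on_compose) (auto intro!: continuous_intros intro: continuous_on_subset[OF continuous_Q])
  then have "(\<lambda>z. Q (snd z + c) (fst z)) \<in> borel_measurable (restrict_space borel ?S)"
    by (intro borel_measurable_continuous_on_restrict) (simp add: o_def)
  moreover have "sets (restrict_space borel ?S) = sets (time_torus T)"
    unfolding time_torus_def by (rule sets_restrict_space_cong) simp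
  ultimately have "(\<lambda>z. Q (snd z + c) (fst z)) \<in> borel_measurable (time_torus T)"
    by (simp cong: measurable_cong_sets)
  then show ?thesis by (simp only: case_prod_unfold)
qed

lemma shifted_L1_convergence:
  assumes fine: "\<And>\<delta>. 0 < \<delta> \<Longrightarrow>
    \<forall>\<^sub>F (N, k) in \<F>. mesh_width N < \<delta> \<and> 0 < k \<and> cfl_condition \<alpha> \<beta> T N k Q\<^sub>0"
  shows "tendsto_L1 (time_torus T)
    (\<lambda>(N, k) (t, x). roe_approximation \<alpha> \<beta> (mesh_width N) k Q\<^sub>0 (x + c) t)
    (\<lambda>(t, x). Q (x + c) t) \<F>"
proof -
  obtain M where num: "\<And>N k n i. \<lbrakk>0 < k; cfl_condition \<alpha> \<beta> T N k Q\<^sub>0; real n * k < T\<rbrakk> \<Longrightarrow> \<bar>num N k n i\<bar> \<le> M"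
    and Q: "\<And>x t. t \<in> {0..<T} \<Longrightarrow> \<bar>Q x t\<bar> \<le> M"
    using num_bounded by blast
  have approx: "\<bar>roe_approximation \<alpha> \<beta> (mesh_width N) k Q\<^sub>0 x t\<bar> \<le> M"
    if k: "0 < k" and cfl: "cfl_condition \<alpha> \<beta> T N k Q\<^sub>0" and t: "t \<in> {0..<T}" for N k x t
  proof -
    have "real (nat \<lfloor>t / k\<rfloor>) * k \<le> t" using floor_divide_lower[OF k, of t] t k by simp
    then show ?thesis unfolding roe_approximation_def using t by (intro num[OF k cfl]) auto
  qed
  show ?thesis
  proof (rule tendsto_L1_of_locally_uniform[OF T_pos _ Q_shift_measurable, of _ M])
    show "(case i of (N, k) \<Rightarrow> \<lambda>(t, x). roe_approximation \<alpha> \<beta> (mesh_width N) k Q\<^sub>0 (x + c) t)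
        \<in> borel_measurable (time_torus T)" for i
      by (cases i) (simp add: roe_approximation_measurable)
    show "\<forall>\<^sub>F i in \<F>. \<forall>t\<in>{0..<T}. \<forall>x.
        \<bar>(case i of (N, k) \<Rightarrow> \<lambda>(t, x). roe_approximation \<alpha> \<beta> (mesh_width N) k Q\<^sub>0 (x + c) t) (t, x)\<bar> \<le> M"
      using fine[OF zero_less_one] by eventually_elim (auto intro: approx)
    show "\<bar>case (t, x) of (t, x) \<Rightarrow> Q (x + c) t\<bar> \<le> M" if "t \<in> {0..<T}" for t x
      using Q[OF that] by simp
    show "\<forall>\<^sub>F i in \<F>. \<forall>t\<in>{0..b}. \<forall>x.
        \<bar>(case i of (N, k) \<Rightarrow> \<lambda>(t, x). roe_approximation \<alpha> \<beta> (mesh_width N) k Q\<^sub>0 (x + c) t) (t, x)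
          - (case (t, x) of (t, x) \<Rightarrow> Q (x + c) t)\<bar> \<le> e"
      if b: "0 \<le> b" "b < T" and e: "0 < e" for b e
    proof -
      obtain \<delta> where \<delta>: "0 < \<delta>"
        "\<And>N k t x. \<lbrakk>mesh_width N < \<delta>; 0 < k; cfl_condition \<alpha> \<beta> T N k Q\<^sub>0; t \<in> {0..b}\<rbrakk>
          \<Longrightarrow> \<bar>roe_approximation \<alpha> \<beta> (mesh_width N) k Q\<^sub>0 x t - Q x t\<bar> \<le> e"
        by (rule uniform_convergence[OF b e]) blast
      show ?thesis using fine[OF \<delta>(1)] by eventually_elim (auto intro: \<delta>(2))
    qed
  qed
qed

end

lemma eventually_mesh_refinement:
  assumes "0 < \<delta>"
  shows "\<forall>\<^sub>F (N, k) in mesh_refinement \<gamma> T u\<^sub>0 \<rho>\<^sub>0. mesh_width N < \<delta> \<and> 0 < k \<and>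
    cfl_condition (alpha \<gamma>) (beta_plus \<gamma> u\<^sub>0 \<rho>\<^sub>0) T N k (F_init u\<^sub>0 \<rho>\<^sub>0) \<and>
    cfl_condition (alpha \<gamma>) (beta_minus \<gamma> u\<^sub>0 \<rho>\<^sub>0) T N k (B_init u\<^sub>0 \<rho>\<^sub>0)"
proof -
  have "\<forall>\<^sub>F h in at_right (0::real). h < \<delta>"
    unfolding eventually_at_right_field using assms by auto
  then show ?thesis
    unfolding mesh_refinement_def eventually_inf_principal eventually_filtercomap
    by (intro exI[of _ "\<lambda>h. h < \<delta>"]) auto
qed

theorem theorem2:
  fixes \<gamma> T s :: real and u\<^sub>0 \<rho>\<^sub>0 :: "real \<Rightarrow> real" and F B :: "real \<Rightarrow> real \<Rightarrow> real"
  assumes "0 < T"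
    and "u\<^sub>0 \<in> sobolev s" and "\<rho>\<^sub>0 \<in> sobolev s"
    and "conservation_law_solution (alpha \<gamma>) (beta_plus \<gamma> u\<^sub>0 \<rho>\<^sub>0) T s (F_init u\<^sub>0 \<rho>\<^sub>0) F"
    and "conservation_law_solution (alpha \<gamma>) (beta_minus \<gamma> u\<^sub>0 \<rho>\<^sub>0) T s (B_init u\<^sub>0 \<rho>\<^sub>0) B"
  shows "(2 \<le> s \<longrightarrow> (\<forall>\<tau>::real.
            tendsto_L1 (time_torus T)
              (\<lambda>(N, k) (t, x). U_of u\<^sub>0 (F_num \<gamma> u\<^sub>0 \<rho>\<^sub>0 N k) (B_num \<gamma> u\<^sub>0 \<rho>\<^sub>0 N k) x \<tau> t)
              (\<lambda>(t, x). U_of u\<^sub>0 F B x \<tau> t) (mesh_refinement \<gamma> T u\<^sub>0 \<rho>\<^sub>0) \<and>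
            tendsto_L1 (time_torus T)
              (\<lambda>(N, k) (t, x). R_of \<rho>\<^sub>0 (F_num \<gamma> u\<^sub>0 \<rho>\<^sub>0 N k) (B_num \<gamma> u\<^sub>0 \<rho>\<^sub>0 N k) x \<tau> t)
              (\<lambda>(t, x). R_of \<rho>\<^sub>0 F B x \<tau> t) (mesh_refinement \<gamma> T u\<^sub>0 \<rho>\<^sub>0))) \<and>
         (3 \<le> s \<longrightarrow> (\<forall>T'.
            T' < T \<or>
            T' = T \<and> (\<exists>M. \<forall>t\<in>{0..<T}. sobolev_norm s (\<lambda>x. F x t) \<le> M \<and>
                                        sobolev_norm s (\<lambda>x. B x t) \<le> M) \<longrightarrow>
            first_order_accurate (alpha \<gamma>) (beta_plus \<gamma> u\<^sub>0 \<rho>\<^sub>0) T' F \<and>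
            first_order_accurate (alpha \<gamma>) (beta_minus \<gamma> u\<^sub>0 \<rho>\<^sub>0) T' B))"
proof -
  have init: "F_init u\<^sub>0 \<rho>\<^sub>0 \<in> borel_measurable borel" "B_init u\<^sub>0 \<rho>\<^sub>0 \<in> borel_measurable borel"
    using sobolevD(1)[OF assms(2)] sobolevD(1)[OF assms(3)]
    unfolding F_init_def[abs_def] B_init_def[abs_def] by measurable
  have F: "smooth_solution (alpha \<gamma>) (beta_plus \<gamma> u\<^sub>0 \<rho>\<^sub>0) T s (F_init u\<^sub>0 \<rho>\<^sub>0) F"
    and B: "smooth_solution (alpha \<gamma>) (beta_minus \<gamma> u\<^sub>0 \<rho>\<^sub>0) T s (B_init u\<^sub>0 \<rho>\<^sub>0) B" if "2 \<le> s"
    using assms init that by (simp_all add: smooth_solution_def)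
  let ?\<F> = "mesh_refinement \<gamma> T u\<^sub>0 \<rho>\<^sub>0"
  have convergence: "tendsto_L1 (time_torus T)
        (\<lambda>(N, k) (t, x). U_of u\<^sub>0 (F_num \<gamma> u\<^sub>0 \<rho>\<^sub>0 N k) (B_num \<gamma> u\<^sub>0 \<rho>\<^sub>0 N k) x \<tau> t)
        (\<lambda>(t, x). U_of u\<^sub>0 F B x \<tau> t) ?\<F> \<and>
      tendsto_L1 (time_torus T)
        (\<lambda>(N, k) (t, x). R_of \<rho>\<^sub>0 (F_num \<gamma> u\<^sub>0 \<rho>\<^sub>0 N k) (B_num \<gamma> u\<^sub>0 \<rho>\<^sub>0 N k) x \<tau> t)
        (\<lambda>(t, x). R_of \<rho>\<^sub>0 F B x \<tau> t) ?\<F>"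
    if s: "2 \<le> s" for \<tau>
  proof -
    have F_lim: "tendsto_L1 (time_torus T) (\<lambda>(N, k) (t, x). F_num \<gamma> u\<^sub>0 \<rho>\<^sub>0 N k (x + - \<tau>) t)
        (\<lambda>(t, x). F (x + - \<tau>) t) ?\<F>"
      unfolding F_num_def
      by (rule smooth_solution.shifted_L1_convergence[OF F[OF s]])
         (use eventually_mesh_refinement in \<open>force elim!: eventually_mono\<close>)
    have B_lim: "tendsto_L1 (time_torus T) (\<lambda>(N, k) (t, x). B_num \<gamma> u\<^sub>0 \<rho>\<^sub>0 N k (x + \<tau>) t)
        (\<lambda>(t, x). B (x + \<tau>) t) ?\<F>"
      unfolding B_num_def
      by (rule smooth_solution.shifted_L1_convergence[OF B[OF s]])
         (use eventually_mesh_refinement in \<open>force elim!: eventually_mono\<close>)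
    interpret finite_measure "time_torus T" by (rule finite_measure_time_torus)
    have const: "tendsto_L1 (time_torus T) (\<lambda>i z. c) (\<lambda>z. c) ?\<F>" for c :: real
      by (rule tendsto_L1_const) simp
    show ?thesis
    proof
      from tendsto_L1_add[OF tendsto_L1_add[OF F_lim B_lim] const[of "torus_integral u\<^sub>0 / (2 * pi)"]]
      show "tendsto_L1 (time_torus T)
          (\<lambda>(N, k) (t, x). U_of u\<^sub>0 (F_num \<gamma> u\<^sub>0 \<rho>\<^sub>0 N k) (B_num \<gamma> u\<^sub>0 \<rho>\<^sub>0 N k) x \<tau> t)
          (\<lambda>(t, x). U_of u\<^sub>0 F B x \<tau> t) ?\<F>"
        by (simp add: U_of_def split_beta' cong: if_cong)
      from tendsto_L1_add[OF tendsto_L1_add[OF F_lim tendsto_L1_uminus[OF B_lim]]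
          const[of "torus_integral \<rho>\<^sub>0 / (2 * pi)"]]
      show "tendsto_L1 (time_torus T)
          (\<lambda>(N, k) (t, x). R_of \<rho>\<^sub>0 (F_num \<gamma> u\<^sub>0 \<rho>\<^sub>0 N k) (B_num \<gamma> u\<^sub>0 \<rho>\<^sub>0 N k) x \<tau> t)
          (\<lambda>(t, x). R_of \<rho>\<^sub>0 F B x \<tau> t) ?\<F>"
        by (simp add: R_of_def split_beta')
    qed
  qed
  have accuracy: "first_order_accurate (alpha \<gamma>) (beta_plus \<gamma> u\<^sub>0 \<rho>\<^sub>0) T' F \<and>
      first_order_accurate (alpha \<gamma>) (beta_minus \<gamma> u\<^sub>0 \<rho>\<^sub>0) T' B"
    if s: "3 \<le> s" and T': "T' < T \<or> T' = T \<and> (\<exists>M. \<forall>t\<in>{0..<T}. sobolev_norm s (\<lambda>x. F x t) \<le> M \<and>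
        sobolev_norm s (\<lambda>x. B x t) \<le> M)" for T'
  proof -
    have s2: "2 \<le> s" using s by simp
    interpret F: smooth_solution "alpha \<gamma>" "beta_plus \<gamma> u\<^sub>0 \<rho>\<^sub>0" T s "F_init u\<^sub>0 \<rho>\<^sub>0" F by (rule F[OF s2])
    interpret B: smooth_solution "alpha \<gamma>" "beta_minus \<gamma> u\<^sub>0 \<rho>\<^sub>0" T s "B_init u\<^sub>0 \<rho>\<^sub>0" B by (rule B[OF s2])
    have "\<exists>M. \<forall>t\<in>{0..<T'}. sobolev_norm s (\<lambda>x. F x t) \<le> M \<and> sobolev_norm s (\<lambda>x. B x t) \<le> M"
      using T'
    proof
      assume less: "T' < T"
      obtain M1 where "\<And>t. t \<in> {0..T'} \<Longrightarrow> sobolev_norm s (\<lambda>x. F x t) \<le> M1"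
        by (rule F.sobolev_norm_locally_bounded[OF less]) blast
      moreover obtain M2 where "\<And>t. t \<in> {0..T'} \<Longrightarrow> sobolev_norm s (\<lambda>x. B x t) \<le> M2"
        by (rule B.sobolev_norm_locally_bounded[OF less]) blast
      ultimately have "\<forall>t\<in>{0..<T'}. sobolev_norm s (\<lambda>x. F x t) \<le> max M1 M2 \<and>
          sobolev_norm s (\<lambda>x. B x t) \<le> max M1 M2"
        by (simp add: le_max_iff_disj)
      then show ?thesis by blast
    qed simp
    then obtain M where "\<And>t. t \<in> {0..<T'} \<Longrightarrow> sobolev_norm s (\<lambda>x. F x t) \<le> M"
      "\<And>t. t \<in> {0..<T'} \<Longrightarrow> sobolev_norm s (\<lambda>x. B x t) \<le> M" by blast
    moreover have "T' \<le> T" using T' by auto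
    ultimately show ?thesis
      using F.first_order_accurate_of_bounded_norm[OF s] B.first_order_accurate_of_bounded_norm[OF s] by blast
  qed
  show ?thesis using convergence accuracy by blast
qed

end
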